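(* Let $G$ be a finite metanilpotent group. Then the following statements are equivalent: (1) $G$ is supersoluble; (2) every Sylow subgroup of $G$ is strongly permuteral in $G$; (3) every Sylow subgroup of $G$ is permuteral in $G$.
   Context: All groups are finite. For a subgroup $H$ of a group $G$, the permutizer of $H$ in $G$ is the subgroup $P_G(H)=\langle x\in G \mid \langle x\rangle H=H\langle x\rangle\rangle$. A subgroup $H$ of $G$ is permuteral in $G$ if $P_G(H)=G$, and strongly permuteral in $G$ if $P_U(H)=U$ for every subgroup $U$ with $H\leq U\leq G$. A group is metanilpotent if it has nilpotent length at most $2$, i.e. it has a nilpotent normal subgroup with nilpotent quotient. *)

theory Defs
  imports "HOL-Algebra.Algebra"
begin

definition group_center :: "('a, 'b) monoid_scheme \<Rightarrow> 'a set" where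
  "group_center G = {z \<in> carrier G. \<forall>g \<in> carrier G. z \<otimes>\<^bsub>G\<^esub> g = g \<otimes>\<^bsub>G\<^esub> z}"

text \<open>As for \<open>solvable_seq\<close> in the library, a series is encoded by an inductive predicate:
  \<open>central_seq G H\<close> says that \<open>H\<close> is the top of a finite chain, starting at the trivial subgroup,
  of normal subgroups of \<open>G\<close>, each step \<open>K \<subseteq> H\<close> of which satisfies \<open>H/K \<le> Z(G/K)\<close>.
  A group is nilpotent if such a chain reaches the whole group.\<close>

inductive central_seq :: "('a, 'b) monoid_scheme \<Rightarrow> 'a set \<Rightarrow> bool"
  for G where
    unity: "central_seq G {\<one>\<^bsub>G\<^esub>}"
  | extension: "\<lbrakk> central_seq G K; K \<lhd> G; H \<lhd> G; K \<subseteq> H;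
                  carrier ((G \<lparr> carrier := H \<rparr>) Mod K) \<subseteq> group_center (G Mod K) \<rbrakk>
                \<Longrightarrow> central_seq G H"

definition nilpotent_group :: "('a, 'b) monoid_scheme \<Rightarrow> bool" where
  "nilpotent_group G \<longleftrightarrow> central_seq G (carrier G)"

definition metanilpotent :: "('a, 'b) monoid_scheme \<Rightarrow> bool" where
  "metanilpotent G \<longleftrightarrow>
     (\<exists>N. N \<lhd> G \<and> nilpotent_group (G \<lparr> carrier := N \<rparr>) \<and> nilpotent_group (G Mod N))"

text \<open>The same encoding of series; all terms are normal in the whole group \<open>G\<close>, not only in
  the next term, and the factors are cyclic.\<close>

inductive supersoluble_seq :: "('a, 'b) monoid_scheme \<Rightarrow> 'a set \<Rightarrow> bool"
  for G where
    unity: "supersoluble_seq G {\<one>\<^bsub>G\<^esub>}"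
  | extension: "\<lbrakk> supersoluble_seq G K; K \<lhd> G; H \<lhd> G; K \<subseteq> H;
                  cyclic_group ((G \<lparr> carrier := H \<rparr>) Mod K) \<rbrakk>
                \<Longrightarrow> supersoluble_seq G H"

definition supersoluble :: "('a, 'b) monoid_scheme \<Rightarrow> bool" where
  "supersoluble G \<longleftrightarrow> supersoluble_seq G (carrier G)"

text \<open>The prime is not required to divide the order of \<open>G\<close>, so the trivial subgroup is
  a Sylow subgroup for every other prime.\<close>

definition sylow_subgroup :: "'a set \<Rightarrow> ('a, 'b) monoid_scheme \<Rightarrow> bool" where
  "sylow_subgroup P G \<longleftrightarrow>
     subgroup P G \<and> (\<exists>p::nat. Factorial_Ring.prime p \<and> card P = p ^ multiplicity p (order G))"

definition permutizer :: "('a, 'b) monoid_scheme \<Rightarrow> 'a set \<Rightarrow> 'a set" where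
  "permutizer G H =
     generate G {x \<in> carrier G. generate G {x} <#>\<^bsub>G\<^esub> H = H <#>\<^bsub>G\<^esub> generate G {x}}"

definition permuteral :: "'a set \<Rightarrow> ('a, 'b) monoid_scheme \<Rightarrow> bool" where
  "permuteral H G \<longleftrightarrow> subgroup H G \<and> permutizer G H = carrier G"

definition strongly_permuteral :: "'a set \<Rightarrow> ('a, 'b) monoid_scheme \<Rightarrow> bool" where
  "strongly_permuteral H G \<longleftrightarrow>
     subgroup H G \<and>
     (\<forall>U. subgroup U G \<and> H \<subseteq> U \<longrightarrow> permutizer (G \<lparr> carrier := U \<rparr>) H = U)"

end

theory Submission
  imports Defs "HOL-Number_Theory.Residue_Primitive_Roots"
begin

text \<open>Let \<open>F\<close> be a nilpotent normal subgroup with nilpotent quotient. The only consequence of nilpotency that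
  is needed, apart from one central step above \<open>F\<close>, is that elements of coprime order commute in
  \<open>F\<close> and in \<open>G/F\<close>; this property passes to subgroups and gives \<open>G = F N(P)\<close> for every Sylow subgroup \<open>P\<close>.

  If \<open>G\<close> is supersoluble, it therefore suffices to generate \<open>F\<close> by elements permuting with the Sylow
  \<open>p\<close>-subgroup \<open>P\<close>. A \<open>G\<close>-invariant \<open>q\<close>-subgroup \<open>T \<noteq> 1\<close> of \<open>F\<close> has a \<open>G\<close>-invariant subgroup \<open>S\<close> of index \<open>q\<close>, and
  a counting argument modulo \<open>p\<close> gives a \<open>P\<close>-invariant cyclic subgroup of \<open>T\<close> outside \<open>S\<close>.

  Conversely, let a Sylow \<open>q\<close>-subgroup \<open>Q\<close> be permuteral, and let \<open>R\<close> be the Sylow \<open>p\<close>-subgroup of \<open>F\<close>, \<open>p \<noteq> q\<close>.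
  The elements \<open>D\<close> of \<open>Q\<close> that centralize every cyclic \<open>Q\<close>-invariant subgroup of \<open>R\<close> contain all
  commutators and \<open>(p - 1)\<close>-st powers of \<open>Q\<close>. If \<open>H = \<langle>x\<rangle>Q\<close> is a subgroup, then \<open>H \<inter> R\<close> is such a cyclic
  subgroup, so \<open>H\<close> normalizes \<open>DB\<close> for the \<open>p\<close>-complement \<open>B\<close> of \<open>F\<close>. Hence \<open>DB\<close> is normal in \<open>G\<close> and \<open>D\<close>
  centralizes \<open>R\<close>. Thus \<open>G\<close> acts on each chief factor below \<open>R\<close> as an abelian group of exponent dividing
  \<open>p - 1\<close>, so by scalars, and the factor has order \<open>p\<close>.\<close>

section \<open>Fixed points, Sylow subgroups and normalizers\<close>

text \<open>The shape of the proof comes from what is inherited. Permuterality is exploited in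
  \<open>G\<close> alone, to make \<open>BD\<close> normal. What results is a normal subgroup
  \<open>E\<close> with \<open>G/E\<close> abelian of exponent dividing \<open>p - 1\<close>,
  described by equations that survive every projection, so chief factors higher up need no new
  argument.

  \<open>B\<close> appears because an element of \<open>H\<close> factors by Frattini as
  \<open>r b n\<close>, with \<open>r\<close> in \<open>R\<close>, \<open>b\<close> in
  \<open>B\<close> and \<open>n\<close> normalizing \<open>Q\<close>. \<open>D\<close> is normalized
  by \<open>r\<close> and \<open>n\<close>, but perhaps not by \<open>b\<close>. Enlarging
  \<open>D\<close> to \<open>BD\<close> does no harm: its elements have order prime to
  \<open>p\<close>, so it still meets \<open>R\<close> trivially.

  The number \<open>p - 1\<close> is Euler's: the automorphisms of a cyclic group of order
  \<open>p ^ k\<close> form an abelian group of order \<open>(p - 1) p ^ (k - 1)\<close>, and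
  \<open>Q\<close> has order prime to \<open>p\<close>. The Sylow \<open>p\<close>-subgroup of
  \<open>G\<close> escapes this argument. It is put into \<open>E\<close>, and as a
  \<open>p\<close>-group it fixes a nontrivial element of every \<open>p\<close>-factor.

  For strong permuterality, the series of \<open>G\<close> is not carried over to a subgroup
  \<open>U\<close>; instead \<open>U\<close> acts on the traces that the series leaves on its own
  normal subgroups.\<close>

lemma coprime_nat_bezout:
  fixes m n :: nat
  assumes "coprime m n" "n \<noteq> 1"
  obtains j k where "m * j = n * k + 1"
proof (cases "n = 0")
  case True
  then show ?thesis using that[of 1 0] assms by simp
next
  case False
  then have "n > 1" using assms by simp
  obtain j where "[m * j = 1] (mod n)"
    using assms(1) cong_solve_coprime_nat by auto
  then have "m * j mod n = 1" using \<open>n > 1\<close> by (simp add: cong_def)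
  then have "m * j = n * (m * j div n) + 1" by (metis mult_div_mod_eq)
  then show ?thesis using that by blast
qed

context group
begin

lemma inv_cancel_left: "x \<in> carrier G \<Longrightarrow> y \<in> carrier G \<Longrightarrow> inv x \<otimes> (x \<otimes> y) = y"
  by (simp flip: m_assoc)

lemma inv_cancel_right: "x \<in> carrier G \<Longrightarrow> y \<in> carrier G \<Longrightarrow> x \<otimes> (inv x \<otimes> y) = y"
  by (simp flip: m_assoc)

lemmas group_normalize = m_assoc inv_mult_group inv_cancel_left inv_cancel_right

lemma subgroup_conj_closed:
  assumes "subgroup H G" "g \<in> H" "h \<in> H"
  shows "g \<otimes> h \<otimes> inv g \<in> H"
  using assms by (simp add: subgroup.m_closed subgroup.m_inv_closed)

lemma subgroup_nat_pow_closed: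
  assumes "subgroup H G" "x \<in> H"
  shows "x [^] (n::nat) \<in> H"
  using assms by (induction n) (auto simp: subgroup.one_closed subgroup.m_closed)

lemma conj_mult:
  assumes "g \<in> carrier G" "x \<in> carrier G" "y \<in> carrier G"
  shows "g \<otimes> (x \<otimes> y) \<otimes> inv g = (g \<otimes> x \<otimes> inv g) \<otimes> (g \<otimes> y \<otimes> inv g)"
proof -
  have "inv g \<otimes> (g \<otimes> (y \<otimes> inv g)) = y \<otimes> inv g"
    using assms by (simp flip: m_assoc)
  then show ?thesis using assms by (simp add: m_assoc)
qed

lemma conj_pow:
  assumes "g \<in> carrier G" "x \<in> carrier G"
  shows "g \<otimes> x [^] (n::nat) \<otimes> inv g = (g \<otimes> x \<otimes> inv g) [^] n"
proof (induction n)
  case (Suc n)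
  then show ?case using assms by (simp add: conj_mult)
qed (use assms in simp)

lemma conj_conj:
  assumes "g \<in> carrier G" "h \<in> carrier G" "x \<in> carrier G"
  shows "g \<otimes> (h \<otimes> x \<otimes> inv h) \<otimes> inv g = (g \<otimes> h) \<otimes> x \<otimes> inv (g \<otimes> h)"
  using assms by (simp add: m_assoc inv_mult_group)

lemma conj_fixed_iff:
  assumes "g \<in> carrier G" "x \<in> carrier G"
  shows "g \<otimes> x \<otimes> inv g = x \<longleftrightarrow> g \<otimes> x = x \<otimes> g"
  using assms by (metis inv_solve_right m_closed)

text \<open>By Bezout \<open>x\<close> is a product of a power of \<open>x [^] m\<close> and an
  inverse power of \<open>x [^] n\<close>. Coprime orders are exploited in this form throughout,
  with \<open>H\<close> a trivial group, a centralizer or a complement. The case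
  \<open>n = 1\<close> is separate because Bezout with natural coefficients fails for
  \<open>m = 0\<close>, \<open>n = 1\<close>.\<close>

lemma coprime_pow_mem:
  assumes "subgroup H G" "x \<in> carrier G" "x [^] (m::nat) \<in> H" "x [^] (n::nat) \<in> H" "coprime m n"
  shows "x \<in> H"
proof (cases "n = 1")
  case True
  then show ?thesis using assms by simp
next
  case False
  then obtain j k where jk: "m * j = n * k + 1"
    using coprime_nat_bezout assms(5) by blast
  have a: "x [^] (m * j) \<in> H" "x [^] (n * k) \<in> H"
    using assms subgroup_nat_pow_closed by (simp_all flip: nat_pow_pow)
  have "x [^] (m * j) = x [^] (n * k) \<otimes> x"
    using assms jk by simp
  then have "x = inv (x [^] (n * k)) \<otimes> x [^] (m * j)"
    using assms by (simp add: inv_solve_left)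
  then show ?thesis
    using a assms(1) by (metis subgroup.m_closed subgroup.m_inv_closed)
qed

text \<open>One inclusion is demanded. For a subgroup of a finite group, conjugation by
  \<open>g\<close> is injective and hence maps \<open>H\<close> onto \<open>H\<close>, so this is
  the normalizer; closure under inverses rests on that.\<close>

definition normalizing :: "'a set \<Rightarrow> 'a set" where
  "normalizing H = {g \<in> carrier G. \<forall>h\<in>H. g \<otimes> h \<otimes> inv g \<in> H}"

lemma subgroup_le_normalizing:
  assumes "subgroup H G"
  shows "H \<subseteq> normalizing H"
  using subgroup_conj_closed[OF assms] subgroup.subset[OF assms] unfolding normalizing_def by blast

lemma normalizing_subgroup:
  assumes "finite (carrier G)" "subgroup H G"
  shows "subgroup (normalizing H) G"
proof -
  have HG: "H \<subseteq> carrier G" using assms(2) subgroup.subset by blast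
  have fin: "finite H" using HG assms(1) finite_subset by blast
  have inv_mem: "inv g \<in> normalizing H" if g: "g \<in> normalizing H" for g
  proof -
    have gc: "g \<in> carrier G" using g by (simp add: normalizing_def)
    have "inj_on (\<lambda>h. g \<otimes> h \<otimes> inv g) H"
      using gc HG by (intro inj_onI) (simp add: subsetD)
    moreover have "(\<lambda>h. g \<otimes> h \<otimes> inv g) ` H \<subseteq> H"
      using g by (auto simp: normalizing_def)
    ultimately have img: "(\<lambda>h. g \<otimes> h \<otimes> inv g) ` H = H"
      using fin by (simp add: endo_inj_surj)
    have "inv g \<otimes> h \<otimes> inv (inv g) \<in> H" if h: "h \<in> H" for h
    proof -
      obtain k where k: "k \<in> H" "h = g \<otimes> k \<otimes> inv g" using img h by blast
      then have "inv g \<otimes> h \<otimes> inv (inv g) = k"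
        using gc HG conj_conj[of "inv g" g k] by (simp add: subsetD)
      then show ?thesis using k(1) by simp
    qed
    then show ?thesis using gc by (simp add: normalizing_def)
  qed
  show ?thesis
  proof (rule subgroupI)
    show "normalizing H \<noteq> {}"
      using subgroup_le_normalizing assms(2) subgroup.one_closed by blast
    show "a \<otimes> b \<in> normalizing H" if "a \<in> normalizing H" "b \<in> normalizing H" for a b
      using that HG by (simp add: normalizing_def subsetD flip: conj_conj)
  qed (use inv_mem in \<open>auto simp: normalizing_def\<close>)
qed

lemma normal_iff_normalizing:
  "subgroup H G \<Longrightarrow> H \<lhd> G \<longleftrightarrow> normalizing H = carrier G"
  by (auto simp: normal_inv_iff normalizing_def)

lemma normal_in_normalizing:
  assumes "finite (carrier G)" "subgroup H G"
  shows "H \<lhd> G\<lparr>carrier := normalizing H\<rparr>"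
proof -
  have s: "subgroup (normalizing H) G" using normalizing_subgroup assms by blast
  interpret N: group "G\<lparr>carrier := normalizing H\<rparr>" using s subgroup_imp_group by blast
  show ?thesis
  proof (rule N.normal_invI)
    show "subgroup H (G\<lparr>carrier := normalizing H\<rparr>)"
      using assms s subgroup_le_normalizing by (simp add: subgroup_incl)
  qed (use s in \<open>auto simp: m_inv_consistent normalizing_def\<close>)
qed

lemma coset_pow_index:
  assumes "B \<lhd> G" "x \<in> carrier G"
  shows "x [^] card (rcosets B) \<in> B"
proof -
  interpret B: normal B G by fact
  interpret Q: group "G Mod B" by (rule B.factorgroup_is_group)
  have "(B #> x) [^]\<^bsub>G Mod B\<^esub> order (G Mod B) = \<one>\<^bsub>G Mod B\<^esub>"
    using assms(2) by (intro Q.pow_order_eq_1) (auto simp: carrier_FactGroup)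
  then have "B #> x [^] order (G Mod B) = B"
    using assms(2) by (simp add: B.FactGroup_pow)
  then have "x [^] order (G Mod B) \<in> B"
    using assms(2) by (metis B.subgroup_axioms nat_pow_closed rcos_self)
  then show ?thesis by (simp add: order_def FactGroup_def)
qed

definition sylow_sub :: "nat \<Rightarrow> 'a set \<Rightarrow> bool" where
  "sylow_sub p P \<longleftrightarrow> subgroup P G \<and> card P = p ^ multiplicity p (order G)"

lemma sylow_sub_exists:
  assumes "finite (carrier G)" "Factorial_Ring.prime p"
  shows "\<exists>P. sylow_sub p P"
proof -
  have "p ^ multiplicity p (order G) dvd order G" by (rule multiplicity_dvd)
  then obtain m where m: "order G = p ^ multiplicity p (order G) * m" by (rule dvdE)
  show ?thesis
    unfolding sylow_sub_def by (rule sylow_thm[OF assms(2) is_group m assms(1)])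
qed

lemma card_dvd_order: "subgroup H G \<Longrightarrow> card H dvd order G"
  using lagrange by (metis dvd_triv_right)

lemma card_pos:
  assumes "finite (carrier G)" "subgroup H G"
  shows "card H > 0"
  using assms by (metis card_gt_0_iff finite_subset subgroup.subset subgroup_nonempty)

lemma order_pos: "finite (carrier G) \<Longrightarrow> order G > 0"
  by (simp add: order_gt_0_iff_finite)

text \<open>Every prime power exactly dividing \<open>order G\<close> divides \<open>card H\<close>.
  Whenever a property cuts out a subgroup, it thus holds on all of \<open>G\<close> once it is
  checked on one freely chosen Sylow subgroup per prime.\<close>

lemma subgroup_with_sylows:
  assumes "finite (carrier G)" "subgroup H G"
    and "\<And>r. Factorial_Ring.prime r \<Longrightarrow> \<exists>Q\<subseteq>H. sylow_sub r Q"
  shows "H = carrier G"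
proof -
  have fin: "finite H" using assms by (meson finite_subset subgroup.subset)
  have o: "order G \<noteq> 0" using order_pos assms(1) by simp
  have "multiplicity r (order G) \<le> multiplicity r (card H)" if r: "Factorial_Ring.prime r" for r
  proof -
    obtain Q where Q: "Q \<subseteq> H" "sylow_sub r Q" using assms(3) r by blast
    then have "subgroup Q (G\<lparr>carrier := H\<rparr>)"
      using assms(2) by (simp add: subgroup_incl sylow_sub_def)
    then have "card Q dvd card H"
      using group.card_dvd_order[OF subgroup_imp_group[OF assms(2)]] by (simp add: order_def)
    then show ?thesis using Q(2) card_pos[OF assms(1,2)] r
      by (intro multiplicity_geI) (auto simp: sylow_sub_def prime_gt_Suc_0_nat)
  qed
  then have "order G dvd card H"
    using card_pos[OF assms(1,2)] o by (intro multiplicity_le_imp_dvd) auto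
  then have "order G \<le> card H" using card_pos[OF assms(1,2)] by (simp add: dvd_imp_le)
  then show ?thesis
    using assms by (metis card_seteq order_def subgroup.subset)
qed

lemma sylow_sub_not_dvd_index:
  assumes "finite (carrier G)" "Factorial_Ring.prime p" "sylow_sub p P"
    and "subgroup H G" "P \<subseteq> H"
  shows "\<not> p dvd card (rcosets\<^bsub>G\<lparr>carrier := H\<rparr>\<^esub> P)"
proof
  assume d: "p dvd card (rcosets\<^bsub>G\<lparr>carrier := H\<rparr>\<^esub> P)"
  have "subgroup P (G\<lparr>carrier := H\<rparr>)"
    using assms by (simp add: subgroup_incl sylow_sub_def)
  then have "card (rcosets\<^bsub>G\<lparr>carrier := H\<rparr>\<^esub> P) * card P = card H"
    using group.lagrange[OF subgroup_imp_group[OF assms(4)]] by (simp add: order_def)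
  then have "p * card P dvd order G"
    using d card_dvd_order[OF assms(4)] by (metis dvd_trans mult_dvd_mono dvd_refl)
  then have "p ^ Suc (multiplicity p (order G)) dvd order G"
    using assms(3) by (simp add: sylow_sub_def)
  then show False
    using order_pos[OF assms(1)] assms(2)
    by (metis Suc_n_not_le_n less_not_refl multiplicity_geI not_prime_unit)
qed

text \<open>The order of \<open>x\<close> modulo \<open>P\<close> divides both \<open>p ^ k\<close>
  and the index of \<open>P\<close> in its normalizer, which is prime to \<open>p\<close>.\<close>

lemma sylow_sub_absorb:
  assumes "finite (carrier G)" "Factorial_Ring.prime p" "sylow_sub p P"
    and "x \<in> normalizing P" "x [^] ((p::nat) ^ k) \<in> P"
  shows "x \<in> P"
proof -
  have P: "subgroup P G" using assms(3) by (simp add: sylow_sub_def)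
  let ?N = "G\<lparr>carrier := normalizing P\<rparr>"
  have N: "subgroup (normalizing P) G" using normalizing_subgroup assms(1) P by blast
  have "x [^]\<^bsub>?N\<^esub> card (rcosets\<^bsub>?N\<^esub> P) \<in> P"
    using group.coset_pow_index[OF subgroup_imp_group[OF N] normal_in_normalizing[OF assms(1) P]] assms(4)
    by simp
  then have "x [^] card (rcosets\<^bsub>?N\<^esub> P) \<in> P"
    by (simp flip: nat_pow_consistent)
  moreover have "coprime (p ^ k) (card (rcosets\<^bsub>?N\<^esub> P))"
    using sylow_sub_not_dvd_index[OF assms(1-3) N subgroup_le_normalizing[OF P]] assms(2)
    by (simp add: prime_imp_coprime coprime_power_left_iff)
  ultimately show ?thesis
    using coprime_pow_mem[OF P _ assms(5)] assms(4) by (auto simp: normalizing_def)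
qed

text \<open>Orbits of a \<open>p\<close>-group have \<open>p\<close>-power length, and without fixed
  points no length is 1. The action is a plain function with laws required on \<open>P\<close> and
  \<open>M\<close>, so that conjugation of elements or subgroups and translation of cosets all fit
  directly.\<close>

lemma prime_power_group_fixed_point:
  fixes act :: "'a \<Rightarrow> 'x \<Rightarrow> 'x"
  assumes P: "subgroup P G" and cP: "card P = p ^ k" and p: "Factorial_Ring.prime (p::nat)"
    and M: "finite M"
    and closed: "\<And>g x. g \<in> P \<Longrightarrow> x \<in> M \<Longrightarrow> act g x \<in> M"
    and one: "\<And>x. x \<in> M \<Longrightarrow> act \<one> x = x"
    and mult: "\<And>g h x. g \<in> P \<Longrightarrow> h \<in> P \<Longrightarrow> x \<in> M \<Longrightarrow> act (g \<otimes> h) x = act g (act h x)"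
    and nofix: "\<And>x. x \<in> M \<Longrightarrow> \<exists>g\<in>P. act g x \<noteq> x"
  shows "p dvd card M"
proof -
  let ?P = "G\<lparr>carrier := P\<rparr>"
  \<comment> \<open>Elements of \<open>BijGroup M\<close> are extensional functions, hence the
    restriction.\<close>
  let ?f = "\<lambda>g. restrict (act g) M"
  have inverse: "act (inv g) (act g x) = x" "act g (act (inv g) x) = x" if "g \<in> P" "x \<in> M" for g x
    using that one P by (simp_all flip: mult add: subgroup.m_inv_closed subgroup.mem_carrier[OF P])
  have bij: "bij_betw (?f g) M M" if "g \<in> P" for g
    by (rule bij_betw_byWitness[where f' = "?f (inv g)"])
      (use that inverse closed P in \<open>auto simp: subgroup.m_inv_closed\<close>)
  have "group_hom ?P (BijGroup M) ?f"
  proof (intro group_hom.intro group_hom_axioms.intro)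
    show "?f \<in> hom ?P (BijGroup M)"
    proof (rule homI)
      show "?f g \<in> carrier (BijGroup M)" if "g \<in> carrier ?P" for g
        using bij that by (simp add: BijGroup_def Bij_def)
      show "?f (g \<otimes>\<^bsub>?P\<^esub> h) = ?f g \<otimes>\<^bsub>BijGroup M\<^esub> ?f h"
        if "g \<in> carrier ?P" "h \<in> carrier ?P" for g h
        using bij that by (auto simp: BijGroup_def Bij_def compose_def mult closed)
    qed
  qed (use P group_BijGroup subgroup_imp_group in auto)
  then interpret act: group_action ?P M ?f by (rule group_action.intro)
  have "p dvd card orb" if orb: "orb \<in> orbits ?P M ?f" for orb
  proof -
    obtain x where x: "x \<in> M" "orb = orbit ?P ?f x" using orb unfolding orbits_def by blast
    have eq: "card orb * card (stabilizer ?P ?f x) = p ^ k"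
      using act.orbit_stabilizer_theorem x cP by (simp add: order_def)
    obtain g where g: "g \<in> P" "act g x \<noteq> x" using nofix x(1) by blast
    have "{x, act g x} \<subseteq> orb"
      using x(1) g(1) one subgroup.one_closed[OF P] unfolding x(2) orbit_def by force
    moreover have "orb \<subseteq> M" using orb act.orbits_coverture by blast
    then have fin: "finite orb" using M finite_subset by blast
    ultimately have "card {x, act g x} \<le> card orb" by (meson card_mono)
    then have "card orb \<noteq> 1" using g(2) by auto
    moreover have "card orb dvd p ^ k" using eq by (metis dvd_triv_left)
    then obtain i where "card orb = p ^ i" using p by (auto simp: divides_primepow_nat)
    ultimately show ?thesis by (cases i) auto
  qed
  then have "p dvd card (\<Union> (orbits ?P M ?f))"
    using act.orbits_coverture M act.disjoint_union by (intro dvd_partition) (simp_all, blast)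
  then show ?thesis by (simp add: act.orbits_coverture)
qed

text \<open>\<open>A\<close> permutes the cosets of \<open>B\<close> by right multiplication with
  inverses. Their number is prime to \<open>p\<close>, so some \<open>B #> g\<close> is fixed, which
  means that \<open>g\<close> conjugates \<open>A\<close> into \<open>B\<close>.\<close>

lemma prime_power_subgroup_conj_into:
  assumes A: "subgroup A G" "card A = p ^ k" and p: "Factorial_Ring.prime (p::nat)"
    and fin: "finite (carrier G)"
    and B: "subgroup B G" and index: "\<not> p dvd card (rcosets B)"
  shows "\<exists>g\<in>carrier G. \<forall>a\<in>A. g \<otimes> a \<otimes> inv g \<in> B"
proof -
  have AG: "A \<subseteq> carrier G" and BG: "B \<subseteq> carrier G" using A B subgroup.subset by auto
  have "\<exists>C\<in>rcosets B. \<forall>a\<in>A. C #> inv a = C"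
  proof (rule ccontr)
    assume no: "\<not> ?thesis"
    have "p dvd card (rcosets B)"
    proof (rule prime_power_group_fixed_point[OF A p, where act = "\<lambda>a C. C #> inv a"])
      show "finite (rcosets B)" using fin B by (simp add: rcosets_finite RCOSETS_def)
      show "C #> inv a \<in> rcosets B" if "a \<in> A" "C \<in> rcosets B" for a C
        using that AG BG by (auto simp: RCOSETS_def coset_mult_assoc subsetD)
      show "C #> inv \<one> = C" if "C \<in> rcosets B" for C
        using that BG by (auto simp: RCOSETS_def coset_mult_assoc subsetD)
      show "C #> inv (a \<otimes> b) = C #> inv b #> inv a" if "a \<in> A" "b \<in> A" "C \<in> rcosets B" for a b C
        using that AG BG by (auto simp: RCOSETS_def coset_mult_assoc subsetD inv_mult_group m_assoc)
    qed (use no in auto)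
    then show False using index by simp
  qed
  then obtain g where g: "g \<in> carrier G" "\<And>a. a \<in> A \<Longrightarrow> B #> g #> inv a = B #> g"
    by (auto simp: RCOSETS_def)
  have "g \<otimes> a \<otimes> inv g \<in> B" if a: "a \<in> A" for a
  proof -
    have aG: "a \<in> carrier G" using a AG by blast
    have "B #> (g \<otimes> a) = B #> g"
      using g(2)[of "inv a"] a aG g(1) BG A by (simp add: coset_mult_assoc subgroup.m_inv_closed)
    then have "g \<otimes> a \<in> B #> g"
      using rcos_self[OF _ B, of "g \<otimes> a"] g(1) aG by simp
    then obtain b where "b \<in> B" "g \<otimes> a = b \<otimes> g" by (auto simp: r_coset_def)
    then show ?thesis using g(1) BG by (simp add: m_assoc subsetD)
  qed
  then show ?thesis using g(1) by blast
qed


text \<open>The fibres of multiplication on pairs are parametrized by \<open>A \<inter> B\<close>: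
  from one pair \<open>(a, b)\<close> all others with the same product arise as
  \<open>(a \<otimes> c, inv c \<otimes> b)\<close>.\<close>

lemma card_set_mult:
  assumes A: "subgroup A G" and B: "subgroup B G" and fin: "finite (carrier G)"
  shows "card (A <#> B) * card (A \<inter> B) = card A * card B"
proof -
  have sub: "A \<subseteq> carrier G" "B \<subseteq> carrier G" using A B subgroup.subset by auto
  have finA: "finite A" "finite B" using sub fin finite_subset by auto
  let ?f = "\<lambda>(a, b). a \<otimes> b"
  have img: "?f ` (A \<times> B) = A <#> B" by (auto simp: set_mult_def)
  have fib: "card {u \<in> A \<times> B. ?f u = z} = card (A \<inter> B)" if z: "z \<in> A <#> B" for z
  proof -
    obtain a b where ab: "a \<in> A" "b \<in> B" "z = a \<otimes> b" using z by (auto simp: set_mult_def)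
    have abG: "a \<in> carrier G" "b \<in> carrier G" using ab sub by auto
    have "bij_betw (\<lambda>c. (a \<otimes> c, inv c \<otimes> b)) (A \<inter> B) {u \<in> A \<times> B. ?f u = z}"
    proof (rule bij_betwI')
      show "((a \<otimes> c, inv c \<otimes> b) = (a \<otimes> d, inv d \<otimes> b)) = (c = d)" if cd: "c \<in> A \<inter> B" "d \<in> A \<inter> B" for c d
      proof -
        have "c \<in> carrier G" "d \<in> carrier G" using cd sub by auto
        then show ?thesis using abG by auto
      qed
      show "(a \<otimes> c, inv c \<otimes> b) \<in> {u \<in> A \<times> B. ?f u = z}" if c: "c \<in> A \<inter> B" for c
      proof -
        have cG: "c \<in> carrier G" using c sub by auto
        have "a \<otimes> c \<otimes> (inv c \<otimes> b) = a \<otimes> b"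
          using cG abG by (simp add: group_normalize)
        then show ?thesis
          using c ab A B by (auto intro: subgroup.m_closed subgroup.m_inv_closed)
      qed
      show "\<exists>c\<in>A \<inter> B. u = (a \<otimes> c, inv c \<otimes> b)" if u: "u \<in> {u \<in> A \<times> B. ?f u = z}" for u
      proof -
        obtain x y where xy: "u = (x, y)" "x \<in> A" "y \<in> B" "x \<otimes> y = a \<otimes> b" using u ab by auto
        have xyG: "x \<in> carrier G" "y \<in> carrier G" using xy sub by auto
        let ?c = "inv a \<otimes> x"
        have "?c = inv a \<otimes> (x \<otimes> y) \<otimes> inv y" using abG xyG by (simp add: group_normalize)
        also have "\<dots> = b \<otimes> inv y" unfolding xy(4) using abG xyG by (simp add: group_normalize)
        finally have "?c = b \<otimes> inv y" .
        then have "?c \<in> A \<inter> B"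
          using subgroup.m_closed[OF A subgroup.m_inv_closed[OF A ab(1)] xy(2)]
            subgroup.m_closed[OF B ab(2) subgroup.m_inv_closed[OF B xy(3)]] by simp
        moreover have "x = a \<otimes> ?c" using abG xyG by (simp add: group_normalize)
        moreover have "inv ?c \<otimes> b = inv x \<otimes> (a \<otimes> b)" using abG xyG by (simp add: group_normalize)
        then have "y = inv ?c \<otimes> b"
          unfolding xy(4)[symmetric] using xyG by (simp add: group_normalize)
        ultimately show ?thesis using xy(1) by blast
      qed
    qed
    then show ?thesis by (rule bij_betw_same_card[symmetric])
  qed
  have "card (A \<times> B) = (\<Sum>z\<in>A <#> B. card {u \<in> A \<times> B. ?f u = z})"
    using sum.image_gen[of "A \<times> B" "\<lambda>_. 1::nat" ?f] finA img by simp
  then show ?thesis using fib by (simp add: card_cartesian_product)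
qed

section \<open>Nilpotency through elements of coprime order\<close>

lemma coset_eq_iff:
  assumes "subgroup K G" "x \<in> carrier G"
  shows "K #> x = K \<longleftrightarrow> x \<in> K"
  using assms by (metis coset_join1 coset_join2 rcos_self subgroup.subset)

text \<open>\<open>c\<close> is the commutator of \<open>x\<close> and \<open>y\<close> and commutes
  with both. Conjugating \<open>y\<close> by \<open>x [^] m\<close> gives
  \<open>c [^] m = \<one>\<close>; comparing the \<open>n\<close>-th powers of \<open>y\<close> and
  of its conjugate \<open>c \<otimes> y\<close> gives \<open>c [^] n = \<one>\<close>.\<close>

lemma commutator_trivial:
  assumes x: "x \<in> carrier G" and y: "y \<in> carrier G"
    and c: "c \<in> carrier G" "x \<otimes> y \<otimes> inv x = c \<otimes> y" "c \<otimes> x = x \<otimes> c" "c \<otimes> y = y \<otimes> c"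
    and pow: "x [^] (m::nat) = \<one>" "y [^] (n::nat) = \<one>" "coprime m n"
  shows "c = \<one>"
proof -
  have "x [^] k \<otimes> y \<otimes> inv (x [^] k) = c [^] k \<otimes> y" for k :: nat
  proof (induction k)
    case (Suc k)
    have "x [^] Suc k = x \<otimes> x [^] k" using x by (metis nat_pow_Suc2)
    then have "x [^] Suc k \<otimes> y \<otimes> inv (x [^] Suc k) = x \<otimes> (c [^] k \<otimes> y) \<otimes> inv x"
      using x y Suc by (simp flip: conj_conj)
    also have "\<dots> = (x \<otimes> c \<otimes> inv x) [^] k \<otimes> (c \<otimes> y)"
      using x y c(1,2) by (simp add: conj_mult conj_pow)
    also have "x \<otimes> c \<otimes> inv x = c" using x c conj_fixed_iff by metis
    finally show ?case using c(1) y by (simp add: m_assoc)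
  qed (use x y in simp)
  from this[of m] have "c [^] m = \<one>"
    using pow(1) y c(1) by simp
  moreover have "\<one> = (c \<otimes> y) [^] n"
    using conj_pow[OF x y, of n] pow(2) x c(2) by simp
  then have "c [^] n = \<one>"
    using pow_mult_distrib[OF c(4,1) y, of n] pow(2) c(1) by simp
  ultimately show ?thesis
    using coprime_pow_mem[OF triv_subgroup c(1), of m n] pow(3) by simp
qed

text \<open>For normal \<open>N\<close> elements of coprime order in \<open>G Mod N\<close> commute,
  which for finite \<open>G\<close> amounts to nilpotency of the quotient. Phrased inside
  \<open>G\<close>, it restricts to a subgroup by intersecting \<open>N\<close> with it, without
  quotients of subgroups.\<close>

definition coprime_commuting :: "'a set \<Rightarrow> bool" where
  "coprime_commuting N \<longleftrightarrow> (\<forall>x\<in>carrier G. \<forall>y\<in>carrier G. \<forall>m n::nat. coprime m n \<longrightarrow>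
     x [^] m \<in> N \<longrightarrow> y [^] n \<in> N \<longrightarrow> x \<otimes> y \<otimes> inv x \<otimes> inv y \<in> N)"

lemma group_hom_coset:
  assumes "K \<lhd> G"
  shows "group_hom G (G Mod K) (\<lambda>a. K #> a)"
  using assms by (intro group_hom.intro group_hom_axioms.intro)
    (auto simp: normal.factorgroup_is_group normal.r_coset_hom_Mod)

text \<open>Descent along the series: if the commutator lies in \<open>H\<close>, its coset is
  central in \<open>G Mod K\<close>, and \<open>commutator_trivial\<close> in that quotient puts it
  into the next smaller term \<open>K\<close>.\<close>

lemma central_seq_coprime_commutator:
  assumes "central_seq G H"
    and "x \<in> carrier G" "y \<in> carrier G" "x [^] (m::nat) = \<one>" "y [^] (n::nat) = \<one>" "coprime m n"
    and "x \<otimes> y \<otimes> inv x \<otimes> inv y \<in> H"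
  shows "x \<otimes> y \<otimes> inv x \<otimes> inv y = \<one>"
  using assms
proof (induction rule: central_seq.induct)
  case (extension K H)
  let ?c = "x \<otimes> y \<otimes> inv x \<otimes> inv y"
  interpret K: normal K G by fact
  interpret q: group_hom G "G Mod K" "\<lambda>a. K #> a" using group_hom_coset K.normal_axioms by blast
  have K: "subgroup K G" by (rule K.subgroup_axioms)
  have c: "?c \<in> carrier G" using extension by simp
  have "K #> ?c \<in> carrier ((G\<lparr>carrier := H\<rparr>) Mod K)"
    unfolding carrier_FactGroup r_coset_consistent
    by (rule image_eqI[OF refl]) (use extension.prems in simp)
  then have cent: "K #> ?c \<in> group_center (G Mod K)" using extension by blast
  have comm: "(K #> ?c) \<otimes>\<^bsub>G Mod K\<^esub> (K #> g) = (K #> g) \<otimes>\<^bsub>G Mod K\<^esub> (K #> ?c)" if "g \<in> carrier G" for g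
    using cent that unfolding group_center_def by (auto simp: carrier_FactGroup)
  have "x \<otimes> y \<otimes> inv x = ?c \<otimes> y" using extension.prems by (simp add: m_assoc)
  then have e: "K #> (x \<otimes> y \<otimes> inv x) = K #> (?c \<otimes> y)" by simp
  have "K #> ?c = \<one>\<^bsub>G Mod K\<^esub>"
  proof (rule q.H.commutator_trivial)
    show "(K #> x) \<otimes>\<^bsub>G Mod K\<^esub> (K #> y) \<otimes>\<^bsub>G Mod K\<^esub> inv\<^bsub>G Mod K\<^esub> (K #> x) = (K #> ?c) \<otimes>\<^bsub>G Mod K\<^esub> (K #> y)"
      using e extension.prems c by (simp del: mult_FactGroup flip: q.hom_mult q.hom_inv)
    show "(K #> x) [^]\<^bsub>G Mod K\<^esub> m = \<one>\<^bsub>G Mod K\<^esub>" "(K #> y) [^]\<^bsub>G Mod K\<^esub> n = \<one>\<^bsub>G Mod K\<^esub>"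
      using extension.prems coset_mult_one[OF K.subset] by (simp_all add: K.FactGroup_pow)
  qed (use extension.prems c comm in \<open>simp_all del: mult_FactGroup\<close>)
  then have "?c \<in> K" using coset_eq_iff[OF K c] by simp
  then show ?case using extension by blast
qed simp

lemma nilpotent_Mod_coprime_commuting:
  assumes "N \<lhd> G" "nilpotent_group (G Mod N)"
  shows "coprime_commuting N"
  unfolding coprime_commuting_def
proof (intro ballI allI impI)
  fix x y and m n :: nat
  assume a: "x \<in> carrier G" "y \<in> carrier G" "coprime m n" "x [^] m \<in> N" "y [^] n \<in> N"
  interpret N: normal N G by fact
  interpret q: group_hom G "G Mod N" "\<lambda>a. N #> a" using group_hom_coset assms(1) by blast
  let ?c = "x \<otimes> y \<otimes> inv x \<otimes> inv y"
  have c: "?c \<in> carrier G" using a by simp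
  have eq: "N #> ?c = (N #> x) \<otimes>\<^bsub>G Mod N\<^esub> (N #> y) \<otimes>\<^bsub>G Mod N\<^esub> inv\<^bsub>G Mod N\<^esub> (N #> x) \<otimes>\<^bsub>G Mod N\<^esub> inv\<^bsub>G Mod N\<^esub> (N #> y)"
    using a by (simp del: mult_FactGroup)
  have "\<dots> = \<one>\<^bsub>G Mod N\<^esub>"
  proof (rule q.H.central_seq_coprime_commutator[OF assms(2)[unfolded nilpotent_group_def]])
    show "(N #> x) [^]\<^bsub>G Mod N\<^esub> m = \<one>\<^bsub>G Mod N\<^esub>" "(N #> y) [^]\<^bsub>G Mod N\<^esub> n = \<one>\<^bsub>G Mod N\<^esub>"
      using a coset_eq_iff[OF N.subgroup_axioms] by (simp_all add: N.FactGroup_pow)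
  qed (use a in \<open>simp_all del: mult_FactGroup\<close>)
  then show "?c \<in> N" using coset_eq_iff[OF N.subgroup_axioms c] eq by simp
qed

lemma nilpotent_subgroup_coprime_commute:
  assumes "subgroup F G" "nilpotent_group (G\<lparr>carrier := F\<rparr>)"
    and "x \<in> F" "y \<in> F" "x [^] (m::nat) = \<one>" "y [^] (n::nat) = \<one>" "coprime m n"
  shows "x \<otimes> y = y \<otimes> x"
proof -
  interpret F: group "G\<lparr>carrier := F\<rparr>" using assms(1) subgroup_imp_group by blast
  have xy: "x \<in> carrier G" "y \<in> carrier G" using assms subgroup.mem_carrier by metis+
  have "x \<otimes> y \<otimes> inv x \<otimes> inv y \<in> F"
    using assms by (simp add: subgroup.m_closed subgroup.m_inv_closed)
  then have "x \<otimes> y \<otimes> inv x \<otimes> inv y = \<one>"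
    using F.central_seq_coprime_commutator[OF assms(2)[unfolded nilpotent_group_def], of x y m n] assms
    by (simp add: m_inv_consistent flip: nat_pow_consistent)
  then have "x \<otimes> y \<otimes> inv x \<otimes> inv y \<otimes> (y \<otimes> x) = y \<otimes> x" using xy by simp
  then show ?thesis using xy by (simp add: group_normalize)
qed

lemma conj_image_subgroup:
  assumes "subgroup P G" "g \<in> carrier G"
  shows "subgroup ((\<lambda>x. g \<otimes> x \<otimes> inv g) ` P) G" "card ((\<lambda>x. g \<otimes> x \<otimes> inv g) ` P) = card P"
proof -
  have "group_hom G G (\<lambda>x. g \<otimes> x \<otimes> inv g)"
    using assms(2) by (intro group_hom.intro group_hom_axioms.intro homI) (auto simp: conj_mult)
  then show "subgroup ((\<lambda>x. g \<otimes> x \<otimes> inv g) ` P) G"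
    using assms(1) group_hom.subgroup_img_is_subgroup by blast
  have "inj_on (\<lambda>x. g \<otimes> x \<otimes> inv g) P"
    using assms subgroup.mem_carrier[OF assms(1)] by (intro inj_onI) simp
  then show "card ((\<lambda>x. g \<otimes> x \<otimes> inv g) ` P) = card P" by (rule card_image)
qed

lemma subgroup_set_mult_normal:
  assumes "N \<lhd> G" "subgroup H G"
  shows "subgroup (N <#> H) G" "N \<subseteq> N <#> H" "H \<subseteq> N <#> H"
proof -
  interpret second_isomorphism_grp N G H
    using assms by (simp add: second_isomorphism_grp_def second_isomorphism_grp_axioms_def)
  show "subgroup (N <#> H) G" "N \<subseteq> N <#> H" "H \<subseteq> N <#> H"
    using normal_set_mult_subgroup H_contained_in_set_mult S_contained_in_set_mult by blast+
qed

lemma subgroup_pow_card: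
  assumes "subgroup H G" "x \<in> H"
  shows "x [^] card H = \<one>"
  using group.pow_order_eq_1[OF subgroup_imp_group[OF assms(1)], of x] assms(2)
  by (simp add: order_def flip: nat_pow_consistent)

lemma normal_mult_pow:
  assumes "N \<lhd> G" "x \<in> carrier G" "y \<in> N" "x [^] (m::nat) \<in> N"
  shows "(x \<otimes> y) [^] m \<in> N" "(y \<otimes> x) [^] m \<in> N"
proof -
  interpret N: normal N G by fact
  have N: "subgroup N G" by (rule N.subgroup_axioms)
  have y: "y \<in> carrier G" using assms by simp
  have e: "N #> z [^] m = (N #> z) [^]\<^bsub>G Mod N\<^esub> m" if "z \<in> carrier G" for z
    using that by (simp add: N.FactGroup_pow)
  have Ny: "N #> y = N" using coset_eq_iff[OF N y] assms by simp
  have "N #> (y \<otimes> x) = N #> x"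
    using coset_mult_assoc[OF N.subset y assms(2)] Ny by simp
  moreover have "x \<otimes> y \<otimes> inv x \<in> N" using assms N.inv_op_closed2 by simp
  then have "N #> (x \<otimes> y \<otimes> inv x \<otimes> x) = N #> x"
    using coset_mult_assoc[OF N.subset, of "x \<otimes> y \<otimes> inv x" x] assms(2) y
      coset_eq_iff[OF N, of "x \<otimes> y \<otimes> inv x"] by simp
  then have "N #> (x \<otimes> y) = N #> x"
    using assms(2) y by (simp add: group_normalize)
  ultimately have "N #> (x \<otimes> y) [^] m = N" "N #> (y \<otimes> x) [^] m = N"
    using e[of "x \<otimes> y"] e[of "y \<otimes> x"] e[of x] assms(2,4) y coset_eq_iff[OF N, of "x [^] m"] by simp_all
  then show "(x \<otimes> y) [^] m \<in> N" "(y \<otimes> x) [^] m \<in> N"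
    using coset_eq_iff[OF N] assms(2) y by simp_all
qed

end

section \<open>Groups with a nilpotent normal subgroup and nilpotent quotient\<close>

text \<open>Nilpotency enters through two conditions that a subgroup \<open>H\<close> inherits with
  \<open>F \<inter> H\<close>. The locale is used for \<open>G\<close>, for the groups
  \<open>\<langle>x\<rangle>Q\<close> and for the subgroups \<open>U\<close> in the definition of
  strong permuterality.\<close>

locale nilpotent_by_nilpotent = group +
  fixes F
  assumes fin: "finite (carrier G)"
    and normal_F: "F \<lhd> G"
    and quotient_commuting: "coprime_commuting F"
    and F_commute: "\<lbrakk>x \<in> F; y \<in> F; x [^] (m::nat) = \<one>; y [^] (n::nat) = \<one>; coprime m n\<rbrakk>
      \<Longrightarrow> x \<otimes> y = y \<otimes> x"
begin

lemma subgroup_F: "subgroup F G" using normal_F normal_imp_subgroup by blast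

lemma F_carrier: "x \<in> F \<Longrightarrow> x \<in> carrier G" using subgroup_F subgroup.mem_carrier by metis

text \<open>For prime \<open>p\<close> this is the Sylow \<open>p\<close>-subgroup of
  \<open>F\<close>. The description by elements makes invariance under conjugation immediate; that
  it is a subgroup follows from \<open>primary_sylow\<close>.\<close>

definition primary :: "nat \<Rightarrow> 'a set" where
  "primary p = {x \<in> F. \<exists>k. x [^] (p ^ k) = \<one>}"

text \<open>A Sylow \<open>p\<close>-subgroup \<open>S\<close> of \<open>F\<close> commutes
  elementwise with the Sylow subgroups of \<open>F\<close> for other primes, so \<open>F\<close>
  normalizes it, and a normalized Sylow subgroup absorbs all \<open>p\<close>-elements.\<close>

lemma primary_sylow:
  assumes p: "Factorial_Ring.prime p"
  shows "group.sylow_sub (G\<lparr>carrier := F\<rparr>) p (primary p)"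
proof -
  let ?F = "G\<lparr>carrier := F\<rparr>"
  interpret F: group ?F using subgroup_F subgroup_imp_group by blast
  have finF: "finite (carrier ?F)" using fin subgroup.subset[OF subgroup_F] finite_subset by auto
  obtain S where S: "F.sylow_sub p S" using F.sylow_sub_exists[OF finF p] by blast
  then have SF: "subgroup S ?F" and cS: "card S = p ^ multiplicity p (order ?F)"
    by (auto simp: F.sylow_sub_def)
  have S_sub: "S \<subseteq> F" using subgroup.subset[OF SF] by simp
  have Spow: "x [^] card S = \<one>" if "x \<in> S" for x
    using F.subgroup_pow_card[OF SF that] by (simp flip: nat_pow_consistent)
  have "F.normalizing S = carrier ?F"
  proof (rule F.subgroup_with_sylows[OF finF F.normalizing_subgroup[OF finF SF]])
    fix r :: nat assume r: "Factorial_Ring.prime r"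
    show "\<exists>Q\<subseteq>F.normalizing S. F.sylow_sub r Q"
    proof (cases "r = p")
      case True
      then show ?thesis using S F.subgroup_le_normalizing[OF SF] by blast
    next
      case False
      obtain Q where Q: "F.sylow_sub r Q" using F.sylow_sub_exists[OF finF r] by blast
      then have QF: "subgroup Q ?F" and cQ: "card Q = r ^ multiplicity r (order ?F)"
        by (auto simp: F.sylow_sub_def)
      have Q_sub: "Q \<subseteq> F" using subgroup.subset[OF QF] by simp
      have cop: "coprime (card Q) (card S)"
        using False p r by (simp add: cQ cS primes_coprime)
      have "a \<otimes> s \<otimes> inv a = s" if as: "a \<in> Q" "s \<in> S" for a s
      proof -
        have "a [^] card Q = \<one>"
          using F.subgroup_pow_card[OF QF as(1)] by (simp flip: nat_pow_consistent)
        then have "a \<otimes> s = s \<otimes> a"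
          using F_commute[of a s "card Q" "card S"] as Q_sub S_sub cop Spow by blast
        then show ?thesis using conj_fixed_iff[of a s] F_carrier as Q_sub S_sub by blast
      qed
      then have "Q \<subseteq> F.normalizing S"
        using Q_sub by (auto simp: F.normalizing_def m_inv_consistent[OF subgroup_F])
      then show ?thesis using Q by blast
    qed
  qed
  then have norm: "F.normalizing S = F" by simp
  have "primary p = S"
  proof
    show "S \<subseteq> primary p" using S_sub Spow cS by (auto simp: primary_def)
    show "primary p \<subseteq> S"
    proof
      fix x assume "x \<in> primary p"
      then obtain k where "x \<in> F" "x [^] (p ^ k) = \<one>" by (auto simp: primary_def)
      then show "x \<in> S"
        using F.sylow_sub_absorb[OF finF p S, of x k] norm subgroup.one_closed[OF SF]
        by (simp flip: nat_pow_consistent)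
    qed
  qed
  then show ?thesis using S by simp
qed

lemma primary_normal:
  assumes p: "Factorial_Ring.prime p"
  shows "primary p \<lhd> G"
proof (rule normal_invI)
  interpret F: group "G\<lparr>carrier := F\<rparr>" using subgroup_F subgroup_imp_group by blast
  show "subgroup (primary p) G"
    using primary_sylow[OF p] incl_subgroup[OF subgroup_F] by (simp add: F.sylow_sub_def)
  fix g x assume g: "g \<in> carrier G" and "x \<in> primary p"
  then obtain k where x: "x \<in> F" "x [^] (p ^ k) = \<one>" by (auto simp: primary_def)
  then have "(g \<otimes> x \<otimes> inv g) [^] (p ^ k) = \<one>"
    using conj_pow[of g x "p ^ k"] g F_carrier by simp
  then show "g \<otimes> x \<otimes> inv g \<in> primary p"
    using normal.inv_op_closed2[OF normal_F g x(1)] by (auto simp: primary_def)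
qed

lemma card_primary:
  assumes p: "Factorial_Ring.prime p"
  shows "\<exists>k. card (primary p) = p ^ k"
proof -
  interpret F: group "G\<lparr>carrier := F\<rparr>" using subgroup_F subgroup_imp_group by blast
  show ?thesis using primary_sylow[OF p] by (auto simp: F.sylow_sub_def)
qed

lemma subgroup_containing_primaries:
  assumes "subgroup H G" "\<And>p. Factorial_Ring.prime p \<Longrightarrow> primary p \<subseteq> H"
  shows "F \<subseteq> H"
proof -
  let ?F = "G\<lparr>carrier := F\<rparr>"
  interpret F: group ?F using subgroup_F subgroup_imp_group by blast
  have finF: "finite (carrier ?F)" using fin subgroup.subset[OF subgroup_F] finite_subset by auto
  have "subgroup (H \<inter> F) ?F"
    using assms(1) subgroup_F by (intro subgroup_incl subgroups_Inter_pair) auto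
  moreover have "\<exists>Q\<subseteq>H \<inter> F. F.sylow_sub r Q" if "Factorial_Ring.prime r" for r
    using primary_sylow[OF that] assms(2)[OF that] by (intro exI[of _ "primary r"]) (auto simp: primary_def)
  ultimately have "H \<inter> F = carrier ?F" by (rule F.subgroup_with_sylows[OF finF])
  then show ?thesis by auto
qed

text \<open>Modulo \<open>F\<close> this is the normality of Sylow subgroups in a nilpotent group:
  an element \<open>a\<close> of a Sylow \<open>r\<close>-subgroup, \<open>r \<noteq> p\<close>, and
  an element of \<open>P\<close> have their commutator in \<open>F\<close>, so \<open>a\<close>
  normalizes \<open>F <#> P\<close>.\<close>

lemma mult_sylow_normal:
  assumes p: "Factorial_Ring.prime p" and P: "sylow_sub p P"
  shows "F <#> P \<lhd> G"
proof -
  have PG: "subgroup P G" and cP: "card P = p ^ multiplicity p (order G)"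
    using P by (auto simp: sylow_sub_def)
  let ?L = "F <#> P"
  have L: "subgroup ?L G" "F \<subseteq> ?L" "P \<subseteq> ?L"
    using subgroup_set_mult_normal[OF normal_F PG] by auto
  have F_mult: "f \<otimes> l \<in> ?L" if "f \<in> F" "l \<in> ?L" for f l
    using that L by (meson subgroup.m_closed subsetD)
  have "normalizing ?L = carrier G"
  proof (rule subgroup_with_sylows[OF fin normalizing_subgroup[OF fin L(1)]])
    fix r :: nat assume r: "Factorial_Ring.prime r"
    show "\<exists>Q\<subseteq>normalizing ?L. sylow_sub r Q"
    proof (cases "r = p")
      case True
      then show ?thesis using P subgroup_le_normalizing[OF L(1)] L(3) by blast
    next
      case False
      obtain Q where Q: "sylow_sub r Q" using sylow_sub_exists[OF fin r] by blast
      then have QG: "subgroup Q G" and cQ: "card Q = r ^ multiplicity r (order G)"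
        by (auto simp: sylow_sub_def)
      have cop: "coprime (card Q) (card P)"
        using False p r by (simp add: cQ cP primes_coprime)
      have "a \<otimes> l \<otimes> inv a \<in> ?L" if a: "a \<in> Q" and l: "l \<in> ?L" for a l
      proof -
        obtain f u where fu: "f \<in> F" "u \<in> P" "l = f \<otimes> u" using l by (auto simp: set_mult_def)
        have car: "a \<in> carrier G" "f \<in> carrier G" "u \<in> carrier G"
          using a fu QG PG F_carrier subgroup.mem_carrier by metis+
        have "a [^] card Q \<in> F" "u [^] card P \<in> F"
          using subgroup_pow_card QG PG a fu subgroup.one_closed[OF subgroup_F] by simp_all
        then have "a \<otimes> u \<otimes> inv a \<otimes> inv u \<in> F"
          using quotient_commuting cop car unfolding coprime_commuting_def by blast
        moreover have "u \<in> ?L" using fu L by blast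
        ultimately have "a \<otimes> u \<otimes> inv a \<otimes> inv u \<otimes> u \<in> ?L"
          using F_mult by blast
        then have "a \<otimes> u \<otimes> inv a \<in> ?L" using car by (simp add: group_normalize)
        then show ?thesis
          using normal.inv_op_closed2[OF normal_F car(1) fu(1)] F_mult car fu(3)
          by (simp add: conj_mult)
      qed
      then have "Q \<subseteq> normalizing ?L"
        using subgroup.subset[OF QG] by (auto simp: normalizing_def)
      then show ?thesis using Q by blast
    qed
  qed
  then show ?thesis using normal_iff_normalizing[OF L(1)] by simp
qed

text \<open>The conjugate of \<open>P\<close> by \<open>g\<close> lies in the normal subgroup
  \<open>F <#> P\<close>, where some \<open>l\<close> conjugates it back into \<open>P\<close>. Thus
  \<open>l \<otimes> g\<close> normalizes \<open>P\<close>, and so does the factor of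
  \<open>l\<close> in \<open>P\<close>.\<close>

lemma frattini:
  assumes p: "Factorial_Ring.prime p" and P: "sylow_sub p P" and g: "g \<in> carrier G"
  obtains f n where "f \<in> F" "n \<in> normalizing P" "g = f \<otimes> n"
proof -
  have PG: "subgroup P G" and cP: "card P = p ^ multiplicity p (order G)"
    using P by (auto simp: sylow_sub_def)
  let ?L = "F <#> P"
  let ?A = "(\<lambda>x. g \<otimes> x \<otimes> inv g) ` P"
  interpret L: normal ?L G using mult_sylow_normal[OF p P] .
  have L: "subgroup ?L G" "P \<subseteq> ?L"
    using subgroup_set_mult_normal[OF normal_F PG] by auto
  interpret LG: group "G\<lparr>carrier := ?L\<rparr>" using L subgroup_imp_group by blast
  have "\<exists>l\<in>carrier (G\<lparr>carrier := ?L\<rparr>). \<forall>a\<in>?A. l \<otimes>\<^bsub>G\<lparr>carrier := ?L\<rparr>\<^esub> a \<otimes>\<^bsub>G\<lparr>carrier := ?L\<rparr>\<^esub> inv\<^bsub>G\<lparr>carrier := ?L\<rparr>\<^esub> l \<in> P"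
  proof (rule LG.prime_power_subgroup_conj_into)
    show "subgroup ?A (G\<lparr>carrier := ?L\<rparr>)"
      using L g L.inv_op_closed2 by (intro subgroup_incl conj_image_subgroup PG) auto
    show "card ?A = p ^ multiplicity p (order G)" using conj_image_subgroup(2)[OF PG g] cP by simp
    show "finite (carrier (G\<lparr>carrier := ?L\<rparr>))" using fin L.subset finite_subset by auto
    show "subgroup P (G\<lparr>carrier := ?L\<rparr>)" using subgroup_incl PG L by blast
    show "\<not> p dvd card (rcosets\<^bsub>G\<lparr>carrier := ?L\<rparr>\<^esub> P)"
      using sylow_sub_not_dvd_index[OF fin p P] L by blast
  qed (rule p)
  then obtain l where l: "l \<in> ?L" "\<And>u. u \<in> P \<Longrightarrow> l \<otimes> (g \<otimes> u \<otimes> inv g) \<otimes> inv l \<in> P"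
    by (auto simp: m_inv_consistent[OF L(1)])
  have lG: "l \<in> carrier G" using l L.subset by blast
  have n: "l \<otimes> g \<in> normalizing P"
    using l(2) lG g subgroup.mem_carrier[OF PG] by (simp add: normalizing_def conj_conj)
  obtain f u where fu: "f \<in> F" "u \<in> P" "l = f \<otimes> u" using l(1) by (auto simp: set_mult_def)
  have car: "f \<in> carrier G" "u \<in> carrier G" using fu F_carrier PG subgroup.mem_carrier by metis+
  have "g = (inv u \<otimes> inv f \<otimes> u) \<otimes> (inv u \<otimes> (l \<otimes> g))"
    using car g by (simp add: fu(3) group_normalize)
  moreover have "inv u \<otimes> inv f \<otimes> u \<in> F"
    using normal.inv_op_closed1[OF normal_F car(2)] fu(1) subgroup.m_inv_closed[OF subgroup_F] by blast
  moreover have "inv u \<otimes> (l \<otimes> g) \<in> normalizing P"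
    using n subgroup_le_normalizing[OF PG] subgroup.m_inv_closed[OF PG fu(2)]
      subgroup.m_closed[OF normalizing_subgroup[OF fin PG]] by blast
  ultimately show ?thesis using that by blast
qed

lemma restrict_subgroup:
  assumes H: "subgroup H G"
  shows "nilpotent_by_nilpotent (G\<lparr>carrier := H\<rparr>) (F \<inter> H)"
proof -
  interpret H: group "G\<lparr>carrier := H\<rparr>" using H subgroup_imp_group by blast
  show ?thesis
  proof (intro nilpotent_by_nilpotent.intro nilpotent_by_nilpotent_axioms.intro)
    show "group (G\<lparr>carrier := H\<rparr>)" by (rule H.is_group)
    show "finite (carrier (G\<lparr>carrier := H\<rparr>))" using fin H subgroup.subset finite_subset by fastforce
    show "F \<inter> H \<lhd> G\<lparr>carrier := H\<rparr>"
    proof (rule H.normal_invI)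
      show "subgroup (F \<inter> H) (G\<lparr>carrier := H\<rparr>)"
        using H subgroup_F by (intro subgroup_incl subgroups_Inter_pair) auto
      show "x \<otimes>\<^bsub>G\<lparr>carrier := H\<rparr>\<^esub> h \<otimes>\<^bsub>G\<lparr>carrier := H\<rparr>\<^esub> inv\<^bsub>G\<lparr>carrier := H\<rparr>\<^esub> x \<in> F \<inter> H"
        if "x \<in> carrier (G\<lparr>carrier := H\<rparr>)" "h \<in> F \<inter> H" for x h
        using that normal.inv_op_closed2[OF normal_F, of x h] subgroup_conj_closed[OF H, of x h]
          subgroup.mem_carrier[OF H, of x]
        by (simp add: m_inv_consistent[OF H])
    qed
    show "H.coprime_commuting (F \<inter> H)"
      unfolding H.coprime_commuting_def
    proof (intro ballI allI impI)
      fix x y and m n :: nat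
      assume a: "x \<in> carrier (G\<lparr>carrier := H\<rparr>)" "y \<in> carrier (G\<lparr>carrier := H\<rparr>)" "coprime m n"
        "x [^]\<^bsub>G\<lparr>carrier := H\<rparr>\<^esub> m \<in> F \<inter> H" "y [^]\<^bsub>G\<lparr>carrier := H\<rparr>\<^esub> n \<in> F \<inter> H"
      then have xy: "x \<in> H" "y \<in> H" "x \<in> carrier G" "y \<in> carrier G"
        using subgroup.mem_carrier[OF H] by auto
      have "x \<otimes> y \<otimes> inv x \<otimes> inv y \<in> F"
        using quotient_commuting a xy unfolding coprime_commuting_def by (auto simp flip: nat_pow_consistent)
      then show "x \<otimes>\<^bsub>G\<lparr>carrier := H\<rparr>\<^esub> y \<otimes>\<^bsub>G\<lparr>carrier := H\<rparr>\<^esub> inv\<^bsub>G\<lparr>carrier := H\<rparr>\<^esub> x \<otimes>\<^bsub>G\<lparr>carrier := H\<rparr>\<^esub> inv\<^bsub>G\<lparr>carrier := H\<rparr>\<^esub> y \<in> F \<inter> H"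
        using xy H by (simp add: m_inv_consistent subgroup.m_closed subgroup.m_inv_closed)
    qed
    fix x y and m n :: nat
    assume "x \<in> F \<inter> H" "y \<in> F \<inter> H" "x [^]\<^bsub>G\<lparr>carrier := H\<rparr>\<^esub> m = \<one>\<^bsub>G\<lparr>carrier := H\<rparr>\<^esub>"
        "y [^]\<^bsub>G\<lparr>carrier := H\<rparr>\<^esub> n = \<one>\<^bsub>G\<lparr>carrier := H\<rparr>\<^esub>" "coprime m n"
    then show "x \<otimes>\<^bsub>G\<lparr>carrier := H\<rparr>\<^esub> y = y \<otimes>\<^bsub>G\<lparr>carrier := H\<rparr>\<^esub> x"
      using F_commute[of x y m n] by (simp flip: nat_pow_consistent)
  qed
qed

text \<open>\<open>B\<close> is taken maximal among the normal subgroups of \<open>G\<close> inside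
  \<open>F\<close> whose elements have order prime to \<open>p\<close>. Maximality makes it swallow
  \<open>primary q\<close> for each \<open>q \<noteq> p\<close>, so \<open>primary p <#> B\<close>
  contains all primary parts and hence \<open>F\<close>.\<close>

lemma primary_complement:
  assumes p: "Factorial_Ring.prime p"
  obtains B where "B \<lhd> G" "B \<subseteq> F" "\<And>x. x \<in> B \<Longrightarrow> \<exists>m::nat. coprime m p \<and> x [^] m = \<one>"
    "\<And>f. f \<in> F \<Longrightarrow> \<exists>r\<in>primary p. \<exists>b\<in>B. f = r \<otimes> b"
proof -
  let ?good = "\<lambda>N. N \<lhd> G \<and> N \<subseteq> F \<and> (\<forall>x\<in>N. \<exists>m::nat. coprime m p \<and> x [^] m = \<one>)"
  define GG where "GG = {N. ?good N}"
  have "finite GG"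
    by (rule finite_subset[of _ "Pow F"])
      (use fin subgroup.subset[OF subgroup_F] finite_subset in \<open>auto simp: GG_def\<close>)
  moreover have "{\<one>} \<in> GG"
    using one_is_normal subgroup.one_closed[OF subgroup_F] by (auto simp: GG_def intro: exI[of _ 1])
  ultimately obtain B where BG: "B \<in> GG" "\<And>N. N \<in> GG \<Longrightarrow> B \<subseteq> N \<Longrightarrow> B = N"
    using finite_has_maximal2[of GG "{\<one>}"] by blast
  have B: "?good B" using BG(1) unfolding GG_def by (rule CollectD)
  have max: "N = B" if good: "?good N" and le: "B \<subseteq> N" for N
  proof -
    have "N \<in> GG" using good unfolding GG_def by (rule CollectI)
    from BG(2)[OF this le] show ?thesis by (rule sym)
  qed
  interpret B: normal B G using B by blast
  have sB: "subgroup B G" by (rule B.subgroup_axioms)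
  have q: "primary q \<subseteq> B" if q: "Factorial_Ring.prime q" "q \<noteq> p" for q
  proof -
    let ?N = "B <#> primary q"
    note nq = primary_normal[OF q(1)]
    have sub: "primary q \<subseteq> F" by (auto simp: primary_def)
    have N: "B \<subseteq> ?N" "primary q \<subseteq> ?N"
      using subgroup_set_mult_normal[of B "primary q"] B nq normal_imp_subgroup by blast+
    have "?good ?N"
    proof (intro conjI ballI)
      show "?N \<lhd> G" using normal_subgroup_set_mult_closed B nq by blast
      show "?N \<subseteq> F" using B sub subgroup.m_closed[OF subgroup_F] by (auto simp: set_mult_def)
      fix x assume "x \<in> ?N"
      then obtain b s where x: "b \<in> B" "s \<in> primary q" "x = b \<otimes> s" by (auto simp: set_mult_def)
      obtain m :: nat where m: "coprime m p" "b [^] m = \<one>" using B x(1) by blast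
      have xG: "x \<in> carrier G" "b \<in> carrier G" using x B.subset F_carrier sub by auto
      \<comment> \<open>Modulo the normal subgroup \<open>primary q\<close> the element
        \<open>x\<close> equals \<open>b\<close>, whose \<open>m\<close>-th power is
        trivial.\<close>
      have "x [^] m \<in> primary q"
        using normal_mult_pow(1)[OF nq xG(2) x(2), of m] m(2) x(3)
          subgroup.one_closed[OF normal_imp_subgroup[OF nq]] by simp
      then obtain k where "(x [^] m) [^] (q ^ k) = \<one>" by (auto simp: primary_def)
      then have "x [^] (m * q ^ k) = \<one>" using xG by (simp add: nat_pow_pow)
      moreover have "coprime (m * q ^ k) p" using m(1) p q by (simp add: primes_coprime)
      ultimately show "\<exists>m::nat. coprime m p \<and> x [^] m = \<one>" by blast
    qed
    from max[OF this N(1)] show ?thesis using N(2) by simp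
  qed
  have "subgroup (primary p <#> B) G" "primary p \<subseteq> primary p <#> B" "B \<subseteq> primary p <#> B"
    using subgroup_set_mult_normal[OF primary_normal[OF p] sB] by auto
  then have "F \<subseteq> primary p <#> B"
    using q subset_trans by (intro subgroup_containing_primaries) blast+
  then have "\<exists>r\<in>primary p. \<exists>b\<in>B. f = r \<otimes> b" if "f \<in> F" for f
    using that unfolding set_mult_def by blast
  then show ?thesis using B by (intro that[of B]) blast+
qed

end

section \<open>Products, cyclic subgroups and centralizers\<close>

context group
begin

lemma set_multI: "a \<in> A \<Longrightarrow> b \<in> B \<Longrightarrow> a \<otimes> b \<in> A <#> B"
  unfolding set_mult_def by blast

lemma set_multE:
  assumes "x \<in> A <#> B"
  obtains a b where "a \<in> A" "b \<in> B" "x = a \<otimes> b"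
  using assms unfolding set_mult_def by blast

lemma set_mult_commute_subgroup:
  assumes A: "subgroup A G" and B: "subgroup B G" and eq: "A <#> B = B <#> A"
  shows "subgroup (A <#> B) G"
proof (rule subgroupI)
  have sub: "A \<subseteq> carrier G" "B \<subseteq> carrier G" using A B subgroup.subset by auto
  show "A <#> B \<subseteq> carrier G" using sub by (rule setmult_subset_G)
  show "A <#> B \<noteq> {}" using subgroup.one_closed[OF A] subgroup.one_closed[OF B] by (auto simp: set_mult_def)
  show "inv x \<in> A <#> B" if "x \<in> A <#> B" for x
  proof -
    obtain a b where ab: "a \<in> A" "b \<in> B" "x = a \<otimes> b" using \<open>x \<in> A <#> B\<close> by (auto simp: set_mult_def)
    then have "inv x = inv b \<otimes> inv a" using sub by (auto simp: inv_mult_group subsetD)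
    then have "inv x \<in> B <#> A"
      using ab A B by (simp add: set_multI subgroup.m_inv_closed)
    then show ?thesis using eq by simp
  qed
  show "x \<otimes> y \<in> A <#> B" if "x \<in> A <#> B" "y \<in> A <#> B" for x y
  proof -
    have "x \<otimes> y \<in> (A <#> B) <#> (A <#> B)" using that by (rule set_multI)
    also have "(A <#> B) <#> (A <#> B) = A <#> (B <#> A) <#> B"
      using sub by (simp add: set_mult_assoc setmult_subset_G)
    also have "\<dots> = (A <#> A) <#> (B <#> B)"
      unfolding eq[symmetric] using sub by (simp add: set_mult_assoc setmult_subset_G)
    also have "\<dots> = A <#> B" using subgroup_mult_id A B by simp
    finally show ?thesis .
  qed
qed

lemma subgroup_of_cyclic:
  assumes fin: "finite (carrier G)" and u: "u \<in> carrier G"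
    and Y: "subgroup Y G" "Y \<subseteq> generate G {u}"
  obtains y where "y \<in> carrier G" "Y = generate G {y}"
proof -
  have gen: "generate G {z} = {z [^] (k::nat) | k. k \<in> UNIV}" if "z \<in> carrier G" for z
    using generate_pow_on_finite_carrier[OF fin that] .
  define k where "k = (LEAST k. k > 0 \<and> u [^] (k::nat) \<in> Y)"
  have "ord u > 0 \<and> u [^] ord u \<in> Y"
    using u fin Y(1) ord_ge_1[OF fin u] subgroup.one_closed by auto
  then have k: "k > 0" "u [^] k \<in> Y" and least: "\<And>j. j > 0 \<Longrightarrow> u [^] j \<in> Y \<Longrightarrow> k \<le> j"
    using LeastI[of "\<lambda>k. k > 0 \<and> u [^] (k::nat) \<in> Y"] Least_le[of "\<lambda>k. k > 0 \<and> u [^] (k::nat) \<in> Y"]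
    unfolding k_def by blast+
  have "Y \<subseteq> generate G {u [^] k}"
  proof
    fix z assume z: "z \<in> Y"
    then obtain j :: nat where j: "z = u [^] j" using Y(2) gen[OF u] by blast
    let ?q = "(u [^] k) [^] (j div k)"
    have qY: "?q \<in> Y" using subgroup_nat_pow_closed[OF Y(1) k(2)] .
    have "?q \<otimes> u [^] (j mod k) = u [^] j"
      using u by (simp add: nat_pow_pow nat_pow_mult)
    then have "u [^] (j mod k) = inv ?q \<otimes> z" using u j by (simp add: inv_solve_left)
    then have "u [^] (j mod k) \<in> Y"
      using qY z Y(1) by (simp add: subgroup.m_closed subgroup.m_inv_closed)
    then have "j mod k = 0" using least[of "j mod k"] k(1) by (metis mod_less_divisor not_le neq0_conv)
    then have "z = ?q" using \<open>?q \<otimes> u [^] (j mod k) = u [^] j\<close> j u by simp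
    then show "z \<in> generate G {u [^] k}" using gen[of "u [^] k"] u by blast
  qed
  moreover have "generate G {u [^] k} \<subseteq> Y" using k(2) Y(1) generate_subgroup_incl by blast
  ultimately show ?thesis using that[of "u [^] k"] u by blast
qed

lemma centralizer_subgroup:
  assumes "S \<subseteq> carrier G"
  shows "subgroup {g \<in> carrier G. \<forall>s\<in>S. g \<otimes> s = s \<otimes> g} G"
proof (rule subgroupI)
  show "inv g \<in> {g \<in> carrier G. \<forall>s\<in>S. g \<otimes> s = s \<otimes> g}"
    if "g \<in> {g \<in> carrier G. \<forall>s\<in>S. g \<otimes> s = s \<otimes> g}" for g
  proof -
    have "inv g \<otimes> s = s \<otimes> inv g" if s: "s \<in> S" for s
    proof -
      have gs: "g \<in> carrier G" "s \<in> carrier G" "g \<otimes> s = s \<otimes> g"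
        using \<open>g \<in> _\<close> s assms by auto
      have "inv g \<otimes> (s \<otimes> g) \<otimes> inv g = inv g \<otimes> (g \<otimes> s) \<otimes> inv g" by (simp only: gs(3))
      then show ?thesis using gs(1,2) by (simp add: group_normalize)
    qed
    then show ?thesis using \<open>g \<in> _\<close> by simp
  qed
  show "a \<otimes> b \<in> {g \<in> carrier G. \<forall>s\<in>S. g \<otimes> s = s \<otimes> g}"
    if ab: "a \<in> {g \<in> carrier G. \<forall>s\<in>S. g \<otimes> s = s \<otimes> g}" "b \<in> {g \<in> carrier G. \<forall>s\<in>S. g \<otimes> s = s \<otimes> g}" for a b
  proof -
    have "a \<otimes> b \<otimes> s = s \<otimes> (a \<otimes> b)" if s: "s \<in> S" for s
    proof -
      have c: "a \<in> carrier G" "b \<in> carrier G" "s \<in> carrier G" "a \<otimes> s = s \<otimes> a" "b \<otimes> s = s \<otimes> b"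
        using ab s assms by auto
      have "a \<otimes> b \<otimes> s = a \<otimes> (b \<otimes> s)" using c(1-3) by (simp add: m_assoc)
      also have "\<dots> = a \<otimes> s \<otimes> b" unfolding c(5) using c(1-3) by (simp add: m_assoc)
      also have "\<dots> = s \<otimes> (a \<otimes> b)" unfolding c(4) using c(1-3) by (simp add: m_assoc)
      finally show ?thesis .
    qed
    then show ?thesis using ab by simp
  qed
qed (use assms in \<open>auto intro!: exI[of _ \<one>] simp: subsetD\<close>)

lemma centralizer_normal:
  assumes "N \<lhd> G"
  shows "{g \<in> carrier G. \<forall>s\<in>N. g \<otimes> s = s \<otimes> g} \<lhd> G"
proof (rule normal_invI)
  have N: "N \<subseteq> carrier G" using normal_imp_subgroup[OF assms] subgroup.subset by blast
  then show "subgroup {g \<in> carrier G. \<forall>s\<in>N. g \<otimes> s = s \<otimes> g} G" by (rule centralizer_subgroup)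
  fix x h assume x: "x \<in> carrier G" and h: "h \<in> {g \<in> carrier G. \<forall>s\<in>N. g \<otimes> s = s \<otimes> g}"
  have "x \<otimes> h \<otimes> inv x \<otimes> s = s \<otimes> (x \<otimes> h \<otimes> inv x)" if s: "s \<in> N" for s
  proof -
    let ?t = "inv x \<otimes> s \<otimes> x"
    have t: "?t \<in> N" using normal.inv_op_closed1[OF assms x s] .
    have sG: "s \<in> carrier G" using s N by blast
    have hG: "h \<in> carrier G" using h by simp
    have e: "h \<otimes> ?t = ?t \<otimes> h" using h t by simp
    have "x \<otimes> h \<otimes> inv x \<otimes> s = x \<otimes> (h \<otimes> ?t) \<otimes> inv x" using x sG hG by (simp add: group_normalize)
    also have "\<dots> = s \<otimes> (x \<otimes> h \<otimes> inv x)" unfolding e using x sG hG by (simp add: group_normalize)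
    finally show ?thesis .
  qed
  then show "x \<otimes> h \<otimes> inv x \<in> {g \<in> carrier G. \<forall>s\<in>N. g \<otimes> s = s \<otimes> g}" using x h by simp
qed

text \<open>The set is the preimage of the centralizer of the coset of \<open>h\<close> in
  \<open>G Mod E\<close>. As a subgroup it can be filled up with Sylow subgroups.\<close>

lemma commutator_mem_subgroup:
  assumes "E \<lhd> G" "h \<in> carrier G"
  shows "subgroup {g \<in> carrier G. g \<otimes> h \<otimes> inv g \<otimes> inv h \<in> E} G"
proof -
  interpret E: normal E G by fact
  show ?thesis
  proof (rule subgroupI)
    show "{g \<in> carrier G. g \<otimes> h \<otimes> inv g \<otimes> inv h \<in> E} \<noteq> {}"
      using assms(2) E.one_closed by (auto intro!: exI[of _ \<one>])
    show "inv g \<in> {g \<in> carrier G. g \<otimes> h \<otimes> inv g \<otimes> inv h \<in> E}"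
      if "g \<in> {g \<in> carrier G. g \<otimes> h \<otimes> inv g \<otimes> inv h \<in> E}" for g
    proof -
      have g: "g \<in> carrier G" "g \<otimes> h \<otimes> inv g \<otimes> inv h \<in> E" using that by auto
      have "inv g \<otimes> inv (g \<otimes> h \<otimes> inv g \<otimes> inv h) \<otimes> g \<in> E"
        using g by (intro E.inv_op_closed1 E.m_inv_closed)
      moreover have "inv g \<otimes> inv (g \<otimes> h \<otimes> inv g \<otimes> inv h) \<otimes> g = inv g \<otimes> h \<otimes> inv (inv g) \<otimes> inv h"
        using g(1) assms(2) by (simp add: group_normalize)
      ultimately show ?thesis using g by simp
    qed
    show "a \<otimes> b \<in> {g \<in> carrier G. g \<otimes> h \<otimes> inv g \<otimes> inv h \<in> E}"
      if "a \<in> {g \<in> carrier G. g \<otimes> h \<otimes> inv g \<otimes> inv h \<in> E}" "b \<in> {g \<in> carrier G. g \<otimes> h \<otimes> inv g \<otimes> inv h \<in> E}" for a b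
    proof -
      have ab: "a \<in> carrier G" "b \<in> carrier G" "a \<otimes> h \<otimes> inv a \<otimes> inv h \<in> E" "b \<otimes> h \<otimes> inv b \<otimes> inv h \<in> E"
        using that by auto
      have "(a \<otimes> (b \<otimes> h \<otimes> inv b \<otimes> inv h) \<otimes> inv a) \<otimes> (a \<otimes> h \<otimes> inv a \<otimes> inv h) \<in> E"
        using ab E.inv_op_closed2 E.m_closed by blast
      moreover have "(a \<otimes> (b \<otimes> h \<otimes> inv b \<otimes> inv h) \<otimes> inv a) \<otimes> (a \<otimes> h \<otimes> inv a \<otimes> inv h)
          = (a \<otimes> b) \<otimes> h \<otimes> inv (a \<otimes> b) \<otimes> inv h"
        using ab assms(2) by (simp add: group_normalize)
      ultimately show ?thesis using ab by simp
    qed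
  qed auto
qed

lemma commutator_mem_sym:
  assumes "subgroup E G" "g \<in> carrier G" "h \<in> carrier G" "g \<otimes> h \<otimes> inv g \<otimes> inv h \<in> E"
  shows "h \<otimes> g \<otimes> inv h \<otimes> inv g \<in> E"
  using subgroup.m_inv_closed[OF assms(1,4)] assms(2,3) by (simp add: group_normalize)

lemma sylow_sub_in_subgroup:
  assumes fin: "finite (carrier G)" and p: "Factorial_Ring.prime p" and H: "subgroup H G"
    and P: "sylow_sub p P" "P \<subseteq> H"
  shows "group.sylow_sub (G\<lparr>carrier := H\<rparr>) p P"
proof -
  interpret H: group "G\<lparr>carrier := H\<rparr>" using H subgroup_imp_group by blast
  have sP: "subgroup P (G\<lparr>carrier := H\<rparr>)" using P H subgroup_incl by (auto simp: sylow_sub_def)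
  have cP: "card P = p ^ multiplicity p (order G)" using P by (simp add: sylow_sub_def)
  have "card P dvd order (G\<lparr>carrier := H\<rparr>)" using H.card_dvd_order[OF sP] .
  moreover have oH: "order (G\<lparr>carrier := H\<rparr>) = card H" by (simp add: order_def)
  moreover have "card H dvd order G" using card_dvd_order[OF H] .
  moreover have "card H > 0" "order G > 0" using card_pos fin H order_pos by auto
  ultimately have "multiplicity p (card H) = multiplicity p (order G)"
    using cP p by (intro antisym dvd_imp_multiplicity_le multiplicity_geI) (auto simp: prime_gt_Suc_0_nat)
  then show ?thesis using sP cP oH by (simp add: H.sylow_sub_def)
qed

text \<open>Some conjugate of \<open>R\<close> lies in \<open>S\<close>, and \<open>R\<close> equals
  all its conjugates.\<close>

lemma normal_prime_power_le_sylow: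
  assumes fin: "finite (carrier G)" and p: "Factorial_Ring.prime p"
    and S: "subgroup S G" "\<not> p dvd card (rcosets S)"
    and R: "R \<lhd> G" "card R = p ^ k"
  shows "R \<subseteq> S"
proof
  fix r assume r: "r \<in> R"
  have RG: "subgroup R G" using R normal_imp_subgroup by blast
  obtain g where g: "g \<in> carrier G" "\<And>r. r \<in> R \<Longrightarrow> g \<otimes> r \<otimes> inv g \<in> S"
    using prime_power_subgroup_conj_into[OF RG R(2) p fin S] by blast
  have rG: "r \<in> carrier G" using r RG subgroup.mem_carrier by metis
  have "g \<otimes> (inv g \<otimes> r \<otimes> g) \<otimes> inv g \<in> S"
    using g normal.inv_op_closed1[OF R(1) g(1) r] by blast
  then show "r \<in> S" using g(1) rG by (simp add: group_normalize)
qed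

end

section \<open>Action of a permuteral Sylow subgroup on the primary parts of F\<close>

context nilpotent_by_nilpotent
begin

lemma prime_power_sub_primary:
  assumes p: "Factorial_Ring.prime p" and Y: "subgroup Y G" "Y \<subseteq> primary p"
  shows "\<exists>k. card Y = p ^ k"
proof -
  have "subgroup Y (G\<lparr>carrier := primary p\<rparr>)"
    using Y subgroup_incl primary_normal[OF p] normal_imp_subgroup by blast
  then have "card Y dvd card (primary p)"
    using group.card_dvd_order[OF subgroup_imp_group[OF normal_imp_subgroup[OF primary_normal[OF p]]]]
    by (simp add: order_def)
  then show ?thesis using card_primary[OF p] p by (auto simp: divides_primepow_nat)
qed

lemma primary_carrier: "y \<in> primary p \<Longrightarrow> y \<in> carrier G"
  using F_carrier by (auto simp: primary_def)

text \<open>The order of \<open>H = \<langle>x\<rangle>Q\<close> divides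
  \<open>ord x * card Q\<close>, so the \<open>p\<close>-part \<open>\<langle>u\<rangle>\<close> of
  \<open>\<langle>x\<rangle>\<close> has index prime to \<open>p\<close> in \<open>H\<close>. It
  therefore contains the normal \<open>p\<close>-subgroup
  \<open>primary p \<inter> H\<close>.\<close>

lemma primary_Int_permuting_cyclic:
  assumes p: "Factorial_Ring.prime p" and q: "Factorial_Ring.prime q" "p \<noteq> q"
    and Q: "sylow_sub q Q" and x: "x \<in> carrier G"
    and perm: "generate G {x} <#> Q = Q <#> generate G {x}"
  obtains y where "y \<in> carrier G" "primary p \<inter> (generate G {x} <#> Q) = generate G {y}"
proof -
  have QG: "subgroup Q G" and cQ: "card Q = q ^ multiplicity q (order G)"
    using Q by (auto simp: sylow_sub_def)
  have xG: "subgroup (generate G {x}) G" using x generate_is_subgroup by simp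
  let ?H = "generate G {x} <#> Q"
  let ?HG = "G\<lparr>carrier := ?H\<rparr>"
  have H: "subgroup ?H G" using set_mult_commute_subgroup xG QG perm by blast
  interpret H: group ?HG using H subgroup_imp_group by blast
  let ?Y = "primary p \<inter> ?H"
  have Y: "subgroup ?Y G"
    using H primary_normal[OF p] normal_imp_subgroup by (intro subgroups_Inter_pair) auto
  obtain k where k: "card ?Y = p ^ k" using prime_power_sub_primary[OF p Y] by auto
  have Yn: "?Y \<lhd> ?HG"
    using normal_Int_subgroup[OF H primary_normal[OF p]] by (simp add: Int_commute)
  define n where "n = ord x"
  have n: "n > 0" "card (generate G {x}) = n"
    using ord_ge_1[OF fin x] generate_pow_card[OF x] by (simp_all add: n_def)
  define m where "m = multiplicity p n"
  have "p ^ m dvd n" by (simp add: m_def multiplicity_dvd)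
  then obtain l where l: "n = p ^ m * l" by blast
  define u where "u = x [^] l"
  have uG: "u \<in> carrier G" using x by (simp add: u_def)
  have "l \<noteq> 0" using l n(1) by auto
  then have "ord u = p ^ m"
    using ord_pow[OF x, of l] l by (simp add: u_def n_def)
  then have cU: "card (generate G {u}) = p ^ m" using generate_pow_card[OF uG] by simp
  have UG: "subgroup (generate G {u}) G" using uG generate_is_subgroup by simp
  have "u \<in> generate G {x}"
    unfolding u_def using subgroup_nat_pow_closed[OF xG] generate.incl[of x "{x}"] by blast
  moreover have "generate G {x} \<subseteq> ?H"
    using set_multI[of _ "generate G {x}" \<one> Q] subgroup.one_closed[OF QG] subgroup.mem_carrier[OF xG]
    by force
  ultimately have "generate G {u} \<subseteq> ?H" using generate_subgroup_incl[OF _ H] by blast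
  then have U: "subgroup (generate G {u}) ?HG" using subgroup_incl[OF UG H] by blast
  have index: "\<not> p dvd card (rcosets\<^bsub>?HG\<^esub> (generate G {u}))"
  proof
    assume "p dvd card (rcosets\<^bsub>?HG\<^esub> (generate G {u}))"
    then have "p * p ^ m dvd card (rcosets\<^bsub>?HG\<^esub> (generate G {u})) * card (generate G {u})"
      using cU by simp
    also have "\<dots> = card ?H" using H.lagrange[OF U] by (simp add: order_def)
    also have "\<dots> dvd n * card Q"
      using card_set_mult[OF xG QG fin] n(2) by (metis dvd_triv_left)
    finally have "p ^ Suc m dvd n * card Q" by simp
    moreover have "coprime (p ^ Suc m) (card Q)"
      unfolding cQ using p q by (simp add: primes_coprime)
    ultimately have "p ^ Suc m dvd n" by (simp add: coprime_dvd_mult_left_iff)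
    then have "Suc m \<le> m"
      using n(1) p unfolding m_def by (intro multiplicity_geI) (auto simp: prime_gt_Suc_0_nat)
    then show False by simp
  qed
  have "?Y \<subseteq> generate G {u}"
    using H.normal_prime_power_le_sylow[OF _ p U index Yn k] subgroup.subset[OF H] fin finite_subset
    by auto
  from subgroup_of_cyclic[OF fin uG Y this] show ?thesis using that by blast
qed

lemma primary_le_sylow:
  assumes p: "Factorial_Ring.prime p" and P: "sylow_sub p P"
  shows "primary p \<subseteq> P"
proof -
  have PG: "subgroup P G" using P by (auto simp: sylow_sub_def)
  obtain k where "card (primary p) = p ^ k" using card_primary[OF p] by blast
  moreover have "\<not> p dvd card (rcosets P)"
    using sylow_sub_not_dvd_index[OF fin p P subgroup_self] subgroup.subset[OF PG] by simp
  ultimately show ?thesis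
    using normal_prime_power_le_sylow[OF fin p PG _ primary_normal[OF p]] by blast
qed

text \<open>The group \<open>D\<close> of the overview in terms of generators:
  \<open>\<langle>y\<rangle>\<close> is invariant under \<open>Q\<close> as soon as the conjugates
  of \<open>y\<close> lie in it, and commuting with \<open>y\<close> is commuting with all of
  \<open>\<langle>y\<rangle>\<close>.\<close>

definition power_centralizing :: "nat \<Rightarrow> 'a set \<Rightarrow> 'a set" where
  "power_centralizing p Q = {d \<in> Q. \<forall>y\<in>primary p. (\<forall>a\<in>Q. a \<otimes> y \<otimes> inv a \<in> generate G {y}) \<longrightarrow> d \<otimes> y = y \<otimes> d}"

lemma power_centralizing_subgroup:
  assumes Q: "subgroup Q G"
  shows "subgroup (power_centralizing p Q) G"
proof -
  let ?S = "{y \<in> primary p. \<forall>a\<in>Q. a \<otimes> y \<otimes> inv a \<in> generate G {y}}"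
  have eq: "power_centralizing p Q = Q \<inter> {g \<in> carrier G. \<forall>s\<in>?S. g \<otimes> s = s \<otimes> g}"
    using subgroup.subset[OF Q] by (auto simp: power_centralizing_def)
  have "?S \<subseteq> carrier G" using primary_carrier by blast
  then show ?thesis unfolding eq by (intro subgroups_Inter_pair Q centralizer_subgroup)
qed

text \<open>An element normalizing \<open>Q\<close> permutes the \<open>Q\<close>-invariant cyclic
  subgroups of \<open>primary p\<close>, so it preserves their common centralizer in
  \<open>Q\<close>.\<close>

lemma power_centralizing_conj:
  assumes p: "Factorial_Ring.prime p" and Q: "subgroup Q G"
    and n: "n \<in> normalizing Q" and d: "d \<in> power_centralizing p Q"
  shows "n \<otimes> d \<otimes> inv n \<in> power_centralizing p Q"
proof -
  have nG: "n \<in> carrier G" using n by (simp add: normalizing_def)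
  have dQ: "d \<in> Q" and dG: "d \<in> carrier G" using d subgroup.mem_carrier[OF Q] by (auto simp: power_centralizing_def)
  have "n \<otimes> d \<otimes> inv n \<otimes> y = y \<otimes> (n \<otimes> d \<otimes> inv n)"
    if y: "y \<in> primary p" and inv: "\<And>a. a \<in> Q \<Longrightarrow> a \<otimes> y \<otimes> inv a \<in> generate G {y}" for y
  proof -
    have yG: "y \<in> carrier G" using y primary_carrier by blast
    let ?z = "inv n \<otimes> y \<otimes> n"
    have z: "?z \<in> primary p" using normal.inv_op_closed1[OF primary_normal[OF p] nG y] .
    have zG: "?z \<in> carrier G" using nG yG by simp
    have "a \<otimes> ?z \<otimes> inv a \<in> generate G {?z}" if a: "a \<in> Q" for a
    proof -
      have aG: "a \<in> carrier G" using a subgroup.mem_carrier[OF Q] by blast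
      have "n \<otimes> a \<otimes> inv n \<in> Q" using n a by (simp add: normalizing_def)
      from inv[OF this] obtain k :: nat where "n \<otimes> a \<otimes> inv n \<otimes> y \<otimes> inv (n \<otimes> a \<otimes> inv n) = y [^] k"
        using generate_pow_on_finite_carrier[OF fin yG] by blast
      then have "inv n \<otimes> (n \<otimes> a \<otimes> inv n \<otimes> y \<otimes> inv (n \<otimes> a \<otimes> inv n)) \<otimes> inv (inv n) = ?z [^] k"
        using conj_pow[of "inv n" y k] nG yG by simp
      then have "a \<otimes> ?z \<otimes> inv a = ?z [^] k" using nG yG aG by (simp add: group_normalize)
      then show ?thesis using generate_pow_on_finite_carrier[OF fin zG] by blast
    qed
    then have "d \<otimes> ?z = ?z \<otimes> d" using d z by (simp add: power_centralizing_def)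
    then have "n \<otimes> (d \<otimes> ?z) \<otimes> inv n = n \<otimes> (?z \<otimes> d) \<otimes> inv n" by (simp only:)
    then show ?thesis using nG yG dG by (simp add: group_normalize)
  qed
  moreover have "n \<otimes> d \<otimes> inv n \<in> Q" using n dQ by (simp add: normalizing_def)
  ultimately show ?thesis by (simp add: power_centralizing_def)
qed

text \<open>Frattini inside \<open>H = \<langle>x\<rangle>Q\<close> gives
  \<open>x = r \<otimes> b \<otimes> n\<close>. Here \<open>n\<close> normalizes \<open>Q\<close>
  and hence \<open>D\<close>, \<open>b\<close> lies in \<open>B\<close>, and \<open>r\<close> turns
  out to lie in the cyclic \<open>Q\<close>-invariant group \<open>primary p \<inter> H\<close>,
  which \<open>D\<close> centralizes by definition.\<close>

lemma permuting_normalizes: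
  assumes p: "Factorial_Ring.prime p" and q: "Factorial_Ring.prime q" "p \<noteq> q"
    and Q: "sylow_sub q Q" and x: "x \<in> carrier G"
    and perm: "generate G {x} <#> Q = Q <#> generate G {x}"
    and B: "B \<lhd> G" "B \<subseteq> F" "\<And>b. b \<in> B \<Longrightarrow> \<exists>m::nat. coprime m p \<and> b [^] m = \<one>"
      "\<And>f. f \<in> F \<Longrightarrow> \<exists>r\<in>primary p. \<exists>b\<in>B. f = r \<otimes> b"
  shows "x \<in> normalizing (B <#> power_centralizing p Q)"
proof -
  have QG: "subgroup Q G" using Q by (auto simp: sylow_sub_def)
  have xG: "subgroup (generate G {x}) G" using x generate_is_subgroup by simp
  let ?H = "generate G {x} <#> Q"
  let ?D = "power_centralizing p Q"
  let ?N = "normalizing (B <#> ?D)"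
  have H: "subgroup ?H G" using set_mult_commute_subgroup xG QG perm by blast
  have D: "subgroup ?D G" using power_centralizing_subgroup[OF QG] .
  have BD: "subgroup (B <#> ?D) G" "B \<subseteq> B <#> ?D"
    using subgroup_set_mult_normal[OF B(1) D] by auto
  have N: "subgroup ?N G" using normalizing_subgroup[OF fin BD(1)] .
  have QH: "Q \<subseteq> ?H"
    using set_multI[of \<one> "generate G {x}" _ Q] subgroup.one_closed[OF xG] subgroup.mem_carrier[OF QG]
    by force
  have xH: "x \<in> ?H"
    using set_multI[of x "generate G {x}" \<one> Q] generate.incl[of x "{x}"] subgroup.one_closed[OF QG] x
    by force
  interpret H: nilpotent_by_nilpotent "G\<lparr>carrier := ?H\<rparr>" "F \<inter> ?H" using restrict_subgroup[OF H] .
  have "x \<in> carrier (G\<lparr>carrier := ?H\<rparr>)" using xH by simp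
  from H.frattini[OF q(1) sylow_sub_in_subgroup[OF fin q(1) H Q QH] this]
  obtain f n where fn: "f \<in> F \<inter> ?H" "n \<in> H.normalizing Q" "x = f \<otimes> n" by auto
  have n: "n \<in> normalizing Q"
    using fn(2) subgroup.mem_carrier[OF H] by (auto simp: H.normalizing_def normalizing_def m_inv_consistent[OF H])
  have conjI: "g \<in> ?N" if g: "g \<in> carrier G" and gd: "\<And>d. d \<in> ?D \<Longrightarrow> g \<otimes> d \<otimes> inv g \<in> ?D" for g
  proof -
    have "g \<otimes> l \<otimes> inv g \<in> B <#> ?D" if "l \<in> B <#> ?D" for l
    proof -
      obtain b d where bd: "b \<in> B" "d \<in> ?D" "l = b \<otimes> d" using \<open>l \<in> _\<close> by (rule set_multE)
      have car: "b \<in> carrier G" "d \<in> carrier G"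
        using bd subgroup.mem_carrier[OF D] subgroup.mem_carrier[OF normal_imp_subgroup[OF B(1)]] by blast+
      have "(g \<otimes> b \<otimes> inv g) \<otimes> (g \<otimes> d \<otimes> inv g) \<in> B <#> ?D"
        using bd gd normal.inv_op_closed2[OF B(1) g] by (intro set_multI) auto
      then show ?thesis using bd(3) car g by (simp add: conj_mult)
    qed
    then show ?thesis using g by (simp add: normalizing_def)
  qed
  obtain r b where rb: "r \<in> primary p" "b \<in> B" "f = r \<otimes> b" using B(4) fn(1) by blast
  have car: "r \<in> carrier G" "b \<in> carrier G"
    using rb primary_carrier B(2) F_carrier by blast+
  have "n \<in> ?N"
    using power_centralizing_conj[OF p QG n] n by (intro conjI) (auto simp: normalizing_def)
  moreover have "b \<in> ?N" using rb(2) BD(2) subgroup_le_normalizing[OF BD(1)] by blast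
  moreover have "r \<in> ?N"
  proof -
    obtain m :: nat where m: "coprime m p" "b [^] m = \<one>" using B(3) rb(2) by blast
    obtain k where k: "r \<in> F" "r [^] (p ^ k) = \<one>" using rb(1) by (auto simp: primary_def)
    have "r \<otimes> b = b \<otimes> r"
      using F_commute[OF k(1) _ k(2) m(2)] rb(2) B(2) m(1) by (auto simp: coprime_commute)
    \<comment> \<open>The \<open>m\<close>-th power kills \<open>b\<close> and leaves a power of
      \<open>r\<close> in \<open>H\<close>. Since \<open>r\<close> has \<open>p\<close>-power order
      and \<open>m\<close> is prime to \<open>p\<close>, \<open>r\<close> itself lies in
      \<open>H\<close>.\<close>
    then have "f [^] m = r [^] m" using pow_mult_distrib[of r b m] car rb(3) m(2) by simp
    moreover have "f [^] m \<in> ?H" using fn(1) subgroup_nat_pow_closed[OF H] by blast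
    ultimately have "r \<in> ?H"
      using coprime_pow_mem[OF H car(1), of m "p ^ k"] k(2) m(1) subgroup.one_closed[OF H] by simp
    then have rH: "r \<in> primary p \<inter> ?H" using rb(1) by blast
    obtain y where y: "y \<in> carrier G" "primary p \<inter> ?H = generate G {y}"
      using primary_Int_permuting_cyclic[OF p q Q x perm] by blast
    have yR: "y \<in> primary p" "y \<in> ?H" using y(2) generate.incl[of y "{y}"] by blast+
    have inv: "a \<otimes> y \<otimes> inv a \<in> generate G {y}" if "a \<in> Q" for a
    proof -
      have "a \<in> ?H" "a \<in> carrier G" using that QH subgroup.mem_carrier[OF QG] by auto
      then show ?thesis
        using subgroup_conj_closed[OF H _ yR(2)] normal.inv_op_closed2[OF primary_normal[OF p] _ yR(1)] y(2)
        by blast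
    qed
    obtain j :: nat where j: "r = y [^] j"
      using rH y(2) generate_pow_on_finite_carrier[OF fin y(1)] by blast
    have "r \<otimes> d \<otimes> inv r \<in> ?D" if d: "d \<in> ?D" for d
    proof -
      have dG: "d \<in> carrier G" using d subgroup.mem_carrier[OF D] by blast
      have "d \<otimes> y = y \<otimes> d" using d yR(1) inv by (simp add: power_centralizing_def)
      then have "d \<otimes> y \<otimes> inv d = y" using conj_fixed_iff[OF dG y(1)] by blast
      then have "d \<otimes> r \<otimes> inv d = r" using conj_pow[OF dG y(1), of j] j by simp
      then have "d \<otimes> r = r \<otimes> d" using conj_fixed_iff[OF dG car(1)] by blast
      then have "r \<otimes> d \<otimes> inv r = d" using conj_fixed_iff[OF car(1) dG] by simp
      then show ?thesis using d by simp
    qed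
    then show ?thesis using car by (intro conjI)
  qed
  ultimately show ?thesis
    unfolding fn(3) rb(3) using subgroup.m_closed[OF N] by simp
qed

text \<open>All elements permuting with \<open>Q\<close> normalize \<open>BD\<close>, so
  permuterality makes \<open>BD\<close> normal in \<open>G\<close>. The commutator of
  \<open>d\<close> and \<open>r\<close> then lies in \<open>BD\<close> and in
  \<open>primary p\<close>. A \<open>p\<close>-element of \<open>BD\<close> lies in
  \<open>B\<close>, where all orders are prime to \<open>p\<close>, so it is trivial.\<close>

lemma permuteral_centralizes:
  assumes p: "Factorial_Ring.prime p" and q: "Factorial_Ring.prime q" "p \<noteq> q"
    and Q: "sylow_sub q Q" and perm: "permuteral Q G"
    and d: "d \<in> power_centralizing p Q" and r: "r \<in> primary p"
  shows "d \<otimes> r = r \<otimes> d"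
proof -
  have QG: "subgroup Q G" using Q by (auto simp: sylow_sub_def)
  let ?D = "power_centralizing p Q"
  obtain B where B: "B \<lhd> G" "B \<subseteq> F" "\<And>b. b \<in> B \<Longrightarrow> \<exists>m::nat. coprime m p \<and> b [^] m = \<one>"
      "\<And>f. f \<in> F \<Longrightarrow> \<exists>r\<in>primary p. \<exists>b\<in>B. f = r \<otimes> b"
    using primary_complement[OF p] by blast
  have D: "subgroup ?D G" using power_centralizing_subgroup[OF QG] .
  have BD: "subgroup (B <#> ?D) G" "?D \<subseteq> B <#> ?D"
    using subgroup_set_mult_normal[OF B(1) D] by auto
  have "{x \<in> carrier G. generate G {x} <#> Q = Q <#> generate G {x}} \<subseteq> normalizing (B <#> ?D)"
    using permuting_normalizes[OF p q Q _ _ B] by blast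
  then have "permutizer G Q \<subseteq> normalizing (B <#> ?D)"
    unfolding permutizer_def by (rule generate_subgroup_incl[OF _ normalizing_subgroup[OF fin BD(1)]])
  then have norm: "normalizing (B <#> ?D) = carrier G"
    using perm by (auto simp: permuteral_def normalizing_def)
  have car: "d \<in> carrier G" "r \<in> carrier G" using subgroup.mem_carrier[OF D d] primary_carrier[OF r] by auto
  let ?c = "d \<otimes> r \<otimes> inv d \<otimes> inv r"
  have cG: "?c \<in> carrier G" using car by simp
  note nR = primary_normal[OF p]
  have "d \<otimes> (r \<otimes> inv d \<otimes> inv r) \<in> B <#> ?D"
  proof (rule subgroup.m_closed[OF BD(1)])
    show "d \<in> B <#> ?D" using d BD by blast
    have "inv d \<in> B <#> ?D" using subgroup.m_inv_closed[OF D d] BD by blast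
    then show "r \<otimes> inv d \<otimes> inv r \<in> B <#> ?D"
      using norm car by (auto simp: normalizing_def set_eq_iff)
  qed
  then have "?c \<in> B <#> ?D" using car by (simp add: m_assoc)
  then obtain b e where be: "b \<in> B" "e \<in> ?D" "?c = b \<otimes> e" by (rule set_multE)
  have eQ: "e \<in> Q" "e \<in> carrier G" using be(2) subgroup.mem_carrier[OF QG] by (auto simp: power_centralizing_def)
  have "?c \<in> primary p"
    using normal.inv_op_closed2[OF nR car(1) r] r subgroup.m_inv_closed[OF normal_imp_subgroup[OF nR] r]
      subgroup.m_closed[OF normal_imp_subgroup[OF nR]] by blast
  then obtain k where k: "?c [^] (p ^ k) = \<one>" by (auto simp: primary_def)
  have sB: "subgroup B G" using B(1) normal_imp_subgroup by blast
  have "(b \<otimes> e) [^] card Q \<in> B"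
    using normal_mult_pow(2)[OF B(1) eQ(2) be(1), of "card Q"] subgroup_pow_card[OF QG eQ(1)]
      subgroup.one_closed[OF sB] by simp
  moreover have "coprime (p ^ k) (card Q)"
    using Q p q by (simp add: sylow_sub_def primes_coprime)
  ultimately have "?c \<in> B"
    using coprime_pow_mem[OF sB cG, of "p ^ k" "card Q"] k be(3) subgroup.one_closed[OF sB] by simp
  then obtain m :: nat where "coprime m p" "?c [^] m = \<one>" using B(3) by blast
  then have "?c \<in> {\<one>}"
    using coprime_pow_mem[OF triv_subgroup cG, of m "p ^ k"] k by simp
  then have "?c \<otimes> (r \<otimes> d) = r \<otimes> d" using car by simp
  then show ?thesis using car by (simp add: group_normalize)
qed

end

lemma (in group) nat_pow_cong:
  assumes "x \<in> carrier G" "[i = j] (mod ord x)"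
  shows "x [^] (i::nat) = x [^] (j::nat)"
proof -
  have "[int j = int i] (mod int (ord x))" using assms(2) by (simp add: cong_int_iff cong_sym)
  then have "int (ord x) dvd int j - int i" by (simp add: cong_iff_dvd_diff)
  then show ?thesis using int_pow_eq[OF assms(1), of "int i" "int j"] by (simp add: int_pow_int)
qed

lemma (in group) conj_eq_one_iff:
  assumes "g \<in> carrier G" "x \<in> carrier G"
  shows "g \<otimes> x \<otimes> inv g = \<one> \<longleftrightarrow> x = \<one>"
proof
  assume "g \<otimes> x \<otimes> inv g = \<one>"
  then have "inv g \<otimes> (g \<otimes> x \<otimes> inv g) \<otimes> g = inv g \<otimes> \<one> \<otimes> g" by (simp only:)
  then show "x = \<one>" using assms by (simp add: group_normalize)
qed (use assms in simp)

context nilpotent_by_nilpotent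
begin

lemma power_conj:
  assumes Q: "subgroup Q G" and y: "y \<in> carrier G" and a: "a \<in> Q"
    and inv: "\<And>a. a \<in> Q \<Longrightarrow> a \<otimes> y \<otimes> inv a \<in> generate G {y}"
  obtains i :: nat where "a \<otimes> y \<otimes> inv a = y [^] i"
  using inv[OF a] generate_pow_on_finite_carrier[OF fin y] by blast

text \<open>On an invariant cyclic group the inverses of \<open>a\<close> and \<open>b\<close> act
  as power maps with exponents \<open>i\<close> and \<open>j\<close>, and both orders of composition
  give the exponent \<open>i * j\<close>.\<close>

lemma commutator_power_centralizing:
  assumes Q: "subgroup Q G" and a: "a \<in> Q" and b: "b \<in> Q"
  shows "a \<otimes> b \<otimes> inv a \<otimes> inv b \<in> power_centralizing p Q"
proof -
  have car: "a \<in> carrier G" "b \<in> carrier G" using a b subgroup.mem_carrier[OF Q] by auto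
  let ?c = "a \<otimes> b \<otimes> inv a \<otimes> inv b"
  have "?c \<otimes> y = y \<otimes> ?c"
    if y: "y \<in> primary p" and inv: "\<And>a. a \<in> Q \<Longrightarrow> a \<otimes> y \<otimes> inv a \<in> generate G {y}" for y
  proof -
    have yG: "y \<in> carrier G" using y primary_carrier by blast
    obtain i :: nat where i: "inv a \<otimes> y \<otimes> inv (inv a) = y [^] i"
      using power_conj[OF Q yG _ inv] subgroup.m_inv_closed[OF Q a] by blast
    obtain j :: nat where j: "inv b \<otimes> y \<otimes> inv (inv b) = y [^] j"
      using power_conj[OF Q yG _ inv] subgroup.m_inv_closed[OF Q b] by blast
    have "(inv a \<otimes> inv b) \<otimes> y \<otimes> inv (inv a \<otimes> inv b) = inv a \<otimes> (y [^] j) \<otimes> inv (inv a)"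
      unfolding j[symmetric] using car yG by (intro conj_conj[symmetric]) simp_all
    also have "\<dots> = y [^] (i * j)"
      using conj_pow[of "inv a" y j] car yG i by (simp add: nat_pow_pow)
    also have "\<dots> = inv b \<otimes> (y [^] i) \<otimes> inv (inv b)"
      using conj_pow[of "inv b" y i] car yG j by (simp add: nat_pow_pow mult.commute)
    also have "\<dots> = (inv b \<otimes> inv a) \<otimes> y \<otimes> inv (inv b \<otimes> inv a)"
      unfolding i[symmetric] using car yG by (intro conj_conj) simp_all
    finally have e: "(inv a \<otimes> inv b) \<otimes> y \<otimes> inv (inv a \<otimes> inv b) = (inv b \<otimes> inv a) \<otimes> y \<otimes> inv (inv b \<otimes> inv a)" .
    have "?c \<otimes> y \<otimes> inv ?c = (a \<otimes> b) \<otimes> ((inv a \<otimes> inv b) \<otimes> y \<otimes> inv (inv a \<otimes> inv b)) \<otimes> inv (a \<otimes> b)"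
      using car yG by (simp add: group_normalize)
    also have "\<dots> = y" unfolding e using car yG by (simp add: group_normalize)
    finally show ?thesis using conj_fixed_iff[of ?c y] car yG by blast
  qed
  moreover have "?c \<in> Q" using a b Q by (simp add: subgroup.m_closed subgroup.m_inv_closed)
  ultimately show ?thesis by (simp add: power_centralizing_def)
qed

lemma power_power_centralizing:
  assumes p: "Factorial_Ring.prime p" and q: "Factorial_Ring.prime q" "p \<noteq> q"
    and Q: "sylow_sub q Q" and a: "a \<in> Q"
  shows "a [^] (p - 1) \<in> power_centralizing p Q"
proof -
  have QG: "subgroup Q G" and cQ: "card Q = q ^ multiplicity q (order G)"
    using Q by (auto simp: sylow_sub_def)
  have aG: "a \<in> carrier G" using a subgroup.mem_carrier[OF QG] by auto
  let ?u = "a [^] (p - 1)"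
  have uQ: "?u \<in> Q" using subgroup_nat_pow_closed[OF QG a] .
  have "?u \<otimes> y = y \<otimes> ?u"
    if y: "y \<in> primary p" and inv: "\<And>a. a \<in> Q \<Longrightarrow> a \<otimes> y \<otimes> inv a \<in> generate G {y}" for y
  proof (cases "y = \<one>")
    case True
    then show ?thesis using aG by simp
  next
    case False
    have yG: "y \<in> carrier G" using y primary_carrier by blast
    obtain k' where "y [^] (p ^ k') = \<one>" using y by (auto simp: primary_def)
    then have "ord y dvd p ^ k'" using pow_eq_id yG by blast
    then obtain k where k: "ord y = p ^ k" using p by (auto simp: divides_primepow_nat)
    have "k > 0" using False k yG ord_eq_1[of y] by (cases k) auto
    obtain i :: nat where i: "a \<otimes> y \<otimes> inv a = y [^] i"
      using power_conj[OF QG yG a inv] by blast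
    have pow: "a [^] t \<otimes> y \<otimes> inv (a [^] t) = y [^] (i ^ t)" for t :: nat
    proof (induction t)
      case (Suc t)
      have "a [^] Suc t = a \<otimes> a [^] t" using nat_pow_Suc2[OF aG] .
      then have "a [^] Suc t \<otimes> y \<otimes> inv (a [^] Suc t) = a \<otimes> (a [^] t \<otimes> y \<otimes> inv (a [^] t)) \<otimes> inv a"
        using conj_conj[of a "a [^] t" y] aG yG by simp
      also have "\<dots> = (y [^] i) [^] (i ^ t)" unfolding Suc using conj_pow[OF aG yG] i by simp
      finally show ?case using yG by (simp add: nat_pow_pow)
    qed (use yG in simp)
    \<comment> \<open>Conjugation preserves the order, which makes \<open>i\<close> a unit modulo
      \<open>p ^ k\<close>, as Euler requires.\<close>
    have "ord (y [^] i) = ord y"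
    proof -
      have "(y [^] i) [^] n = \<one> \<longleftrightarrow> ord y dvd n" for n :: nat
        unfolding i[symmetric] conj_pow[OF aG yG, symmetric] conj_eq_one_iff[OF aG nat_pow_closed[OF yG]]
        by (rule pow_eq_id[OF yG])
      then show ?thesis using ord_unique[of "y [^] i" "ord y"] yG by blast
    qed
    then have "coprime i (ord y)"
      using pow_ord_eq_ord_iff[OF fin yG, of i] by blast
    then have "[i ^ totient (p ^ k) = 1] (mod p ^ k)" unfolding k by (rule euler_theorem)
    then have "y [^] (i ^ totient (p ^ k)) = y [^] (1::nat)"
      unfolding k[symmetric] by (rule nat_pow_cong[OF yG])
    then have "a [^] totient (p ^ k) \<otimes> y \<otimes> inv (a [^] totient (p ^ k)) = y" using pow yG by simp
    then have 1: "a [^] totient (p ^ k) \<otimes> y = y \<otimes> a [^] totient (p ^ k)"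
      using conj_fixed_iff[of "a [^] totient (p ^ k)" y] aG yG by simp
    have tot: "totient (p ^ k) = (p - 1) * p ^ (k - 1)"
      using p \<open>k > 0\<close> by (simp add: totient_prime_power)
    let ?C = "{g \<in> carrier G. \<forall>s\<in>{y}. g \<otimes> s = s \<otimes> g}"
    have C: "subgroup ?C G" using yG by (intro centralizer_subgroup) simp
    have "?u [^] (p ^ (k - 1)) \<in> ?C" using 1 aG tot by (simp add: nat_pow_pow)
    moreover have "?u [^] card Q \<in> ?C" using subgroup_pow_card[OF QG uQ] yG by simp
    moreover have "coprime (p ^ (k - 1)) (card Q)" using p q cQ by (simp add: primes_coprime)
    ultimately have "?u \<in> ?C" using coprime_pow_mem[OF C] aG by blast
    then show ?thesis by simp
  qed
  then show ?thesis using uQ by (simp add: power_centralizing_def)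
qed

text \<open>\<open>E\<close> is the product of \<open>F\<close>, \<open>P\<close> and the
  centralizer of \<open>primary p\<close>. Modulo \<open>E\<close> Sylow subgroups for different
  primes commute because \<open>F \<subseteq> E\<close>; for \<open>q \<noteq> p\<close> commutators
  and \<open>(p - 1)\<close>-st powers inside a Sylow subgroup centralize \<open>primary p\<close>.
  \<open>P\<close> is absorbed into \<open>E\<close> since \<open>perm\<close> concerns the other
  primes; a fixed point deals with it later.\<close>

lemma abelian_exponent_modulus:
  assumes p: "Factorial_Ring.prime p" and P: "sylow_sub p P"
    and perm: "\<And>q Q. Factorial_Ring.prime q \<Longrightarrow> q \<noteq> p \<Longrightarrow> sylow_sub q Q \<Longrightarrow> permuteral Q G"
  obtains E where "E \<lhd> G" "primary p \<subseteq> E"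
    "\<And>e. e \<in> E \<Longrightarrow> \<exists>c\<in>carrier G. \<exists>u\<in>P. e = c \<otimes> u \<and> (\<forall>r\<in>primary p. c \<otimes> r = r \<otimes> c)"
    "\<And>g h. g \<in> carrier G \<Longrightarrow> h \<in> carrier G \<Longrightarrow> g \<otimes> h \<otimes> inv g \<otimes> inv h \<in> E"
    "\<And>g. g \<in> carrier G \<Longrightarrow> g [^] (p - 1) \<in> E"
proof -
  note nR = primary_normal[OF p]
  have PG: "subgroup P G" and cP: "card P = p ^ multiplicity p (order G)"
    using P by (auto simp: sylow_sub_def)
  define C where "C = {g \<in> carrier G. \<forall>s\<in>primary p. g \<otimes> s = s \<otimes> g}"
  have nC: "C \<lhd> G" unfolding C_def by (rule centralizer_normal[OF nR])
  have sC: "subgroup C G" using nC normal_imp_subgroup by blast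
  define E where "E = (F <#> P) <#> C"
  have nFP: "F <#> P \<lhd> G" using mult_sylow_normal[OF p P] .
  have nE: "E \<lhd> G" unfolding E_def using normal_subgroup_set_mult_closed nFP nC by blast
  have sE: "subgroup E G" using nE normal_imp_subgroup by blast
  have sub: "F \<subseteq> F <#> P" "P \<subseteq> F <#> P" "F <#> P \<subseteq> E" "C \<subseteq> E"
    using subgroup_set_mult_normal[OF normal_F PG] subgroup_set_mult_normal[OF nFP sC]
    by (auto simp: E_def)
  have RP: "primary p \<subseteq> P" using primary_le_sylow[OF p P] .
  have decomp: "\<exists>c\<in>carrier G. \<exists>u\<in>P. e = c \<otimes> u \<and> (\<forall>r\<in>primary p. c \<otimes> r = r \<otimes> c)" if e: "e \<in> E" for e
  proof -
    obtain l c where lc: "l \<in> F <#> P" "c \<in> C" "e = l \<otimes> c" using e unfolding E_def by (rule set_multE)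
    obtain f u where fu: "f \<in> F" "u \<in> P" "l = f \<otimes> u" using lc(1) by (rule set_multE)
    obtain B where B: "B \<lhd> G" "B \<subseteq> F" "\<And>b. b \<in> B \<Longrightarrow> \<exists>m::nat. coprime m p \<and> b [^] m = \<one>"
      "\<And>f. f \<in> F \<Longrightarrow> \<exists>r\<in>primary p. \<exists>b\<in>B. f = r \<otimes> b"
      using primary_complement[OF p] by blast
    obtain r b where rb: "r \<in> primary p" "b \<in> B" "f = r \<otimes> b" using B(4)[OF fu(1)] by blast
    have car: "r \<in> carrier G" "b \<in> carrier G" "u \<in> carrier G" "c \<in> carrier G"
      using rb fu lc primary_carrier subgroup.mem_carrier[OF PG] subgroup.mem_carrier[OF sC]
        F_carrier B(2) by blast+
    obtain m :: nat where m: "coprime m p" "b [^] m = \<one>" using B(3) rb(2) by blast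
    have bC: "b \<in> C"
    proof -
      have "b \<otimes> s = s \<otimes> b" if "s \<in> primary p" for s
      proof -
        obtain k where k: "s \<in> F" "s [^] (p ^ k) = \<one>" using \<open>s \<in> _\<close> by (auto simp: primary_def)
        then show ?thesis using F_commute[of b s m "p ^ k"] m rb(2) B(2) by auto
      qed
      then show ?thesis using car by (simp add: C_def)
    qed
    \<comment> \<open>In \<open>r \<otimes> b \<otimes> u \<otimes> c\<close> the factors
      \<open>b\<close> and \<open>c\<close>, which centralize \<open>primary p\<close>, are moved to
      the left: \<open>b\<close> past \<open>r\<close>, and \<open>c\<close> past
      \<open>r \<otimes> u\<close>, which lies in \<open>P\<close> because
      \<open>primary p \<subseteq> P\<close>.\<close>
    let ?v = "r \<otimes> u"
    let ?c = "(r \<otimes> b \<otimes> inv r) \<otimes> (?v \<otimes> c \<otimes> inv ?v)"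
    have "?c \<in> C"
      by (rule subgroup.m_closed[OF sC])
        (use normal.inv_op_closed2[OF nC] bC lc(2) car in simp_all)
    moreover have "?v \<in> P" using RP rb(1) fu(2) subgroup.m_closed[OF PG] by blast
    moreover have "e = ?c \<otimes> ?v" unfolding lc(3) fu(3) rb(3) using car by (simp add: group_normalize)
    ultimately show ?thesis unfolding C_def by blast
  qed
  \<comment> \<open>For the prime \<open>p\<close> the Sylow subgroup has to be \<open>P\<close>
    itself, the one built into \<open>E\<close>; for other primes any choice works.\<close>
  have sylows: "\<exists>Q. sylow_sub q Q \<and> Q \<subseteq> H"
    if "Factorial_Ring.prime q" "\<And>Q. sylow_sub q Q \<Longrightarrow> (q = p \<Longrightarrow> Q = P) \<Longrightarrow> Q \<subseteq> H" for q H
    using sylow_sub_exists[OF fin that(1)] that(2) P by (cases "q = p") blast+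
  have DE: "d \<in> E" if "d \<in> power_centralizing p Q" "Factorial_Ring.prime q" "q \<noteq> p" "sylow_sub q Q" for d q Q
  proof -
    have "subgroup Q G" using that by (simp add: sylow_sub_def)
    then have "d \<in> carrier G"
      using that(1) subgroup.mem_carrier by (auto simp: power_centralizing_def)
    moreover have "\<forall>r\<in>primary p. d \<otimes> r = r \<otimes> d"
      using permuteral_centralizes[OF p that(2) _ that(4) perm[OF that(2-4)] that(1)] that(3) by blast
    ultimately show ?thesis using sub by (auto simp: C_def)
  qed
  have comm_E: "e \<otimes> h \<otimes> inv e \<otimes> inv h \<in> E" if e: "e \<in> E" and h: "h \<in> carrier G" for e h
  proof -
    have eG: "e \<in> carrier G" using e subgroup.mem_carrier[OF sE] by blast
    have "e \<otimes> (h \<otimes> inv e \<otimes> inv h) \<in> E"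
      by (rule subgroup.m_closed[OF sE])
        (use e h normal.inv_op_closed2[OF nE h] subgroup.m_inv_closed[OF sE] in simp_all)
    then show ?thesis using eG h by (simp add: m_assoc)
  qed
  \<comment> \<open>With \<open>a\<close> fixed in a Sylow subgroup \<open>Q\<close>, all
    \<open>g\<close> are reached through Sylow subgroups, where \<open>Q\<close> itself represents
    the prime of \<open>a\<close>. The fact \<open>comm\<close> repeats the reduction in the other
    argument.\<close>
  have step1: "g \<otimes> a \<otimes> inv g \<otimes> inv a \<in> E"
    if q: "Factorial_Ring.prime q" and Q: "sylow_sub q Q" "q = p \<Longrightarrow> Q = P" and a: "a \<in> Q" and g: "g \<in> carrier G"
    for q Q a g
  proof -
    have QG: "subgroup Q G" using Q by (simp add: sylow_sub_def)
    have aG: "a \<in> carrier G" using a subgroup.mem_carrier[OF QG] by blast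
    let ?Z = "{g \<in> carrier G. g \<otimes> a \<otimes> inv g \<otimes> inv a \<in> E}"
    have "?Z = carrier G"
    proof (rule subgroup_with_sylows[OF fin commutator_mem_subgroup[OF nE aG]])
      fix r :: nat assume r: "Factorial_Ring.prime r"
      show "\<exists>R\<subseteq>?Z. sylow_sub r R"
      proof (cases "r = q")
        case True
        have "Q \<subseteq> ?Z"
        proof
          fix b assume b: "b \<in> Q"
          have bG: "b \<in> carrier G" using b subgroup.mem_carrier[OF QG] by blast
          have "b \<otimes> a \<otimes> inv b \<otimes> inv a \<in> E"
          proof (cases "q = p")
            case True
            then show ?thesis using comm_E b Q(2) sub aG by blast
          next
            case False
            then show ?thesis using DE[OF commutator_power_centralizing[OF QG b a] q _ Q(1)] by blast
          qed
          then show "b \<in> ?Z" using bG by simp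
        qed
        then show ?thesis using Q(1) True by blast
      next
        case False
        obtain R where R: "sylow_sub r R" using sylow_sub_exists[OF fin r] by blast
        have RG: "subgroup R G" using R by (simp add: sylow_sub_def)
        have "R \<subseteq> ?Z"
        proof
          fix b assume b: "b \<in> R"
          have bG: "b \<in> carrier G" using b subgroup.mem_carrier[OF RG] by blast
          have "coprime (card R) (card Q)"
            using R Q r q False by (simp add: sylow_sub_def primes_coprime)
          moreover have "b [^] card R \<in> F" "a [^] card Q \<in> F"
            using subgroup_pow_card[OF RG b] subgroup_pow_card[OF QG a] subgroup.one_closed[OF subgroup_F]
            by simp_all
          ultimately have "b \<otimes> a \<otimes> inv b \<otimes> inv a \<in> F"
            using quotient_commuting aG bG unfolding coprime_commuting_def by blast
          then show "b \<in> ?Z" using bG sub by blast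
        qed
        then show ?thesis using R by blast
      qed
    qed
    then show ?thesis using g by blast
  qed
  have comm: "g \<otimes> h \<otimes> inv g \<otimes> inv h \<in> E" if g: "g \<in> carrier G" and h: "h \<in> carrier G" for g h
  proof -
    let ?Z = "{a \<in> carrier G. a \<otimes> g \<otimes> inv a \<otimes> inv g \<in> E}"
    have "?Z = carrier G"
    proof (rule subgroup_with_sylows[OF fin commutator_mem_subgroup[OF nE g]])
      fix r :: nat assume r: "Factorial_Ring.prime r"
      have "Q \<subseteq> ?Z" if Q: "sylow_sub r Q" "r = p \<Longrightarrow> Q = P" for Q
      proof
        fix a assume a: "a \<in> Q"
        have "subgroup Q G" using Q by (simp add: sylow_sub_def)
        then have "a \<in> carrier G" using a subgroup.mem_carrier by metis
        then show "a \<in> ?Z" using commutator_mem_sym[OF sE g _ step1[OF r Q a g]] by simp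
      qed
      from sylows[OF r this] show "\<exists>Q\<subseteq>?Z. sylow_sub r Q" by blast
    qed
    then show ?thesis using commutator_mem_sym[OF sE h g] h by blast
  qed
  have "g [^] (p - 1) \<in> E" if g: "g \<in> carrier G" for g
  proof -
    let ?Z = "{g \<in> carrier G. g [^] (p - 1) \<in> E}"
    interpret E: normal E G by (rule nE)
    interpret q: group_hom G "G Mod E" "\<lambda>a. E #> a" using group_hom_coset nE by blast
    \<comment> \<open>As commutators lie in \<open>E\<close>, taking \<open>(p - 1)\<close>-st
      powers is multiplicative modulo \<open>E\<close>.\<close>
    have mult: "a \<otimes> b \<in> ?Z" if ab: "a \<in> ?Z" "b \<in> ?Z" for a b
    proof -
      have abG: "a \<in> carrier G" "b \<in> carrier G" using ab by auto
      have "E #> (a \<otimes> b) = E #> (a \<otimes> b \<otimes> inv a \<otimes> inv b \<otimes> (b \<otimes> a))" using abG by (simp add: group_normalize)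
      also have "\<dots> = E #> (b \<otimes> a)"
        using coset_mult_assoc[OF E.subset, of "a \<otimes> b \<otimes> inv a \<otimes> inv b" "b \<otimes> a"] abG comm[OF abG]
          coset_eq_iff[OF sE, of "a \<otimes> b \<otimes> inv a \<otimes> inv b"] by simp
      finally have "(E #> a) \<otimes>\<^bsub>G Mod E\<^esub> (E #> b) = (E #> b) \<otimes>\<^bsub>G Mod E\<^esub> (E #> a)"
        using abG q.hom_mult by metis
      from q.H.pow_mult_distrib[OF this, of "p - 1"]
      have "E #> (a \<otimes> b) [^] (p - 1) = (E #> a [^] (p - 1)) \<otimes>\<^bsub>G Mod E\<^esub> (E #> b [^] (p - 1))"
        using abG by (simp del: mult_FactGroup flip: E.FactGroup_pow)
      also have "\<dots> = E"
      proof -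
        have "E #> a [^] (p - 1) = E" "E #> b [^] (p - 1) = E"
          using ab coset_eq_iff[OF sE nat_pow_closed] by simp_all
        then show ?thesis using q.H.l_one[OF q.H.one_closed] by simp
      qed
      finally show ?thesis using coset_eq_iff[OF sE] abG by simp
    qed
    have "subgroup ?Z G"
    proof (rule subgroupI)
      show "inv a \<in> ?Z" if "a \<in> ?Z" for a
        using that E.m_inv_closed by (auto simp: nat_pow_inv)
      show "?Z \<noteq> {}" using E.one_closed by (auto intro!: exI[of _ \<one>])
    qed (use mult in auto)
    moreover have "\<exists>Q\<subseteq>?Z. sylow_sub r Q" if r: "Factorial_Ring.prime r" for r
    proof -
      have "Q \<subseteq> ?Z" if Q: "sylow_sub r Q" "r = p \<Longrightarrow> Q = P" for Q
      proof
        fix a assume a: "a \<in> Q"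
        have QG: "subgroup Q G" using Q by (simp add: sylow_sub_def)
        then have aG: "a \<in> carrier G" using a subgroup.mem_carrier by metis
        show "a \<in> ?Z"
        proof (cases "r = p")
          case True
          then have "a \<in> E" using a Q sub by blast
          then show ?thesis using aG subgroup_nat_pow_closed[OF sE] by simp
        next
          case False
          then show ?thesis
            using DE[OF power_power_centralizing[OF p r _ Q(1) a] r _ Q(1)] aG by simp
        qed
      qed
      from sylows[OF r this] show ?thesis by blast
    qed
    ultimately have "?Z = carrier G" using subgroup_with_sylows[OF fin] by blast
    then show ?thesis using g by blast
  qed
  moreover have "primary p \<subseteq> E" using sub by (auto simp: primary_def)
  ultimately show ?thesis using that[OF nE _ decomp comm] by blast
qed

end

section \<open>Eigenvectors of automorphisms of order dividing \<open>p - 1\<close>\<close>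

text \<open>Multiplication by a primitive root \<open>g\<close> permutes the nonzero residues, so
  the sum \<open>s\<close> satisfies \<open>s = g ^ i * s\<close> modulo \<open>p\<close>, while
  \<open>g ^ i\<close> is not 1 because \<open>0 < i < p - 1\<close>.\<close>

lemma dvd_power_sum:
  fixes p i :: nat
  assumes p: "Factorial_Ring.prime p" and i: "0 < i" "i < p - 1"
  shows "p dvd (\<Sum>l\<in>{1..p - 1}. l ^ i)"
proof -
  obtain g where g: "residue_primroot p g"
    using prime_primitive_root_exists[of p] p prime_gt_1_nat[OF p] by blast
  have cop: "coprime p g"
    using g by (auto simp: residue_primroot_def)
  have "\<not> [g ^ i = 1] (mod p)"
  proof
    assume "[g ^ i = 1] (mod p)"
    then have "ord p g dvd i" by (rule iffD1[OF ord_divides])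
    then have "p - 1 dvd i"
      using g p by (simp add: residue_primroot_def totient_prime)
    then show False using i by (simp add: dvd_imp_le leD)
  qed
  let ?L = "{1..p - 1}"
  let ?f = "\<lambda>l. g * l mod p"
  have small: "coprime p l" if "l \<in> ?L" for l
  proof -
    have "\<not> p dvd l" using that by (auto dest: dvd_imp_le)
    then show ?thesis using p prime_imp_coprime by blast
  qed
  have "inj_on ?f ?L"
  proof (rule inj_onI)
    fix x y assume xy: "x \<in> ?L" "y \<in> ?L" "g * x mod p = g * y mod p"
    then have "[g * x = g * y] (mod p)" by (simp add: cong_def)
    then have "[x = y] (mod p)" using cop by (simp add: cong_mult_lcancel_nat coprime_commute)
    then show "x = y" using xy by (auto simp: cong_def)
  qed
  moreover have "?f ` ?L \<subseteq> ?L"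
  proof
    fix y assume "y \<in> ?f ` ?L"
    then obtain l where l: "l \<in> ?L" "y = g * l mod p" by blast
    have "coprime p (g * l)" using cop small[OF l(1)] by simp
    then have "\<not> p dvd g * l" using p by (metis coprime_absorb_left not_prime_unit)
    then have "y \<noteq> 0" using l(2) by (simp add: dvd_eq_mod_eq_0)
    moreover have "y < p" using l(2) p by (simp add: prime_gt_0_nat)
    ultimately show "y \<in> ?L" by auto
  qed
  ultimately have "?f ` ?L = ?L" by (simp add: endo_inj_surj)
  then have perm: "(\<Sum>l\<in>?L. l ^ i) = (\<Sum>l\<in>?L. ?f l ^ i)"
    using sum.reindex[OF \<open>inj_on ?f ?L\<close>, of "\<lambda>l. l ^ i"] by simp
  have "[(\<Sum>l\<in>?L. ?f l ^ i) = (\<Sum>l\<in>?L. (g * l) ^ i)] (mod p)"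
    by (intro cong_sum cong_pow) (simp add: cong_def)
  then have e: "[(\<Sum>l\<in>?L. l ^ i) = g ^ i * (\<Sum>l\<in>?L. l ^ i)] (mod p)"
    unfolding perm[symmetric] by (simp only: power_mult_distrib sum_distrib_left)
  show ?thesis
  proof (rule ccontr)
    assume "\<not> p dvd (\<Sum>l\<in>?L. l ^ i)"
    then have "coprime (\<Sum>l\<in>?L. l ^ i) p" using p prime_imp_coprime coprime_commute by blast
    moreover have "[1 * (\<Sum>l\<in>?L. l ^ i) = g ^ i * (\<Sum>l\<in>?L. l ^ i)] (mod p)" using e by simp
    ultimately have "[1 = g ^ i] (mod p)" using cong_mult_rcancel_nat by blast
    then show False using \<open>\<not> [g ^ i = 1] (mod p)\<close> cong_sym by blast
  qed
qed

context comm_group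
begin

text \<open>Additively: each \<open>l\<close> gives a linear relation between the \<open>f i\<close>
  with coefficients \<open>c l i\<close>, and these relations are added up.\<close>

lemma finprod_pow_sum_one:
  assumes "finite L" "finite I" "\<And>i. i \<in> I \<Longrightarrow> f i \<in> carrier G"
    and "\<And>l. l \<in> L \<Longrightarrow> (\<Otimes>i\<in>I. f i [^] (c l i :: nat)) = \<one>"
  shows "(\<Otimes>i\<in>I. f i [^] (\<Sum>l\<in>L. c l i)) = \<one>"
  using assms(1,4)
proof (induction L)
  case empty
  then show ?case by simp
next
  case (insert l L)
  have "(\<Otimes>i\<in>I. f i [^] (\<Sum>l\<in>insert l L. c l i)) = (\<Otimes>i\<in>I. f i [^] c l i \<otimes> f i [^] (\<Sum>l\<in>L. c l i))"
    using insert(1,2) assms(3) by (intro finprod_cong') (auto simp: nat_pow_mult)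
  also have "\<dots> = (\<Otimes>i\<in>I. f i [^] c l i) \<otimes> (\<Otimes>i\<in>I. f i [^] (\<Sum>l\<in>L. c l i))"
    using assms(3) by (intro finprod_multf) auto
  also have "\<dots> = \<one>" using insert by simp
  finally show ?case .
qed

lemma finprod_nat_pow:
  assumes "\<And>i. i \<in> I \<Longrightarrow> f i \<in> carrier G"
  shows "(\<Otimes>i\<in>I. f i) [^] (n::nat) = (\<Otimes>i\<in>I. f i [^] n)"
  using assms
proof (induction I rule: infinite_finite_induct)
  case (insert x F)
  then show ?case by (simp add: Pi_def nat_pow_distrib)
qed auto

lemma hom_finprod:
  assumes "\<phi> \<in> hom G G" "\<And>i. i \<in> I \<Longrightarrow> f i \<in> carrier G"
  shows "\<phi> (\<Otimes>i\<in>I. f i) = (\<Otimes>i\<in>I. \<phi> (f i))"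
proof -
  interpret h: group_hom G G \<phi> using assms(1) by unfold_locales
  show ?thesis
    using assms(2) by (induction I rule: infinite_finite_induct) (auto simp: Pi_def)
qed

text \<open>Up to the scalar \<open>p - 1\<close>, the projection of \<open>w\<close> to an eigenspace of \<open>\<phi>\<close> is the product of the
  \<open>(\<phi> ^^ i) w [^] (l ^ i)\<close> over \<open>i < p - 1\<close>. Not all of these vanish, because the product over
  \<open>l = 1, ..., p - 1\<close> is \<open>w [^] (p - 1)\<close> by the vanishing of power sums modulo \<open>p\<close>.\<close>

lemma exists_eigenvector:
  assumes p: "Factorial_Ring.prime p"
    and exponent: "\<And>a. a \<in> carrier G \<Longrightarrow> a [^] p = \<one>"
    and hom: "\<phi> \<in> hom G G" and period: "\<And>a. a \<in> carrier G \<Longrightarrow> (\<phi> ^^ (p - 1)) a = a"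
    and w: "w \<in> carrier G" "w \<noteq> \<one>"
  shows "\<exists>v\<in>carrier G. v \<noteq> \<one> \<and> (\<exists>k::nat. \<phi> v = v [^] k)"
proof -
  interpret h: group_hom G G \<phi> using hom by unfold_locales
  obtain m where m: "p - 1 = Suc m" using prime_gt_1_nat[OF p] by (metis Suc_diff_Suc diff_Suc_1' One_nat_def)
  have pow_cong: "a [^] (i::nat) = a [^] (j::nat)" if "a \<in> carrier G" "[i = j] (mod p)" for a i j
  proof -
    have "ord a dvd p" using exponent[OF that(1)] pow_eq_id[OF that(1)] by blast
    then show ?thesis using that cong_dvd_modulus_nat nat_pow_cong by blast
  qed
  let ?x = "\<lambda>i. (\<phi> ^^ i) w"
  have x: "?x i \<in> carrier G" for i using w by (induction i) auto
  define v where "v l = (\<Otimes>i\<in>{..m}. ?x i [^] (l ^ i))" for l :: nat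
  have vG: "v l \<in> carrier G" for l unfolding v_def using x by (intro finprod_closed) auto
  \<comment> \<open>If nontrivial, \<open>v l\<close> is an eigenvector for the inverse of
    \<open>l\<close> modulo \<open>p\<close>: applying \<open>\<phi>\<close> and raising to the
    power \<open>l\<close> moves each factor one place on, and the factor with index
    \<open>p - 1\<close> equals the one with index 0 by \<open>period\<close> and Fermat.\<close>
  have shift: "\<phi> (v l) [^] l = v l" if l: "l \<in> {1..p - 1}" for l
  proof -
    let ?g = "\<lambda>i. ?x i [^] (l ^ i)"
    have g: "?g i \<in> carrier G" for i using x by simp
    have "\<phi> (v l) = (\<Otimes>i\<in>{..m}. \<phi> (?g i))"
      unfolding v_def using hom_finprod[OF hom, of "{..m}" ?g] g by simp
    also have "\<dots> = (\<Otimes>i\<in>{..m}. ?x (Suc i) [^] (l ^ i))"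
      using x by (intro finprod_cong') (auto simp: h.hom_nat_pow)
    finally have "\<phi> (v l) [^] l = (\<Otimes>i\<in>{..m}. (?x (Suc i) [^] (l ^ i)) [^] l)"
      using finprod_nat_pow[of "{..m}" "\<lambda>i. ?x (Suc i) [^] (l ^ i)" l] x nat_pow_closed by presburger
    also have "\<dots> = (\<Otimes>i\<in>{..m}. ?g (Suc i))"
    proof (rule finprod_cong')
      show "(?x (Suc i) [^] (l ^ i)) [^] l = ?g (Suc i)" for i
        using x[of "Suc i"] by (simp only: nat_pow_pow power_Suc mult.commute)
    qed (rule refl, intro Pi_I g)
    finally have a: "\<phi> (v l) [^] l = (\<Otimes>i\<in>{..m}. ?g (Suc i))" .
    have "\<not> p dvd l" using l by (auto dest: dvd_imp_le)
    then have "[l ^ (p - 1) = 1] (mod p)" using fermat_theorem p by blast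
    then have "?g (Suc m) = ?x (Suc m) [^] (1::nat)" unfolding m by (rule pow_cong[OF x])
    also have "\<dots> = ?g 0" using period[OF w(1)] m w(1) x[of "Suc m"] by simp
    finally have "?g (Suc m) = ?g 0" .
    moreover have "(\<Otimes>i\<in>{..m}. ?g (Suc i)) \<otimes> ?g 0 = ?g (Suc m) \<otimes> (\<Otimes>i\<in>{..m}. ?g i)"
      using finprod_Suc2[of ?g m] finprod_Suc[of ?g m] g by (simp add: Pi_def)
    moreover have closed: "(\<Otimes>i\<in>{..m}. ?g i) \<in> carrier G" "(\<Otimes>i\<in>{..m}. ?g (Suc i)) \<in> carrier G"
      by (intro finprod_closed Pi_I g)+
    ultimately have "(\<Otimes>i\<in>{..m}. ?g (Suc i)) \<otimes> ?g 0 = (\<Otimes>i\<in>{..m}. ?g i) \<otimes> ?g 0"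
      using m_comm[OF g[of 0] closed(1)] by (simp only:)
    then have "(\<Otimes>i\<in>{..m}. ?g (Suc i)) = (\<Otimes>i\<in>{..m}. ?g i)"
      using right_cancel[OF g[of 0] closed(2,1)] by blast
    then show ?thesis using a by (simp add: v_def)
  qed
  have "\<exists>l\<in>{1..p - 1}. v l \<noteq> \<one>"
  proof (rule ccontr)
    assume "\<not> ?thesis"
    then have "(\<Otimes>i\<in>{..m}. ?x i [^] (\<Sum>l\<in>{1..p - 1}. l ^ i)) = \<one>"
      using x by (intro finprod_pow_sum_one) (auto simp: v_def)
    \<comment> \<open>The exponents are power sums: 0 modulo \<open>p\<close> for
      \<open>0 < i < p - 1\<close>, but \<open>p - 1\<close> for \<open>i = 0\<close> since
      \<open>l ^ 0 = 1\<close>.\<close>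
    moreover have "(\<Otimes>i\<in>{..m}. ?x i [^] (\<Sum>l\<in>{1..p - 1}. l ^ i))
        = (\<Otimes>i\<in>{..m}. if 0 = i then ?x i [^] (p - 1) else \<one>)"
    proof (rule finprod_cong')
      fix i assume i: "i \<in> {..m}"
      show "?x i [^] (\<Sum>l\<in>{1..p - 1}. l ^ i) = (if 0 = i then ?x i [^] (p - 1) else \<one>)"
      proof (cases "i = 0")
        case False
        then have "[(\<Sum>l\<in>{1..p - 1}. l ^ i) = 0] (mod p)"
          using dvd_power_sum[OF p, of i] i m by (simp add: cong_0_iff)
        then show ?thesis using pow_cong[OF x, of _ 0 i] False by simp
      qed simp
    qed (use x w(1) in auto)
    moreover have "\<dots> = ?x 0 [^] (p - 1)"
    proof (rule finprod_singleton)
      show "(\<lambda>i. ?x i [^] (p - 1)) \<in> {..m} \<rightarrow> carrier G" by (intro Pi_I nat_pow_closed x)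
    qed simp_all
    ultimately have "w [^] (p - 1) \<in> {\<one>}" by simp
    moreover have "w [^] p \<in> {\<one>}" using exponent w by simp
    moreover have "coprime (p - 1) p" by (rule coprime_diff_one_left_nat[OF prime_gt_0_nat[OF p]])
    ultimately show False using coprime_pow_mem[OF triv_subgroup w(1)] w(2) by blast
  qed
  then obtain l where l: "l \<in> {1..p - 1}" "v l \<noteq> \<one>" by blast
  have "\<not> p dvd l" using l by (auto dest: dvd_imp_le)
  then have "coprime l p" using p prime_imp_coprime coprime_commute by blast
  then obtain k where "[l * k = 1] (mod p)" using cong_solve_coprime_nat by auto
  then have "\<phi> (v l) [^] (l * k) = \<phi> (v l) [^] (1::nat)" using pow_cong vG by simp
  then have "\<phi> (v l) = (\<phi> (v l) [^] l) [^] k" using vG by (simp add: nat_pow_pow)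
  then have "\<phi> (v l) = v l [^] k" using shift[OF l(1)] by simp
  then show ?thesis using l vG by blast
qed

end

section \<open>Scalar action on a minimal normal subgroup\<close>

context group
begin

text \<open>\<open>E\<close> centralizes a nontrivial part of \<open>R\<close>, since
  \<open>P\<close> fixes some \<open>v\<close> in \<open>R\<close> and the other factor of an
  element of \<open>E\<close> centralizes \<open>R\<close>. On a minimal normal subgroup
  \<open>N\<close> of exponent \<open>p\<close> in this part, \<open>g\<close> acts with order
  dividing \<open>p - 1\<close> and so has an eigenvector. By minimality the eigenspace is
  \<open>N\<close>, for every \<open>g\<close>. The data are abstract so that images in a quotient
  can be inserted.\<close>

lemma exists_normal_cyclic:
  assumes fin: "finite (carrier G)" and p: "Factorial_Ring.prime p"
    and R: "R \<lhd> G" "card R = p ^ a" "R \<noteq> {\<one>}"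
    and E: "E \<lhd> G" "R \<subseteq> E"
    and P: "subgroup P G" "card P = p ^ b"
    and decomp: "\<And>e. e \<in> E \<Longrightarrow> \<exists>c\<in>carrier G. \<exists>u\<in>P. e = c \<otimes> u \<and> (\<forall>r\<in>R. c \<otimes> r = r \<otimes> c)"
    and comm: "\<And>g h. g \<in> carrier G \<Longrightarrow> h \<in> carrier G \<Longrightarrow> g \<otimes> h \<otimes> inv g \<otimes> inv h \<in> E"
    and pow: "\<And>g. g \<in> carrier G \<Longrightarrow> g [^] (p - 1) \<in> E"
  shows "\<exists>z\<in>R. z \<noteq> \<one> \<and> (\<forall>g\<in>carrier G. \<exists>k::nat. g \<otimes> z \<otimes> inv g = z [^] k)"
proof -
  have sR: "subgroup R G" using R(1) normal_imp_subgroup by blast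
  have RG: "r \<in> carrier G" if "r \<in> R" for r using that subgroup.mem_carrier[OF sR] by blast
  have PG: "u \<in> carrier G" if "u \<in> P" for u using that subgroup.mem_carrier[OF P(1)] by blast
  have finR: "finite R" using fin subgroup.subset[OF sR] finite_subset by blast
  have oneR: "\<one> \<in> R" using subgroup.one_closed[OF sR] .
  have a: "a > 0"
  proof (rule ccontr)
    assume "\<not> a > 0"
    then have "card R = 1" using R(2) by simp
    then show False using R(3) oneR by (metis card_1_singletonE singletonD)
  qed
  have "\<exists>v\<in>R - {\<one>}. \<forall>u\<in>P. u \<otimes> v \<otimes> inv u = v"
  proof (rule ccontr)
    assume no: "\<not> ?thesis"
    have "p dvd card (R - {\<one>})"
    proof (rule prime_power_group_fixed_point[OF P p, where act = "\<lambda>u v. u \<otimes> v \<otimes> inv u"])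
      show "u \<otimes> v \<otimes> inv u \<in> R - {\<one>}" if "u \<in> P" "v \<in> R - {\<one>}" for u v
        using that normal.inv_op_closed2[OF R(1)] conj_eq_one_iff PG RG by auto
      show "g \<otimes> h \<otimes> v \<otimes> inv (g \<otimes> h) = g \<otimes> (h \<otimes> v \<otimes> inv h) \<otimes> inv g"
        if "g \<in> P" "h \<in> P" "v \<in> R - {\<one>}" for g h v
        using that conj_conj PG RG by simp
    qed (use finR RG no in auto)
    moreover have "card (R - {\<one>}) = p ^ a - 1" using R(2) finR oneR by simp
    moreover have "p dvd p ^ a" using a by simp
    ultimately have "p dvd p ^ a - (p ^ a - 1)" using dvd_diff_nat by metis
    moreover have "p ^ a - (p ^ a - 1) = 1" using prime_gt_0_nat[OF p] by simp
    ultimately show False using p by simp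
  qed
  then obtain v where v: "v \<in> R" "v \<noteq> \<one>" "\<And>u. u \<in> P \<Longrightarrow> u \<otimes> v \<otimes> inv u = v" by blast
  have vG: "v \<in> carrier G" using RG v by blast
  define V where "V = R \<inter> {g \<in> carrier G. \<forall>e\<in>E. g \<otimes> e = e \<otimes> g}"
  have nV: "V \<lhd> G" unfolding V_def using normal_subgroup_intersect R(1) centralizer_normal[OF E(1)] by blast
  have sV: "subgroup V G" using nV normal_imp_subgroup by blast
  have EG: "e \<in> carrier G" if "e \<in> E" for e using that subgroup.mem_carrier[OF normal_imp_subgroup[OF E(1)]] by blast
  have vV: "v \<in> V"
  proof -
    have "v \<otimes> e = e \<otimes> v" if e: "e \<in> E" for e
    proof -
      obtain c u where cu: "c \<in> carrier G" "u \<in> P" "e = c \<otimes> u" "\<And>r. r \<in> R \<Longrightarrow> c \<otimes> r = r \<otimes> c"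
        using decomp[OF e] by blast
      have uG: "u \<in> carrier G" using cu PG by blast
      have "e \<otimes> v \<otimes> inv e = c \<otimes> (u \<otimes> v \<otimes> inv u) \<otimes> inv c"
        using cu uG vG by (simp add: conj_conj)
      also have "\<dots> = v" using v(3)[OF cu(2)] conj_fixed_iff[OF cu(1) vG] cu(4)[OF v(1)] by simp
      finally show ?thesis using conj_fixed_iff[OF EG[OF e] vG] by simp
    qed
    then show ?thesis using v(1) vG by (simp add: V_def)
  qed
  have comV: "x \<otimes> y = y \<otimes> x" if "x \<in> V" "y \<in> V" for x y
    using that E(2) by (auto simp: V_def)
  \<comment> \<open>Exponent \<open>p\<close> is needed for eigenvectors. \<open>V\<close> is
    abelian because it centralizes \<open>E\<close>, and
    \<open>V \<subseteq> R \<subseteq> E\<close>.\<close>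
  define W where "W = {x \<in> V. x [^] p = \<one>}"
  have VG: "x \<in> carrier G" if "x \<in> V" for x using that subgroup.mem_carrier[OF sV] by blast
  have nW: "W \<lhd> G"
  proof (rule normal_invI)
    show "subgroup W G"
    proof (rule subgroupI)
      show "x \<otimes> y \<in> W" if "x \<in> W" "y \<in> W" for x y
        using that pow_mult_distrib[of x y p] comV VG subgroup.m_closed[OF sV] by (auto simp: W_def)
    qed (use VG subgroup.one_closed[OF sV] subgroup.m_inv_closed[OF sV] in \<open>auto simp: W_def nat_pow_inv\<close>)
    show "g \<otimes> x \<otimes> inv g \<in> W" if "g \<in> carrier G" "x \<in> W" for g x
      using that conj_pow[of g x p] normal.inv_op_closed2[OF nV] VG by (auto simp: W_def)
  qed
  obtain w where w: "w \<in> W" "w \<noteq> \<one>"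
  proof -
    have "v [^] (p ^ a) = \<one>" using subgroup_pow_card[OF sR v(1)] R(2) by simp
    then have "ord v dvd p ^ a" using pow_eq_id vG by blast
    then obtain j where j: "ord v = p ^ j" using p by (auto simp: divides_primepow_nat)
    have "j > 0" using v(2) j ord_eq_1[OF vG] by (cases j) auto
    have "(v [^] (p ^ (j - 1))) [^] p = v [^] ord v"
      unfolding j using vG \<open>j > 0\<close> by (simp add: nat_pow_pow flip: power_Suc2)
    then have "(v [^] (p ^ (j - 1))) [^] p = \<one>" using vG by simp
    moreover have "v [^] (p ^ (j - 1)) \<noteq> \<one>"
    proof
      assume "v [^] (p ^ (j - 1)) = \<one>"
      then have "p ^ j dvd p ^ (j - 1)" using pow_eq_id[OF vG] j by simp
      then have "j \<le> j - 1" using p by (simp add: power_dvd_imp_le prime_gt_Suc_0_nat)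
      then show False using \<open>j > 0\<close> by simp
    qed
    ultimately show ?thesis using that subgroup_nat_pow_closed[OF sV vV] by (auto simp: W_def)
  qed
  define NN where "NN = {N. N \<lhd> G \<and> N \<subseteq> W \<and> N \<noteq> {\<one>}}"
  have "finite NN"
    by (rule finite_subset[of _ "Pow (carrier G)"])
      (use fin VG in \<open>auto simp: NN_def W_def\<close>)
  moreover have "W \<in> NN" using nW w by (auto simp: NN_def)
  ultimately obtain N where N: "N \<in> NN" and minN: "\<And>M'. M' \<in> NN \<Longrightarrow> M' \<subseteq> N \<Longrightarrow> N = M'"
    using finite_has_minimal2[of NN W] by blast
  have nN: "N \<lhd> G" and NW: "N \<subseteq> W" and N1: "N \<noteq> {\<one>}" using N by (auto simp: NN_def)
  have sN: "subgroup N G" using nN normal_imp_subgroup by blast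
  have NG: "x \<in> carrier G" if "x \<in> N" for x using that subgroup.mem_carrier[OF sN] by blast
  have comN: "x \<otimes> y = y \<otimes> x" if "x \<in> N" "y \<in> N" for x y using that comV NW by (auto simp: W_def)
  have NE: "x \<otimes> e = e \<otimes> x" if "x \<in> N" "e \<in> E" for x e using that NW by (auto simp: W_def V_def)
  interpret N: comm_group "G\<lparr>carrier := N\<rparr>"
    by (rule group.group_comm_groupI[OF subgroup_imp_group[OF sN]]) (use comN in simp)
  obtain n where n: "n \<in> N" "n \<noteq> \<one>" using N1 subgroup.one_closed[OF sN] by blast
  have "\<exists>k::nat. g \<otimes> n \<otimes> inv g = n [^] k" if g: "g \<in> carrier G" for g
  proof -
    let ?f = "\<lambda>x. g \<otimes> x \<otimes> inv g"
    have fN: "?f x \<in> N" if "x \<in> N" for x using normal.inv_op_closed2[OF nN g that] .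
    have iter: "(?f ^^ i) x = g [^] i \<otimes> x \<otimes> inv (g [^] i)" if x: "x \<in> N" for x and i :: nat
    proof (induction i)
      case (Suc i)
      have "(?f ^^ Suc i) x = (g \<otimes> g [^] i) \<otimes> x \<otimes> inv (g \<otimes> g [^] i)"
        using Suc conj_conj[of g "g [^] i" x] g NG[OF x] by simp
      then show ?case using nat_pow_Suc2[OF g, of i] by (simp only:)
    qed (use NG[OF x] in simp)
    have "\<exists>x\<in>carrier (G\<lparr>carrier := N\<rparr>). x \<noteq> \<one>\<^bsub>G\<lparr>carrier := N\<rparr>\<^esub> \<and> (\<exists>k::nat. ?f x = x [^]\<^bsub>G\<lparr>carrier := N\<rparr>\<^esub> k)"
    proof (rule N.exists_eigenvector[OF p])
      show "x [^]\<^bsub>G\<lparr>carrier := N\<rparr>\<^esub> p = \<one>\<^bsub>G\<lparr>carrier := N\<rparr>\<^esub>" if "x \<in> carrier (G\<lparr>carrier := N\<rparr>)" for x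
        using that NW by (auto simp: W_def simp flip: nat_pow_consistent)
      show "?f \<in> hom (G\<lparr>carrier := N\<rparr>) (G\<lparr>carrier := N\<rparr>)"
        using fN conj_mult[OF g] NG by (intro homI) auto
      show "(?f ^^ (p - 1)) x = x" if "x \<in> carrier (G\<lparr>carrier := N\<rparr>)" for x
      proof -
        have x: "x \<in> N" using that by simp
        show ?thesis unfolding iter[OF x]
          using conj_fixed_iff[OF nat_pow_closed[OF g] NG[OF x]] NE[OF x pow[OF g]] by simp
      qed
    qed (use n in auto)
    then obtain x and k :: nat where x: "x \<in> N" "x \<noteq> \<one>" "?f x = x [^] k"
      by (auto simp flip: nat_pow_consistent)
    \<comment> \<open>The full eigenspace of \<open>g\<close> for the exponent \<open>k\<close>;
      that it is all of \<open>N\<close> means that \<open>g\<close> acts as a scalar.\<close>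
    define M' where "M' = {y \<in> N. ?f y = y [^] k}"
    have nM: "M' \<lhd> G"
    proof (rule normal_invI)
      show "subgroup M' G"
      proof (rule subgroupI)
        show "y \<otimes> z \<in> M'" if yz: "y \<in> M'" "z \<in> M'" for y z
        proof -
          have y: "y \<in> N" "?f y = y [^] k" and z: "z \<in> N" "?f z = z [^] k" using yz by (auto simp: M'_def)
          have "?f (y \<otimes> z) = (y \<otimes> z) [^] k"
            unfolding conj_mult[OF g NG[OF y(1)] NG[OF z(1)]] y(2) z(2)
            by (rule pow_mult_distrib[OF comN[OF y(1) z(1)] NG[OF y(1)] NG[OF z(1)], symmetric])
          then show ?thesis using subgroup.m_closed[OF sN y(1) z(1)] by (simp add: M'_def)
        qed
        show "inv y \<in> M'" if y: "y \<in> M'" for y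
        proof -
          have yN: "y \<in> N" "?f y = y [^] k" using y by (auto simp: M'_def)
          have "?f (inv y) = inv (?f y)" using g NG[OF yN(1)] by (simp add: group_normalize)
          also have "\<dots> = inv y [^] k" unfolding yN(2) using NG[OF yN(1)] by (simp add: nat_pow_inv)
          finally show ?thesis using subgroup.m_inv_closed[OF sN yN(1)] by (simp add: M'_def)
        qed
        show "M' \<noteq> {}" using x by (auto simp: M'_def)
        show "M' \<subseteq> carrier G" using NG by (auto simp: M'_def)
      qed
      show "h \<otimes> y \<otimes> inv h \<in> M'" if h: "h \<in> carrier G" and y: "y \<in> M'" for h y
      proof -
        have yN: "y \<in> N" "?f y = y [^] k" and yG: "y \<in> carrier G" using y NG by (auto simp: M'_def)
        let ?c = "g \<otimes> h \<otimes> inv g \<otimes> inv h"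
        let ?y' = "h \<otimes> ?f y \<otimes> inv h"
        have y': "?y' \<in> N" using normal.inv_op_closed2[OF nN h fN[OF yN(1)]] .
        \<comment> \<open>Moving \<open>g\<close> past \<open>h\<close> costs the commutator
          \<open>?c\<close>, which lies in \<open>E\<close> and so acts trivially on
          \<open>N\<close>.\<close>
        have "?f (h \<otimes> y \<otimes> inv h) = ?c \<otimes> ?y' \<otimes> inv ?c" using g h yG by (simp add: group_normalize)
        also have "\<dots> = ?y'"
          using conj_fixed_iff[of ?c ?y'] NE[OF y' comm[OF g h]] g h NG[OF y'] by simp
        also have "\<dots> = (h \<otimes> y \<otimes> inv h) [^] k" unfolding yN(2) by (rule conj_pow[OF h yG])
        finally show ?thesis using normal.inv_op_closed2[OF nN h yN(1)] by (simp add: M'_def)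
      qed
    qed
    moreover have "M' \<subseteq> N" by (auto simp: M'_def)
    moreover have "M' \<noteq> {\<one>}" using x by (auto simp: M'_def)
    ultimately have "M' = N" using minN[of M'] NW by (auto simp: NN_def)
    then show ?thesis using n by (auto simp: M'_def)
  qed
  moreover have "n \<in> R" using n NW by (auto simp: W_def V_def)
  ultimately show ?thesis using n by blast
qed

end

section \<open>Supersoluble series\<close>

lemma (in group_hom) card_image_dvd:
  assumes "subgroup I G"
  shows "card (h ` I) dvd card I"
proof -
  let ?I = "G\<lparr>carrier := I\<rparr>"
  let ?J = "H\<lparr>carrier := h ` I\<rparr>"
  interpret r: group_hom ?I ?J h
    using assms subgroup.mem_carrier[OF assms] G.subgroup_imp_group
      H.subgroup_imp_group[OF subgroup_img_is_subgroup[OF assms]]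
    by (intro group_hom.intro group_hom_axioms.intro homI) auto
  have "order (?I Mod kernel ?I ?J h) = order ?J"
    by (rule iso_same_order[OF r.FactGroup_iso_set]) simp
  then have "card (rcosets\<^bsub>?I\<^esub> kernel ?I ?J h) = card (h ` I)"
    by (simp add: order_def FactGroup_def)
  then have "card (h ` I) * card (kernel ?I ?J h) = card I"
    using r.G.lagrange[OF r.subgroup_kernel] by (simp add: order_def)
  then show ?thesis by (metis dvd_triv_left)
qed

lemma (in group_hom) normal_image:
  assumes "N \<lhd> G" "h ` carrier G = carrier H"
  shows "h ` N \<lhd> H"
  using normal.surj_hom_normal_subgroup[OF assms(1) group_hom_axioms assms(2)] .

context group
begin

lemma normal_coset_generated:
  assumes fin: "finite (carrier G)" and K: "K \<lhd> G" and z: "z \<in> carrier G"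
    and conj: "\<And>g. g \<in> carrier G \<Longrightarrow> \<exists>k::nat. K #> (g \<otimes> z \<otimes> inv g) = K #> z [^] k"
  shows "K <#> generate G {z} \<lhd> G"
    and "cyclic_group ((G\<lparr>carrier := K <#> generate G {z}\<rparr>) Mod K)"
    and "K \<subseteq> K <#> generate G {z}" and "z \<in> K <#> generate G {z}"
proof -
  let ?Z = "generate G {z}"
  let ?H = "K <#> ?Z"
  interpret K: normal K G by fact
  have sZ: "subgroup ?Z G" using generate_is_subgroup z by simp
  have H: "subgroup ?H G" and KH: "K \<subseteq> ?H" and ZH: "?Z \<subseteq> ?H"
    using subgroup_set_mult_normal[OF K sZ] by auto
  show "K \<subseteq> ?H" by fact
  show zH: "z \<in> ?H" using ZH generate.incl[of z "{z}"] by blast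
  have conj_z: "g \<otimes> z \<otimes> inv g \<in> ?H" if g: "g \<in> carrier G" for g
  proof -
    obtain k :: nat where "K #> (g \<otimes> z \<otimes> inv g) = K #> z [^] k" using conj g by blast
    then have "g \<otimes> z \<otimes> inv g \<in> K #> z [^] k"
      using rcos_self[OF _ K.subgroup_axioms, of "g \<otimes> z \<otimes> inv g"] g z by simp
    then obtain l where l: "l \<in> K" "g \<otimes> z \<otimes> inv g = l \<otimes> z [^] k" by (auto simp: r_coset_def)
    have "z [^] k \<in> ?Z" using subgroup_nat_pow_closed[OF sZ generate.incl] by blast
    then show ?thesis unfolding l(2) using l(1) by (rule set_multI[rotated])
  qed
  show "?H \<lhd> G"
  proof (rule normal_invI[OF H])
    fix g h assume g: "g \<in> carrier G" and h: "h \<in> ?H"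
    obtain l y where ly: "l \<in> K" "y \<in> ?Z" "h = l \<otimes> y" using h by (rule set_multE)
    obtain i :: nat where i: "y = z [^] i" using ly(2) generate_pow_on_finite_carrier[OF fin z] by blast
    have "g \<otimes> h \<otimes> inv g = (g \<otimes> l \<otimes> inv g) \<otimes> (g \<otimes> z \<otimes> inv g) [^] i"
      unfolding ly(3) i using conj_mult[OF g K.mem_carrier[OF ly(1)] nat_pow_closed[OF z]] conj_pow[OF g z] by simp
    moreover have "g \<otimes> l \<otimes> inv g \<in> ?H" using K.inv_op_closed2[OF g ly(1)] KH by blast
    ultimately show "g \<otimes> h \<otimes> inv g \<in> ?H"
      using subgroup.m_closed[OF H] subgroup_nat_pow_closed[OF H conj_z[OF g]] by simp
  qed
  let ?HG = "G\<lparr>carrier := ?H\<rparr>"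
  have nK: "K \<lhd> ?HG" using normal_restrict_supergroup[OF H K KH] .
  interpret KH: normal K ?HG by (rule nK)
  interpret Q: group "?HG Mod K" by (rule KH.factorgroup_is_group)
  have "carrier (?HG Mod K) = range (\<lambda>n::int. (K #> z) [^]\<^bsub>?HG Mod K\<^esub> n)"
  proof
    have zc: "K #> z \<in> carrier (?HG Mod K)"
      unfolding carrier_FactGroup by (rule image_eqI[of _ _ z]) (use zH in auto)
    then show "range (\<lambda>n::int. (K #> z) [^]\<^bsub>?HG Mod K\<^esub> n) \<subseteq> carrier (?HG Mod K)" by auto
    show "carrier (?HG Mod K) \<subseteq> range (\<lambda>n::int. (K #> z) [^]\<^bsub>?HG Mod K\<^esub> n)"
    proof
      fix C assume "C \<in> carrier (?HG Mod K)"
      then obtain h where h: "h \<in> ?H" "C = K #> h" unfolding carrier_FactGroup by auto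
      obtain l y where ly: "l \<in> K" "y \<in> ?Z" "h = l \<otimes> y" using h(1) by (rule set_multE)
      obtain i :: nat where i: "y = z [^] i" using ly(2) generate_pow_on_finite_carrier[OF fin z] by blast
      have lG: "l \<in> carrier G" using K.mem_carrier[OF ly(1)] .
      have "K #> h = (K #> l) #> y"
        using coset_mult_assoc[OF K.subset lG, of y] i z ly(3) by simp
      also have "\<dots> = K #> z [^] i" using coset_eq_iff[OF K.subgroup_axioms lG] ly(1) i by simp
      also have "\<dots> = (K #> z) [^]\<^bsub>?HG Mod K\<^esub> int i"
        using KH.FactGroup_pow[of z i] zH by (simp add: int_pow_int flip: nat_pow_consistent)
      finally show "C \<in> range (\<lambda>n::int. (K #> z) [^]\<^bsub>?HG Mod K\<^esub> n)" using h(2) by blast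
    qed
  qed
  then show "cyclic_group (?HG Mod K)"
    unfolding Q.cyclic_group carrier_FactGroup
    by (intro bexI[of _ "K #> z"]) (use zH in auto)
qed

text \<open>Induction on the number of elements outside \<open>K\<close>: the coset of
  \<open>z\<close> generates a normal subgroup of \<open>G Mod K\<close>, so
  \<open>K <#> generate G {z}\<close> is a strictly larger term with cyclic factor.\<close>

lemma supersoluble_if_chain:
  assumes fin: "finite (carrier G)"
    and step: "\<And>K. K \<lhd> G \<Longrightarrow> K \<noteq> carrier G \<Longrightarrow> \<exists>z\<in>carrier G. z \<notin> K \<and>
      (\<forall>g\<in>carrier G. \<exists>k::nat. K #> (g \<otimes> z \<otimes> inv g) = K #> z [^] k)"
  shows "supersoluble G"
proof -
  have "supersoluble_seq G (carrier G)" if "K \<lhd> G" "supersoluble_seq G K" for K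
    using that
  proof (induction "card (carrier G) - card K" arbitrary: K rule: less_induct)
    case less
    show ?case
    proof (cases "K = carrier G")
      case True
      then show ?thesis using less.prems by simp
    next
      case False
      then obtain z where z: "z \<in> carrier G" "z \<notin> K"
        "\<And>g. g \<in> carrier G \<Longrightarrow> \<exists>k::nat. K #> (g \<otimes> z \<otimes> inv g) = K #> z [^] k"
        using step[OF less.prems(1)] by blast
      let ?H = "K <#> generate G {z}"
      note H = normal_coset_generated[OF fin less.prems(1) z(1,3)]
      have "?H \<subseteq> carrier G" using normal_imp_subgroup[OF H(1)] subgroup.subset by blast
      then have "card ?H \<le> card (carrier G)" "finite ?H" using fin card_mono finite_subset by blast+
      moreover have "card K < card ?H"
        using H(3,4) z(2) \<open>finite ?H\<close> by (intro psubset_card_mono) auto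
      ultimately have "card (carrier G) - card ?H < card (carrier G) - card K" by linarith
      then show ?thesis
        using less.hyps[OF _ H(1) supersoluble_seq.extension[OF less.prems(2,1) H(1,3,2)]] by blast
    qed
  qed
  then show ?thesis
    unfolding supersoluble_def using one_is_normal supersoluble_seq.unity by blast
qed

text \<open>The lowest term of the series not contained in \<open>K\<close> has an element outside
  \<open>K\<close>, and its commutators fall into the preceding term, which is inside
  \<open>K\<close>.\<close>

lemma central_seq_exists_central:
  assumes "central_seq G H" and "subgroup K G" and "\<not> H \<subseteq> K"
  shows "\<exists>z\<in>carrier G. z \<notin> K \<and> (\<forall>g\<in>carrier G. g \<otimes> z \<otimes> inv g \<otimes> inv z \<in> K)"
  using assms
proof (induction rule: central_seq.induct)
  case unity
  then show ?case using subgroup.one_closed by auto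
next
  case (extension L H)
  show ?case
  proof (cases "L \<subseteq> K")
    case False
    then show ?thesis using extension by blast
  next
    case True
    obtain z where z: "z \<in> H" "z \<notin> K" using extension.prems by blast
    interpret L: normal L G by fact
    interpret q: group_hom G "G Mod L" "\<lambda>a. L #> a" using group_hom_coset L.normal_axioms by blast
    have zG: "z \<in> carrier G" using z(1) normal_imp_subgroup[OF extension.hyps(3)] subgroup.mem_carrier by metis
    have "L #> z \<in> carrier ((G\<lparr>carrier := H\<rparr>) Mod L)"
      unfolding carrier_FactGroup by (rule image_eqI[of _ _ z]) (use z in auto)
    then have cent: "L #> z \<in> group_center (G Mod L)" using extension by blast
    have "g \<otimes> z \<otimes> inv g \<otimes> inv z \<in> K" if g: "g \<in> carrier G" for g
    proof -
      have "L #> g \<in> carrier (G Mod L)" using g q.hom_closed by simp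
      then have "(L #> z) \<otimes>\<^bsub>G Mod L\<^esub> (L #> g) = (L #> g) \<otimes>\<^bsub>G Mod L\<^esub> (L #> z)"
        using cent unfolding group_center_def by blast
      then have "L #> (g \<otimes> z) = L #> (z \<otimes> g)" using q.hom_mult g zG by metis
      then have "L #> (g \<otimes> z) #> inv (z \<otimes> g) = L"
        using coset_mult_assoc[OF L.subset, of "z \<otimes> g" "inv (z \<otimes> g)"] g zG coset_mult_one[OF L.subset] by simp
      then have "L #> (g \<otimes> z \<otimes> inv (z \<otimes> g)) = L"
        using coset_mult_assoc[OF L.subset, of "g \<otimes> z" "inv (z \<otimes> g)"] g zG by simp
      moreover have "g \<otimes> z \<otimes> inv (z \<otimes> g) \<in> carrier G" using g zG by simp
      ultimately have "g \<otimes> z \<otimes> inv (z \<otimes> g) \<in> L" using coset_eq_iff[OF L.subgroup_axioms] by blast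
      then show ?thesis using True g zG by (auto simp: group_normalize)
    qed
    then show ?thesis using z zG by blast
  qed
qed

end

section \<open>From permuteral Sylow subgroups to cyclic factors\<close>

context nilpotent_by_nilpotent
begin

text \<open>The properties of \<open>E\<close> are equations and memberships preserved by the
  projection to \<open>G Mod K\<close>. So \<open>exists_normal_cyclic\<close> applies to the images
  of \<open>primary p\<close>, \<open>E\<close> and \<open>P\<close>, and no permuterality in the
  quotient has to be shown.\<close>

lemma exists_cyclic_over:
  assumes K: "K \<lhd> G" and p: "Factorial_Ring.prime p" and not_le: "\<not> primary p \<subseteq> K"
    and perm: "\<And>q Q. Factorial_Ring.prime q \<Longrightarrow> q \<noteq> p \<Longrightarrow> sylow_sub q Q \<Longrightarrow> permuteral Q G"
  shows "\<exists>z\<in>carrier G. z \<notin> K \<and> (\<forall>g\<in>carrier G. \<exists>k::nat. K #> (g \<otimes> z \<otimes> inv g) = K #> z [^] k)"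
proof -
  obtain P where P: "sylow_sub p P" using sylow_sub_exists[OF fin p] by blast
  have sP: "subgroup P G" and cP: "card P = p ^ multiplicity p (order G)"
    using P by (auto simp: sylow_sub_def)
  obtain E where E: "E \<lhd> G" "primary p \<subseteq> E"
    "\<And>e. e \<in> E \<Longrightarrow> \<exists>c\<in>carrier G. \<exists>u\<in>P. e = c \<otimes> u \<and> (\<forall>r\<in>primary p. c \<otimes> r = r \<otimes> c)"
    "\<And>g h. g \<in> carrier G \<Longrightarrow> h \<in> carrier G \<Longrightarrow> g \<otimes> h \<otimes> inv g \<otimes> inv h \<in> E"
    "\<And>g. g \<in> carrier G \<Longrightarrow> g [^] (p - 1) \<in> E"
  proof (rule abelian_exponent_modulus[OF p P])
    show "permuteral Q G" if "Factorial_Ring.prime q" "q \<noteq> p" "sylow_sub q Q" for q Q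
      using perm that by blast
  qed (rule that)
  interpret K: normal K G by fact
  let ?q = "\<lambda>a. K #> a"
  interpret q: group_hom G "G Mod K" ?q using group_hom_coset K by blast
  have surj: "?q ` carrier G = carrier (G Mod K)" by (simp add: carrier_FactGroup)
  have sR: "subgroup (primary p) G" using primary_normal[OF p] normal_imp_subgroup by blast
  have pow: "\<exists>k. card (?q ` I) = p ^ k" if "subgroup I G" "card I = p ^ j" for I j
    using q.card_image_dvd[OF that(1)] that(2) p by (auto simp: divides_primepow_nat)
  obtain a where a: "card (?q ` primary p) = p ^ a" using pow[OF sR] card_primary[OF p] by blast
  obtain b where b: "card (?q ` P) = p ^ b" using pow[OF sP cP] by blast
  have PG: "u \<in> carrier G" if "u \<in> P" for u using that subgroup.mem_carrier[OF sP] by blast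
  have qm: "?q (x \<otimes> y) = ?q x \<otimes>\<^bsub>G Mod K\<^esub> ?q y" if "x \<in> carrier G" "y \<in> carrier G" for x y
    using that by (rule q.hom_mult)
  have "\<exists>z\<in>?q ` primary p. z \<noteq> \<one>\<^bsub>G Mod K\<^esub> \<and>
    (\<forall>g\<in>carrier (G Mod K). \<exists>k::nat. g \<otimes>\<^bsub>G Mod K\<^esub> z \<otimes>\<^bsub>G Mod K\<^esub> inv\<^bsub>G Mod K\<^esub> g = z [^]\<^bsub>G Mod K\<^esub> k)"
  proof (rule q.H.exists_normal_cyclic[OF _ p _ a _ _ _ _ b])
    show "finite (carrier (G Mod K))" using fin surj by (metis finite_imageI)
    show "?q ` primary p \<lhd> G Mod K" using q.normal_image[OF primary_normal[OF p] surj] .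
    show "?q ` E \<lhd> G Mod K" using q.normal_image[OF E(1) surj] .
    show "?q ` primary p \<subseteq> ?q ` E" using E(2) by blast
    show "subgroup (?q ` P) (G Mod K)" using q.subgroup_img_is_subgroup[OF sP] .
    show "?q ` primary p \<noteq> {\<one>\<^bsub>G Mod K\<^esub>}"
    proof
      assume "?q ` primary p = {\<one>\<^bsub>G Mod K\<^esub>}"
      then have "r \<in> K" if "r \<in> primary p" for r
        using that coset_eq_iff[OF K.subgroup_axioms primary_carrier[OF that]] by auto
      then show False using not_le by blast
    qed
    show "\<exists>c\<in>carrier (G Mod K). \<exists>u\<in>?q ` P. e = c \<otimes>\<^bsub>G Mod K\<^esub> u \<and>
        (\<forall>r\<in>?q ` primary p. c \<otimes>\<^bsub>G Mod K\<^esub> r = r \<otimes>\<^bsub>G Mod K\<^esub> c)" if "e \<in> ?q ` E" for e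
    proof -
      obtain e' where e': "e' \<in> E" "e = ?q e'" using \<open>e \<in> _\<close> by blast
      obtain c u where cu: "c \<in> carrier G" "u \<in> P" "e' = c \<otimes> u" "\<And>r. r \<in> primary p \<Longrightarrow> c \<otimes> r = r \<otimes> c"
        using E(3)[OF e'(1)] by blast
      have "?q c \<otimes>\<^bsub>G Mod K\<^esub> ?q r = ?q r \<otimes>\<^bsub>G Mod K\<^esub> ?q c" if r: "r \<in> primary p" for r
        using qm[OF cu(1) primary_carrier[OF r]] qm[OF primary_carrier[OF r] cu(1)] cu(4)[OF r] by simp
      moreover have "e = ?q c \<otimes>\<^bsub>G Mod K\<^esub> ?q u" unfolding e'(2) cu(3) using cu(1) PG[OF cu(2)] by (rule qm)
      moreover have "?q c \<in> carrier (G Mod K)" using cu(1) by (rule q.hom_closed)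
      ultimately show ?thesis using cu(2) by blast
    qed
    show "g \<otimes>\<^bsub>G Mod K\<^esub> h \<otimes>\<^bsub>G Mod K\<^esub> inv\<^bsub>G Mod K\<^esub> g \<otimes>\<^bsub>G Mod K\<^esub> inv\<^bsub>G Mod K\<^esub> h \<in> ?q ` E"
      if gh: "g \<in> carrier (G Mod K)" "h \<in> carrier (G Mod K)" for g h
    proof -
      obtain x where x: "x \<in> carrier G" "g = ?q x" using gh(1) unfolding carrier_FactGroup by blast
      obtain y where y: "y \<in> carrier G" "h = ?q y" using gh(2) unfolding carrier_FactGroup by blast
      have "?q (x \<otimes> y \<otimes> inv x \<otimes> inv y) \<in> ?q ` E" using E(4)[OF x(1) y(1)] by (rule imageI)
      then show ?thesis using x y by (simp del: mult_FactGroup)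
    qed
    show "g [^]\<^bsub>G Mod K\<^esub> (p - 1) \<in> ?q ` E" if g: "g \<in> carrier (G Mod K)" for g
    proof -
      obtain x where x: "x \<in> carrier G" "g = ?q x" using g unfolding carrier_FactGroup by blast
      then show ?thesis using E(5)[OF x(1)] q.hom_nat_pow[OF x(1), of "p - 1"] by (metis imageI)
    qed
  qed
  then obtain z where z: "z \<in> primary p" "?q z \<noteq> \<one>\<^bsub>G Mod K\<^esub>"
    "\<And>g. g \<in> carrier (G Mod K) \<Longrightarrow> \<exists>k::nat. g \<otimes>\<^bsub>G Mod K\<^esub> ?q z \<otimes>\<^bsub>G Mod K\<^esub> inv\<^bsub>G Mod K\<^esub> g = ?q z [^]\<^bsub>G Mod K\<^esub> k"
    by blast
  have zG: "z \<in> carrier G" using z(1) primary_carrier by blast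
  have "z \<notin> K" using z(2) coset_eq_iff[OF K.subgroup_axioms zG] by simp
  moreover have "\<exists>k::nat. ?q (g \<otimes> z \<otimes> inv g) = ?q (z [^] k)" if g: "g \<in> carrier G" for g
  proof -
    obtain k :: nat where "?q g \<otimes>\<^bsub>G Mod K\<^esub> ?q z \<otimes>\<^bsub>G Mod K\<^esub> inv\<^bsub>G Mod K\<^esub> ?q g = ?q z [^]\<^bsub>G Mod K\<^esub> k"
      using z(3)[OF q.hom_closed[OF g]] by blast
    then have "?q (g \<otimes> z \<otimes> inv g) = ?q (z [^] k)"
      using g zG by (simp del: mult_FactGroup add: q.hom_nat_pow)
    then show ?thesis by blast
  qed
  ultimately show ?thesis using zG by blast
qed

text \<open>A proper normal \<open>K\<close> either misses some primary part of \<open>F\<close> or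
  contains \<open>F\<close>. In the second case the central series of \<open>G Mod F\<close>
  supplies an element outside \<open>K\<close> that is central modulo \<open>K\<close>.\<close>

lemma supersoluble_if_permuteral:
  assumes nilp: "nilpotent_group (G Mod F)"
    and perm: "\<And>q Q. Factorial_Ring.prime q \<Longrightarrow> sylow_sub q Q \<Longrightarrow> permuteral Q G"
  shows "supersoluble G"
proof (rule supersoluble_if_chain[OF fin])
  fix K assume K: "K \<lhd> G" "K \<noteq> carrier G"
  have sK: "subgroup K G" using K normal_imp_subgroup by blast
  show "\<exists>z\<in>carrier G. z \<notin> K \<and> (\<forall>g\<in>carrier G. \<exists>k::nat. K #> (g \<otimes> z \<otimes> inv g) = K #> z [^] k)"
  proof (cases "F \<subseteq> K")
    case False
    then obtain p where "Factorial_Ring.prime p" "\<not> primary p \<subseteq> K"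
      using subgroup_containing_primaries[OF sK] by blast
    then show ?thesis using exists_cyclic_over[OF K(1)] perm by blast
  next
    case True
    interpret F: normal F G by (rule normal_F)
    let ?q = "\<lambda>a. F #> a"
    interpret q: group_hom G "G Mod F" ?q using group_hom_coset normal_F by blast
    \<comment> \<open>As \<open>F \<subseteq> K\<close>, membership in \<open>K\<close> can be
      tested in \<open>G Mod F\<close>.\<close>
    have mem: "x \<in> K" if x: "x \<in> carrier G" "?q x \<in> ?q ` K" for x
    proof -
      obtain k where k: "k \<in> K" "?q x = ?q k" using x(2) by blast
      have "x \<in> F #> k" using rcos_self[OF x(1) F.subgroup_axioms] k(2) by simp
      then obtain f where "f \<in> F" "x = f \<otimes> k" by (auto simp: r_coset_def)
      then show ?thesis using True k(1) subgroup.m_closed[OF sK] by blast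
    qed
    have "\<not> carrier (G Mod F) \<subseteq> ?q ` K"
    proof
      assume "carrier (G Mod F) \<subseteq> ?q ` K"
      then have "carrier G \<subseteq> K" using mem q.hom_closed by blast
      then show False using K(2) subgroup.subset[OF sK] by blast
    qed
    then obtain z where z: "z \<in> carrier (G Mod F)" "z \<notin> ?q ` K"
      "\<And>g. g \<in> carrier (G Mod F) \<Longrightarrow> g \<otimes>\<^bsub>G Mod F\<^esub> z \<otimes>\<^bsub>G Mod F\<^esub> inv\<^bsub>G Mod F\<^esub> g \<otimes>\<^bsub>G Mod F\<^esub> inv\<^bsub>G Mod F\<^esub> z \<in> ?q ` K"
      using q.H.central_seq_exists_central[OF nilp[unfolded nilpotent_group_def] q.subgroup_img_is_subgroup[OF sK]]
      by blast
    obtain x where x: "x \<in> carrier G" "z = ?q x" using z(1) by (auto simp: carrier_FactGroup)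
    have "x \<notin> K" using x z(2) by blast
    \<comment> \<open>The exponent is 1 because \<open>x\<close> is central modulo
      \<open>K\<close>.\<close>
    moreover have "K #> (g \<otimes> x \<otimes> inv g) = K #> x [^] (1::nat)" if g: "g \<in> carrier G" for g
    proof -
      have "?q (g \<otimes> x \<otimes> inv g \<otimes> inv x) \<in> ?q ` K"
        using z(3)[OF q.hom_closed[OF g]] g x by (simp del: mult_FactGroup)
      then have c: "g \<otimes> x \<otimes> inv g \<otimes> inv x \<in> K" using mem g x(1) by simp
      have "K #> (g \<otimes> x \<otimes> inv g \<otimes> inv x \<otimes> x) = K #> x"
        using coset_mult_assoc[OF subgroup.subset[OF sK], of "g \<otimes> x \<otimes> inv g \<otimes> inv x" x]
          coset_eq_iff[OF sK, of "g \<otimes> x \<otimes> inv g \<otimes> inv x"] c g x(1) by simp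
      then show ?thesis using g x(1) by (simp add: group_normalize)
    qed
    ultimately show ?thesis using x(1) by blast
  qed
qed

end

section \<open>Subgroups of prime index and normalized cyclic subgroups\<close>

context group
begin

lemma prime_index_if_coset_generator:
  assumes fin: "finite (carrier G)" and S: "S \<lhd> G" and q: "Factorial_Ring.prime q"
    and t: "t \<in> carrier G" "t \<notin> S" "t [^] q \<in> S"
    and gen: "\<And>x. x \<in> carrier G \<Longrightarrow> \<exists>i::nat. S #> x = S #> t [^] i"
  shows "order G = q * card S"
proof -
  interpret S: normal S G by fact
  interpret Q: group "G Mod S" by (rule S.factorgroup_is_group)
  have tQ: "S #> t \<in> carrier (G Mod S)" using t(1) by (auto simp: carrier_FactGroup)
  have finQ: "finite (carrier (G Mod S))" using fin by (simp add: carrier_FactGroup)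
  have "carrier (G Mod S) = generate (G Mod S) {S #> t}"
  proof
    show "carrier (G Mod S) \<subseteq> generate (G Mod S) {S #> t}"
    proof
      fix C assume "C \<in> carrier (G Mod S)"
      then obtain x where x: "x \<in> carrier G" "C = S #> x" unfolding carrier_FactGroup by blast
      obtain i :: nat where "S #> x = S #> t [^] i" using gen[OF x(1)] by blast
      then have "C = (S #> t) [^]\<^bsub>G Mod S\<^esub> i" using x(2) S.FactGroup_pow[OF t(1)] by simp
      then show "C \<in> generate (G Mod S) {S #> t}"
        unfolding Q.generate_pow_on_finite_carrier[OF finQ tQ] by blast
    qed
    show "generate (G Mod S) {S #> t} \<subseteq> carrier (G Mod S)"
      using Q.generate_incl tQ by simp
  qed
  then have ordQ: "order (G Mod S) = Q.ord (S #> t)"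
    using Q.generate_pow_card[OF tQ] by (simp add: order_def)
  have "(S #> t) [^]\<^bsub>G Mod S\<^esub> q = \<one>\<^bsub>G Mod S\<^esub>"
    using S.FactGroup_pow[OF t(1)] coset_eq_iff[OF S.subgroup_axioms nat_pow_closed[OF t(1)]] t(3) by simp
  then have "Q.ord (S #> t) dvd q" using Q.pow_eq_id[OF tQ] by blast
  moreover have "Q.ord (S #> t) \<noteq> 1"
    using Q.ord_eq_1[OF tQ] coset_eq_iff[OF S.subgroup_axioms t(1)] t(2) by simp
  ultimately have "order (G Mod S) = q" using q ordQ prime_nat_iff by metis
  then show ?thesis using lagrange[OF S.subgroup_axioms] by (simp add: order_def FactGroup_def)
qed

lemma coset_generator_if_prime_index:
  assumes fin: "finite (carrier G)" and S: "S \<lhd> G" and q: "Factorial_Ring.prime q"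
    and index: "order G = q * card S"
    and x: "x \<in> carrier G" "x \<notin> S" and y: "y \<in> carrier G"
  shows "\<exists>i::nat. S #> y = S #> x [^] i"
proof -
  interpret S: normal S G by fact
  interpret Q: group "G Mod S" by (rule S.factorgroup_is_group)
  have xQ: "S #> x \<in> carrier (G Mod S)" using x(1) by (auto simp: carrier_FactGroup)
  have finQ: "finite (carrier (G Mod S))" using fin by (simp add: carrier_FactGroup)
  have "card S > 0" using card_pos[OF fin S.subgroup_axioms] .
  then have ordQ: "order (G Mod S) = q"
    using lagrange[OF S.subgroup_axioms] index by (simp add: order_def FactGroup_def)
  have "Q.ord (S #> x) dvd q" using Q.ord_dvd_group_order[OF xQ] ordQ by simp
  moreover have "Q.ord (S #> x) \<noteq> 1"
    using Q.ord_eq_1[OF xQ] coset_eq_iff[OF S.subgroup_axioms x(1)] x(2) by simp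
  ultimately have "Q.ord (S #> x) = q" using q prime_nat_iff by metis
  then have "card (generate (G Mod S) {S #> x}) = card (carrier (G Mod S))"
    using Q.generate_pow_card[OF xQ] ordQ by (simp add: order_def)
  moreover have "generate (G Mod S) {S #> x} \<subseteq> carrier (G Mod S)"
    using Q.generate_incl xQ by simp
  ultimately have "generate (G Mod S) {S #> x} = carrier (G Mod S)"
    using card_subset_eq[OF finQ] by blast
  moreover have "S #> y \<in> carrier (G Mod S)" using y by (auto simp: carrier_FactGroup)
  ultimately obtain i :: nat where "S #> y = (S #> x) [^]\<^bsub>G Mod S\<^esub> i"
    using Q.generate_pow_on_finite_carrier[OF finQ xQ] by blast
  then show ?thesis using S.FactGroup_pow[OF x(1)] by auto
qed

lemma coset_mem:
  assumes "subgroup S G" "x \<in> carrier G" "y \<in> carrier G" "S #> x = S #> y"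
  shows "x \<otimes> inv y \<in> S"
proof -
  have "x \<in> S #> y" using rcos_self[OF assms(2,1)] assms(4) by simp
  then obtain s where "s \<in> S" "x = s \<otimes> y" by (auto simp: r_coset_def)
  then show ?thesis using assms(3) subgroup.mem_carrier[OF assms(1)] by (simp add: group_normalize)
qed

text \<open>For \<open>t\<close> outside \<open>S\<close>, the coset \<open>S t\<close> is partitioned by the cyclic subgroups \<open>C\<close> of \<open>T\<close> outside \<open>S\<close>,
  and each \<open>C\<close> meets it in \<open>|C \<inter> S|\<close> elements. So \<open>|S|\<close> is the sum of all \<open>|C \<inter> S|\<close>,
  which would be divisible by \<open>p\<close> if \<open>P\<close> fixed no \<open>C\<close>.\<close>

lemma exists_normalized_cyclic:
  assumes fin: "finite (carrier G)" and p: "Factorial_Ring.prime p" and q: "Factorial_Ring.prime q" "q \<noteq> p"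
    and P: "subgroup P G" "card P = p ^ k"
    and T: "T \<lhd> G" "card T = q ^ c" and S: "S \<lhd> G" "S \<subseteq> T" and index: "card T = q * card S"
  shows "\<exists>x\<in>T - S. \<forall>u\<in>P. \<forall>y\<in>generate G {x}. u \<otimes> y \<otimes> inv u \<in> generate G {x}"
proof -
  have sT: "subgroup T G" and sS: "subgroup S G" and sP: "subgroup P G"
    using T S P normal_imp_subgroup by auto
  have TG: "x \<in> carrier G" if "x \<in> T" for x using that subgroup.mem_carrier[OF sT] by blast
  have SG: "x \<in> carrier G" if "x \<in> S" for x using that subgroup.mem_carrier[OF sS] by blast
  have PG: "x \<in> carrier G" if "x \<in> P" for x using that subgroup.mem_carrier[OF sP] by blast
  have finT: "finite T" using fin subgroup.subset[OF sT] finite_subset by blast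
  let ?T = "G\<lparr>carrier := T\<rparr>"
  interpret TT: group ?T using subgroup_imp_group[OF sT] .
  have nS: "S \<lhd> ?T" using normal_restrict_supergroup[OF sT S] .
  have gen: "generate G {x} = {x [^] (i::nat) | i. i \<in> UNIV}" if "x \<in> carrier G" for x
    using generate_pow_on_finite_carrier[OF fin that] .
  have genI: "x \<in> generate G {x}" for x by (rule generate.incl) simp
  have genT: "generate G {x} \<subseteq> T" if "x \<in> T" for x
    using generate_subgroup_incl[OF _ sT] that by simp
  have A: "\<exists>i::nat. S #> y = S #> x [^] i" if "x \<in> T" "x \<notin> S" "y \<in> T" for x y
    using TT.coset_generator_if_prime_index[OF _ nS q(1), of x y] that finT index
    by (auto simp: order_def simp flip: nat_pow_consistent)
  have pow_q: "x [^] q \<in> S" if "x \<in> T" for x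
  proof -
    have "card S > 0" using card_pos[OF fin sS] .
    then have "card (rcosets\<^bsub>?T\<^esub> S) = q"
      using TT.lagrange[OF normal_imp_subgroup[OF nS]] index by (simp add: order_def)
    then show ?thesis using TT.coset_pow_index[OF nS, of x] that by (simp flip: nat_pow_consistent)
  qed
  \<comment> \<open>A cyclic subgroup of \<open>T\<close> outside \<open>S\<close> is generated by
    each of its elements outside \<open>S\<close>: if \<open>y = x [^] j\<close>, then
    \<open>x [^] q \<in> S\<close> excludes \<open>q dvd j\<close>, so \<open>j\<close> is prime to
    the order of \<open>x\<close>. This makes the pieces of the coset disjoint.\<close>
  have B: "generate G {y} = generate G {x}" if x: "x \<in> T" "x \<notin> S" and y: "y \<in> generate G {x}" "y \<notin> S" for x y
  proof
    have xG: "x \<in> carrier G" using TG x by blast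
    have yG: "y \<in> carrier G" using y(1) genT[OF x(1)] TG by blast
    obtain j :: nat where j: "y = x [^] j" using y(1) gen[OF xG] by blast
    have "\<not> q dvd j"
    proof
      assume "q dvd j"
      then obtain i where "j = q * i" by blast
      then have "y = (x [^] q) [^] i" using j xG by (simp add: nat_pow_pow)
      then show False using y(2) subgroup_nat_pow_closed[OF sS pow_q[OF x(1)]] by simp
    qed
    then have "coprime j (q ^ c)"
      using prime_imp_coprime[OF q(1), of j] by (simp add: coprime_commute)
    moreover have "x [^] (q ^ c) = \<one>" using subgroup_pow_card[OF sT x(1)] T(2) by simp
    moreover have sY: "subgroup (generate G {y}) G" using generate_is_subgroup yG by simp
    ultimately have "x \<in> generate G {y}"
      using coprime_pow_mem[OF sY xG, of j "q ^ c"] genI[of y] j subgroup.one_closed[OF sY] by simp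
    then show "generate G {x} \<subseteq> generate G {y}" using generate_subgroup_incl[OF _ sY] by simp
    show "generate G {y} \<subseteq> generate G {x}"
      using generate_subgroup_incl[OF _ generate_is_subgroup] y(1) xG by simp
  qed
  define CC where "CC = (\<lambda>x. generate G {x}) ` (T - S)"
  have finCC: "finite CC" using finT by (simp add: CC_def)
  have CC_sub: "subgroup C G" "C \<subseteq> T" if "C \<in> CC" for C
    using that generate_is_subgroup genT TG by (auto simp: CC_def)
  have "S \<noteq> T"
  proof
    assume "S = T"
    then have "q = 1" using index card_pos[OF fin sT] by simp
    then show False using q(1) by simp
  qed
  then obtain t where t: "t \<in> T" "t \<notin> S" using S(2) by blast
  have tG: "t \<in> carrier G" using TG t by blast
  let ?X = "S #> t"
  have X_T: "y \<in> T" "y \<notin> S" if y: "y \<in> ?X" for y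
  proof -
    obtain s where s: "s \<in> S" "y = s \<otimes> t" using y by (auto simp: r_coset_def)
    show "y \<in> T" unfolding s(2) using s(1) S(2) t(1) subgroup.m_closed[OF sT] by blast
    show "y \<notin> S"
    proof
      assume "y \<in> S"
      then have "inv s \<otimes> y \<in> S" using s(1) subgroup.m_closed[OF sS] subgroup.m_inv_closed[OF sS] by blast
      then show False using t(2) s SG tG by (simp add: group_normalize)
    qed
  qed
  have meet: "card (C \<inter> ?X) = card (C \<inter> S)" if C: "C \<in> CC" for C
  proof -
    obtain x where x: "x \<in> T" "x \<notin> S" "C = generate G {x}" using C by (auto simp: CC_def)
    note sC = CC_sub(1)[OF C]
    have CG: "y \<in> carrier G" if "y \<in> C" for y using that subgroup.mem_carrier[OF sC] by blast
    obtain i :: nat where i: "S #> t = S #> x [^] i" using A[OF x(1,2) t(1)] by blast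
    let ?y = "x [^] i"
    have y: "?y \<in> C" unfolding x(3) using subgroup_nat_pow_closed[OF _ genI] generate_is_subgroup TG[OF x(1)] by simp
    \<comment> \<open>Translation by a power of \<open>x\<close> in the coset \<open>?X\<close>;
      such a power exists since \<open>x\<close> generates \<open>T\<close> modulo
      \<open>S\<close>.\<close>
    have "bij_betw (\<lambda>s. s \<otimes> ?y) (C \<inter> S) (C \<inter> ?X)"
    proof (rule bij_betw_imageI)
      show "inj_on (\<lambda>s. s \<otimes> ?y) (C \<inter> S)"
        using CG y by (intro inj_onI) simp
      show "(\<lambda>s. s \<otimes> ?y) ` (C \<inter> S) = C \<inter> ?X"
      proof
        show "(\<lambda>s. s \<otimes> ?y) ` (C \<inter> S) \<subseteq> C \<inter> ?X"
          unfolding i using subgroup.m_closed[OF sC _ y] by (auto simp: r_coset_def)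
        show "C \<inter> ?X \<subseteq> (\<lambda>s. s \<otimes> ?y) ` (C \<inter> S)"
        proof
          fix z assume z: "z \<in> C \<inter> ?X"
          then obtain s where s: "s \<in> S" "z = s \<otimes> ?y" unfolding i by (auto simp: r_coset_def)
          have "s = z \<otimes> inv ?y" unfolding s(2) using SG[OF s(1)] CG[OF y] by (simp add: group_normalize)
          then have "s \<in> C" using z y subgroup.m_closed[OF sC] subgroup.m_inv_closed[OF sC] by blast
          then show "z \<in> (\<lambda>s. s \<otimes> ?y) ` (C \<inter> S)" using s by blast
        qed
      qed
    qed
    then show ?thesis by (rule bij_betw_same_card[symmetric])
  qed
  have "?X = (\<Union>C\<in>CC. C \<inter> ?X)"
    using X_T genI by (auto simp: CC_def)
  moreover have "card (\<Union>C\<in>CC. C \<inter> ?X) = (\<Sum>C\<in>CC. card (C \<inter> ?X))"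
  proof (rule card_UN_disjoint[OF finCC])
    show "\<forall>C\<in>CC. finite (C \<inter> ?X)" using CC_sub(2) finT finite_subset by blast
    show "\<forall>C\<in>CC. \<forall>D\<in>CC. C \<noteq> D \<longrightarrow> (C \<inter> ?X) \<inter> (D \<inter> ?X) = {}"
    proof (intro ballI impI, rule ccontr)
      fix C D assume C: "C \<in> CC" and D: "D \<in> CC" and ne: "C \<noteq> D" and "(C \<inter> ?X) \<inter> (D \<inter> ?X) \<noteq> {}"
      then obtain y where y: "y \<in> C" "y \<in> D" "y \<in> ?X" by blast
      obtain x where x: "x \<in> T" "x \<notin> S" "C = generate G {x}" using C by (auto simp: CC_def)
      obtain x' where x': "x' \<in> T" "x' \<notin> S" "D = generate G {x'}" using D by (auto simp: CC_def)
      have "generate G {y} = C" using B[OF x(1,2)] y X_T(2)[OF y(3)] x(3) by simp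
      moreover have "generate G {y} = D" using B[OF x'(1,2)] y X_T(2)[OF y(3)] x'(3) by simp
      ultimately show False using ne by simp
    qed
  qed
  moreover have "card ?X = card S"
    using card_rcosets_equal[of ?X S] rcosetsI[OF subgroup.subset[OF sS] tG] subgroup.subset[OF sS] by simp
  ultimately have sum: "card S = (\<Sum>C\<in>CC. card (C \<inter> S))" using meet by simp
  have "\<exists>C\<in>CC. \<forall>u\<in>P. (\<lambda>y. u \<otimes> y \<otimes> inv u) ` C = C"
  proof (rule ccontr)
    assume no: "\<not> ?thesis"
    let ?f = "\<lambda>C. card (C \<inter> S)"
    let ?act = "\<lambda>u C. (\<lambda>y. u \<otimes> y \<otimes> inv u) ` C"
    have act_CC: "?act u C \<in> CC" and act_card: "?f (?act u C) = ?f C" if u: "u \<in> P" and C: "C \<in> CC" for u C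
    proof -
      have uG: "u \<in> carrier G" using u PG by blast
      note sC = CC_sub(1)[OF C]
      have CG: "y \<in> carrier G" if "y \<in> C" for y using that subgroup.mem_carrier[OF sC] by blast
      obtain x where x: "x \<in> T" "x \<notin> S" "C = generate G {x}" using C by (auto simp: CC_def)
      let ?x' = "u \<otimes> x \<otimes> inv u"
      have x': "?x' \<in> T" using normal.inv_op_closed2[OF T(1) uG x(1)] .
      have S_iff: "u \<otimes> y \<otimes> inv u \<in> S \<longleftrightarrow> y \<in> S" if y: "y \<in> carrier G" for y
      proof
        assume "u \<otimes> y \<otimes> inv u \<in> S"
        from normal.inv_op_closed1[OF S(1) uG this] show "y \<in> S" using y uG by (simp add: group_normalize)
      qed (rule normal.inv_op_closed2[OF S(1) uG])
      have "?act u C = generate G {?x'}"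
        unfolding x(3) gen[OF TG[OF x(1)]] gen[OF TG[OF x']]
        using conj_pow[OF uG TG[OF x(1)]] by (auto simp: image_def)
      then show "?act u C \<in> CC" using x' S_iff[OF TG[OF x(1)]] x(2) by (auto simp: CC_def)
      have "?act u C \<inter> S = ?act u (C \<inter> S)" using S_iff CG by auto
      moreover have "inj_on (\<lambda>y. u \<otimes> y \<otimes> inv u) (C \<inter> S)"
        using CG uG by (intro inj_onI) simp
      ultimately show "?f (?act u C) = ?f C" by (simp add: card_image)
    qed
    \<comment> \<open>The weight \<open>card (C \<inter> S)\<close> is invariant under
      \<open>P\<close>, so \<open>P\<close> acts on the set of all \<open>C\<close> of a given
      weight. Without fixed points each such set has size divisible by \<open>p\<close>, hence so
      has the weighted sum.\<close>
    have "p dvd card {C \<in> CC. ?f C = n}" for n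
    proof (rule prime_power_group_fixed_point[OF P p, where act = ?act])
      show "finite {C \<in> CC. ?f C = n}" using finCC by simp
      show "?act u C \<in> {C \<in> CC. ?f C = n}" if "u \<in> P" "C \<in> {C \<in> CC. ?f C = n}" for u C
        using that act_CC act_card by simp
      show "?act \<one> C = C" if "C \<in> {C \<in> CC. ?f C = n}" for C
        using that subgroup.mem_carrier[OF CC_sub(1)] by (auto simp: image_def)
      show "?act (g \<otimes> h) C = ?act g (?act h C)" if "g \<in> P" "h \<in> P" "C \<in> {C \<in> CC. ?f C = n}" for g h C
      proof -
        have "(\<lambda>y. g \<otimes> h \<otimes> y \<otimes> inv (g \<otimes> h)) y = g \<otimes> (h \<otimes> y \<otimes> inv h) \<otimes> inv g" if "y \<in> C" for y
          using conj_conj[of g h y] PG \<open>g \<in> P\<close> \<open>h \<in> P\<close> subgroup.mem_carrier[OF CC_sub(1), of C y]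
            \<open>C \<in> {C \<in> CC. ?f C = n}\<close> that by simp
        then show ?thesis unfolding image_image by (intro image_cong) auto
      qed
      show "\<exists>u\<in>P. ?act u C \<noteq> C" if "C \<in> {C \<in> CC. ?f C = n}" for C
      proof -
        have C: "C \<in> CC" using that by simp
        have "\<not> (\<forall>u\<in>P. ?act u C = C)"
        proof
          assume "\<forall>u\<in>P. ?act u C = C"
          then have "\<exists>C\<in>CC. \<forall>u\<in>P. ?act u C = C" using C by (rule bexI)
          with no show False by (rule notE)
        qed
        then show ?thesis by simp
      qed
    qed
    moreover have "(\<Sum>C\<in>{C \<in> CC. ?f C = n}. ?f C) = card {C \<in> CC. ?f C = n} * n" for n
      using sum.cong[OF refl, of "{C \<in> CC. ?f C = n}" ?f "\<lambda>_. n"] by simp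
    ultimately have "p dvd (\<Sum>C\<in>{C \<in> CC. ?f C = n}. ?f C)" for n
      by (simp only: dvd_mult2)
    then have "p dvd (\<Sum>n\<in>?f ` CC. \<Sum>C\<in>{C \<in> CC. ?f C = n}. ?f C)"
      by (rule dvd_sum)
    then have "p dvd card S"
      unfolding sum using sum.image_gen[OF finCC, of ?f ?f] by simp
    then have "p dvd card T" using index by simp
    then have "p dvd q" using T(2) p prime_dvd_power by metis
    then show False using p q primes_dvd_imp_eq by blast
  qed
  then obtain C where C: "C \<in> CC" "\<And>u. u \<in> P \<Longrightarrow> (\<lambda>y. u \<otimes> y \<otimes> inv u) ` C = C" by blast
  then obtain x where "x \<in> T - S" "C = generate G {x}" by (auto simp: CC_def)
  then show ?thesis using C(2) by blast
qed

lemma normalizing_set_mult_commute: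
  assumes A: "subgroup A G" and B: "subgroup B G" and norm: "B \<subseteq> normalizing A"
  shows "A <#> B = B <#> A"
proof -
  have car: "a \<in> carrier G" if "a \<in> A \<union> B" for a
    using that subgroup.subset[OF A] subgroup.subset[OF B] by blast
  have conj: "b \<otimes> a \<otimes> inv b \<in> A" if "a \<in> A" "b \<in> B" for a b
    using that norm by (auto simp: normalizing_def)
  show ?thesis
  proof
    show "A <#> B \<subseteq> B <#> A"
    proof
      fix x assume "x \<in> A <#> B"
      then obtain a b where ab: "a \<in> A" "b \<in> B" "x = a \<otimes> b" by (rule set_multE)
      have "x = b \<otimes> (inv b \<otimes> a \<otimes> inv (inv b))"
        unfolding ab(3) using car ab by (simp add: group_normalize)
      then show "x \<in> B <#> A"
        using set_multI[OF ab(2) conj[OF ab(1) subgroup.m_inv_closed[OF B ab(2)]]] by simp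
    qed
    show "B <#> A \<subseteq> A <#> B"
    proof
      fix x assume "x \<in> B <#> A"
      then obtain b a where ab: "b \<in> B" "a \<in> A" "x = b \<otimes> a" by (rule set_multE)
      have "x = (b \<otimes> a \<otimes> inv b) \<otimes> b"
        unfolding ab(3) using car ab by (simp add: group_normalize)
      then show "x \<in> A <#> B" using set_multI[OF conj[OF ab(2,1)] ab(1)] by simp
    qed
  qed
qed

text \<open>At the step where \<open>T\<close> lies in \<open>H\<close> but not in \<open>K\<close>,
  the image of \<open>T\<close> modulo \<open>K\<close> is cyclic, generated by the image of some
  \<open>t\<close>; \<open>S\<close> is the part of \<open>T\<close> over the \<open>q\<close>-th
  powers. \<open>U\<close> acts on the image by power maps and so keeps \<open>S\<close>. With the
  series of \<open>G\<close> and a mere subgroup \<open>U\<close>, supersolubility need not be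
  transferred to subgroups.\<close>

lemma supersoluble_seq_invariant_maximal:
  assumes fin: "finite (carrier G)" and seq: "supersoluble_seq G H" and U: "subgroup U G"
    and q: "Factorial_Ring.prime q"
    and T: "subgroup T G" "T \<subseteq> H" "T \<subseteq> U" "U \<subseteq> normalizing T" "card T = q ^ c" "T \<noteq> {\<one>}"
  shows "\<exists>S. subgroup S G \<and> S \<subseteq> T \<and> U \<subseteq> normalizing S \<and> card T = q * card S"
  using seq T(2)
proof (induction rule: supersoluble_seq.induct)
  case unity
  then show ?case using T(1,6) subgroup.one_closed by blast
next
  case (extension K H)
  show ?case
  proof (cases "T \<subseteq> K")
    case True
    then show ?thesis using extension.IH by blast
  next
    case False
    interpret K: normal K G by fact
    have sK: "subgroup K G" by (rule K.subgroup_axioms)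
    let ?q = "\<lambda>a. K #> a"
    interpret q: group_hom G "G Mod K" ?q using group_hom_coset extension.hyps(2) by blast
    have finQ: "finite (carrier (G Mod K))" using fin by (simp add: carrier_FactGroup)
    have sH: "subgroup H G" using extension.hyps(3) normal_imp_subgroup by blast
    have nKH: "K \<lhd> G\<lparr>carrier := H\<rparr>" using normal_restrict_supergroup[OF sH extension.hyps(2,4)] .
    interpret KH: normal K "G\<lparr>carrier := H\<rparr>" by (rule nKH)
    interpret QH: group "(G\<lparr>carrier := H\<rparr>) Mod K" by (rule KH.factorgroup_is_group)
    have TG: "x \<in> carrier G" if "x \<in> T" for x using that subgroup.mem_carrier[OF T(1)] by blast
    obtain C where C: "C \<in> carrier ((G\<lparr>carrier := H\<rparr>) Mod K)"
      "carrier ((G\<lparr>carrier := H\<rparr>) Mod K) = range (\<lambda>n::int. C [^]\<^bsub>(G\<lparr>carrier := H\<rparr>) Mod K\<^esub> n)"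
      using extension.hyps(5) unfolding QH.cyclic_group by blast
    obtain h where h: "h \<in> H" "C = ?q h" using C(1) unfolding carrier_FactGroup by auto
    have hG: "h \<in> carrier G" using h(1) subgroup.mem_carrier[OF sH] by blast
    have "?q ` T \<subseteq> generate (G Mod K) {?q h}"
    proof
      fix D assume "D \<in> ?q ` T"
      then obtain x where x: "x \<in> T" "D = ?q x" by blast
      have "?q x \<in> carrier ((G\<lparr>carrier := H\<rparr>) Mod K)"
        unfolding carrier_FactGroup by (rule image_eqI[of _ _ x]) (use x extension.prems in auto)
      then obtain n :: int where "?q x = C [^]\<^bsub>(G\<lparr>carrier := H\<rparr>) Mod K\<^esub> n" using C(2) by blast
      also have "\<dots> = K #> h [^] n"
        using KH.FactGroup_int_pow[of h n] h int_pow_consistent[OF sH h(1)] by simp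
      also have "\<dots> = ?q h [^]\<^bsub>G Mod K\<^esub> n" using K.FactGroup_int_pow[OF hG] by simp
      finally show "D \<in> generate (G Mod K) {?q h}"
        using x(2) q.H.generate_pow[OF q.hom_closed[OF hG]] by blast
    qed
    then obtain D where D: "D \<in> carrier (G Mod K)" "?q ` T = generate (G Mod K) {D}"
      using q.H.subgroup_of_cyclic[OF finQ q.hom_closed[OF hG] q.subgroup_img_is_subgroup[OF T(1)]] by blast
    obtain t where t: "t \<in> T" "D = ?q t"
      using D(2) generate.incl[of D "{D}" "G Mod K"] by blast
    have tG: "t \<in> carrier G" using TG t(1) by blast
    have gen: "\<exists>i::nat. ?q x = ?q (t [^] i)" if x: "x \<in> T" for x
    proof -
      have "?q x \<in> generate (G Mod K) {?q t}" using D(2) t(2) x by blast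
      then obtain i :: nat where "?q x = ?q t [^]\<^bsub>G Mod K\<^esub> i"
        using q.H.generate_pow_on_finite_carrier[OF finQ q.hom_closed[OF tG]] by blast
      then show ?thesis using K.FactGroup_pow[OF tG] by auto
    qed
    have tK: "t \<notin> K"
    proof
      assume "t \<in> K"
      have "x \<in> K" if x: "x \<in> T" for x
      proof -
        obtain i :: nat where "?q x = ?q (t [^] i)" using gen[OF x] by blast
        then have "?q x = K"
          using coset_eq_iff[OF sK nat_pow_closed[OF tG]] subgroup_nat_pow_closed[OF sK \<open>t \<in> K\<close>] by simp
        then show ?thesis using coset_eq_iff[OF sK TG[OF x]] by simp
      qed
      then show False using False by blast
    qed
    have q_mult: "?q (x \<otimes> y) = ?q (x' \<otimes> y')"
      if "?q x = ?q x'" "?q y = ?q y'" "x \<in> carrier G" "y \<in> carrier G" "x' \<in> carrier G" "y' \<in> carrier G" for x y x' y'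
      using that by (simp del: mult_FactGroup add: q.hom_mult)
    have q_pow: "?q (x [^] n) = ?q (y [^] n)" if "?q x = ?q y" "x \<in> carrier G" "y \<in> carrier G" for x y and n :: nat
      using that K.FactGroup_pow[of x n] K.FactGroup_pow[of y n] by simp
    define S where "S = {x \<in> T. \<exists>i::nat. ?q x = ?q (t [^] (q * i))}"
    have S: "subgroup S G"
    proof (rule subgroupI)
      show "S \<subseteq> carrier G" using TG by (auto simp: S_def)
      have "\<one> \<in> S" using subgroup.one_closed[OF T(1)] by (auto simp: S_def intro: exI[of _ 0])
      then show "S \<noteq> {}" by blast
      show "x \<otimes> y \<in> S" if x: "x \<in> S" and y: "y \<in> S" for x y
      proof -
        obtain i :: nat where i: "x \<in> T" "?q x = ?q (t [^] (q * i))" using x by (auto simp: S_def)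
        obtain j :: nat where j: "y \<in> T" "?q y = ?q (t [^] (q * j))" using y by (auto simp: S_def)
        have "?q (x \<otimes> y) = ?q (t [^] (q * i) \<otimes> t [^] (q * j))"
          by (rule q_mult[OF i(2) j(2)]) (use TG i j tG in auto)
        also have "\<dots> = ?q (t [^] (q * (i + j)))" using tG by (simp add: nat_pow_mult distrib_left)
        finally show ?thesis using subgroup.m_closed[OF T(1) i(1) j(1)] by (auto simp: S_def)
      qed
      show "inv x \<in> S" if x: "x \<in> S" for x
      proof -
        obtain i :: nat where i: "x \<in> T" "?q x = ?q (t [^] (q * i))" using x by (auto simp: S_def)
        have xG: "x \<in> carrier G" using TG i by blast
        \<comment> \<open>To keep exponents natural, the inverse is written as the power with
          exponent \<open>order G - 1\<close>.\<close>
        obtain n where n: "order G = Suc n" using order_pos[OF fin] gr0_implies_Suc by blast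
        have "x [^] n \<otimes> x = \<one>" using pow_order_eq_1[OF xG] n by simp
        then have inv_eq: "inv x = x [^] n" using xG by (intro inv_equality) simp_all
        have "?q (inv x) = ?q ((t [^] (q * i)) [^] n)"
          using q_pow[OF i(2) xG nat_pow_closed[OF tG], of n] by (simp only: inv_eq)
        also have "\<dots> = ?q (t [^] (q * (i * n)))" using tG by (simp add: nat_pow_pow mult.assoc)
        finally show ?thesis using subgroup.m_inv_closed[OF T(1) i(1)] by (auto simp: S_def)
      qed
    qed
    have "U \<subseteq> normalizing S"
    proof
      fix u assume u: "u \<in> U"
      have uG: "u \<in> carrier G" using u subgroup.mem_carrier[OF U] by blast
      have uT: "u \<otimes> x \<otimes> inv u \<in> T" if "x \<in> T" for x using u that T(4) by (auto simp: normalizing_def)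
      have "u \<otimes> x \<otimes> inv u \<in> S" if x: "x \<in> S" for x
      proof -
        obtain i :: nat where i: "x \<in> T" "?q x = ?q (t [^] (q * i))" using x by (auto simp: S_def)
        obtain j :: nat where j: "?q (u \<otimes> t \<otimes> inv u) = ?q (t [^] j)" using gen[OF uT[OF t(1)]] by blast
        have xG: "x \<in> carrier G" using TG i by blast
        have "?q (u \<otimes> x \<otimes> inv u) = ?q (u \<otimes> t [^] (q * i) \<otimes> inv u)"
          by (intro q_mult i(2)) (use uG xG tG in auto)
        also have "\<dots> = ?q ((u \<otimes> t \<otimes> inv u) [^] (q * i))" using conj_pow[OF uG tG] by simp
        also have "\<dots> = ?q ((t [^] j) [^] (q * i))" by (rule q_pow[OF j]) (use uG tG in auto)
        also have "\<dots> = ?q (t [^] (q * (i * j)))" using tG by (simp add: nat_pow_pow mult.commute mult.left_commute)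
        finally show ?thesis using uT[OF i(1)] by (auto simp: S_def)
      qed
      then show "u \<in> normalizing S" using uG by (simp add: normalizing_def)
    qed
    moreover have "card T = q * card S"
    proof -
      let ?T = "G\<lparr>carrier := T\<rparr>"
      interpret TT: group ?T using subgroup_imp_group[OF T(1)] .
      have ST: "S \<subseteq> T" by (auto simp: S_def)
      have nS: "S \<lhd> ?T"
      proof (rule TT.normal_invI)
        show "subgroup S ?T" using subgroup_incl[OF S T(1) ST] .
        show "x \<otimes>\<^bsub>?T\<^esub> s \<otimes>\<^bsub>?T\<^esub> inv\<^bsub>?T\<^esub> x \<in> S" if "x \<in> carrier ?T" "s \<in> S" for x s
          using that \<open>U \<subseteq> normalizing S\<close> T(3) by (auto simp: normalizing_def m_inv_consistent[OF T(1)])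
      qed
      have "order ?T = q * card S"
      proof (rule TT.prime_index_if_coset_generator[OF _ nS q])
        show "finite (carrier ?T)" using fin subgroup.subset[OF T(1)] finite_subset by auto
        show "t \<in> carrier ?T" using t by simp
        show "t \<notin> S"
        proof
          assume "t \<in> S"
          then obtain i :: nat where i: "?q t = ?q (t [^] (q * i))" by (auto simp: S_def)
          have tq: "t [^] (q ^ c) \<in> K"
            using subgroup_pow_card[OF T(1) t(1)] T(5) K.one_closed by simp
          \<comment> \<open>If \<open>t\<close> agrees with \<open>t [^] (q * i)\<close> modulo
            \<open>K\<close>, then \<open>t [^] (q * i - 1)\<close> lies in \<open>K\<close>. This
            exponent is prime to \<open>q\<close> and \<open>t\<close> has \<open>q\<close>-power
            order, so \<open>t\<close> would lie in \<open>K\<close>. For \<open>q * i = 0\<close>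
            there is no predecessor, but then \<open>t \<in> K\<close> at once.\<close>
          show False
          proof (cases "q * i")
            case 0
            have "?q t = K" using i unfolding 0 nat_pow_0 coset_mult_one[OF K.subset] .
            then show False using coset_eq_iff[OF sK tG] tK by blast
          next
            case (Suc n)
            have "t [^] (q * i) \<otimes> inv t \<in> K" by (rule coset_mem[OF sK _ tG i[symmetric]]) (use tG in simp)
            then have "t [^] n \<in> K" unfolding Suc using tG by (simp add: group_normalize)
            moreover have "coprime n (q ^ c)"
            proof -
              have "coprime n (Suc n)" by (rule coprime_Suc_right_nat)
              then show ?thesis unfolding Suc[symmetric] by simp
            qed
            ultimately show False using coprime_pow_mem[OF sK tG _ tq] tK by blast
          qed
        qed
        show "t [^]\<^bsub>?T\<^esub> q \<in> S"
          using subgroup_nat_pow_closed[OF T(1) t(1), of q]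
          by (auto simp: S_def simp flip: nat_pow_consistent intro!: exI[of _ 1])
        show "\<exists>i::nat. S #>\<^bsub>?T\<^esub> x = S #>\<^bsub>?T\<^esub> t [^]\<^bsub>?T\<^esub> i" if x: "x \<in> carrier ?T" for x
        proof -
          have xT: "x \<in> T" using x by simp
          obtain i :: nat where i: "?q x = ?q (t [^] i)" using gen[OF xT] by blast
          let ?s = "x \<otimes> inv (t [^] i)"
          have tiG: "t [^] i \<in> carrier G" using tG by simp
          have "?s \<in> K" by (rule coset_mem[OF sK TG[OF xT] tiG i])
          then have "?q ?s = ?q (t [^] (q * 0))"
            using coset_eq_iff[OF sK, of ?s] coset_eq_iff[OF sK one_closed] K.one_closed TG[OF xT] tiG by simp
          moreover have "?s \<in> T"
            using xT subgroup_nat_pow_closed[OF T(1) t(1)] subgroup.m_closed[OF T(1)] subgroup.m_inv_closed[OF T(1)]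
            by blast
          ultimately have s: "?s \<in> S" unfolding S_def by blast
          have "S #> (?s \<otimes> t [^] i) = S #> t [^] i"
            using coset_mult_assoc[OF subgroup.subset[OF S], of ?s "t [^] i"]
              coset_eq_iff[OF S, of ?s] s TG[OF xT] tiG by simp
          then show ?thesis using TG[OF xT] tiG by (auto simp: group_normalize simp flip: nat_pow_consistent)
        qed
      qed
      then show ?thesis by (simp add: order_def)
    qed
    moreover have "S \<subseteq> T" by (auto simp: S_def)
    ultimately show ?thesis using S by blast
  qed
qed

end

section \<open>Permutizers of Sylow subgroups\<close>

context nilpotent_by_nilpotent
begin

text \<open>Elements normalizing \<open>P\<close> permute with it, which covers
  \<open>primary p\<close>. For \<open>q \<noteq> p\<close> a normal \<open>T\<close> in
  \<open>primary q\<close> is reached by induction on its order: since \<open>S\<close> has prime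
  index, one permuting \<open>x\<close> outside \<open>S\<close> completes it. Supersolubility is
  isolated in \<open>maximal\<close>, so that the lemma can be used inside a subgroup.\<close>

lemma permutizer_sylow:
  assumes p: "Factorial_Ring.prime p" and P: "sylow_sub p P"
    and maximal: "\<And>q T c. Factorial_Ring.prime q \<Longrightarrow> T \<lhd> G \<Longrightarrow> card T = q ^ c \<Longrightarrow> T \<noteq> {\<one>} \<Longrightarrow>
      \<exists>S. S \<lhd> G \<and> S \<subseteq> T \<and> card T = q * card S"
  shows "permutizer G P = carrier G"
proof -
  have PG: "subgroup P G" and cP: "card P = p ^ multiplicity p (order G)"
    using P by (auto simp: sylow_sub_def)
  let ?A = "{x \<in> carrier G. generate G {x} <#> P = P <#> generate G {x}}"
  have Z: "subgroup (permutizer G P) G"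
    unfolding permutizer_def by (rule generate_is_subgroup) blast
  have AZ: "?A \<subseteq> permutizer G P" unfolding permutizer_def by (rule subsetI, rule generate.incl)
  have sgen: "subgroup (generate G {x}) G" if "x \<in> carrier G" for x
    using generate_is_subgroup that by simp
  have norm: "normalizing P \<subseteq> permutizer G P"
  proof
    fix x assume x: "x \<in> normalizing P"
    have xG: "x \<in> carrier G" using x by (simp add: normalizing_def)
    have "generate G {x} \<subseteq> normalizing P"
      using generate_subgroup_incl[OF _ normalizing_subgroup[OF fin PG]] x by simp
    then have "P <#> generate G {x} = generate G {x} <#> P"
      by (rule normalizing_set_mult_commute[OF PG sgen[OF xG]])
    then have "x \<in> ?A" using xG by simp
    then show "x \<in> permutizer G P" using AZ by blast
  qed
  have prim: "T \<subseteq> permutizer G P"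
    if q: "Factorial_Ring.prime q" "q \<noteq> p" and T: "T \<lhd> G" "T \<subseteq> primary q" for q T
    using T
  proof (induction "card T" arbitrary: T rule: less_induct)
    case less
    have sT: "subgroup T G" using less.prems normal_imp_subgroup by blast
    show ?case
    proof (cases "T = {\<one>}")
      case True
      then show ?thesis using subgroup.one_closed[OF Z] by simp
    next
      case False
      obtain c where c: "card T = q ^ c" using prime_power_sub_primary[OF q(1) sT less.prems(2)] by blast
      obtain S where S: "S \<lhd> G" "S \<subseteq> T" "card T = q * card S"
        using maximal[OF q(1) less.prems(1) c False] by blast
      have sS: "subgroup S G" using S(1) normal_imp_subgroup by blast
      have "card S < card T" using S(3) card_pos[OF fin sS] prime_gt_1_nat[OF q(1)] by simp
      moreover have "S \<subseteq> primary q" using S(2) less.prems(2) by blast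
      ultimately have SZ: "S \<subseteq> permutizer G P" using less.hyps S(1) by blast
      obtain x where x: "x \<in> T - S"
        and inv: "\<forall>u\<in>P. \<forall>y\<in>generate G {x}. u \<otimes> y \<otimes> inv u \<in> generate G {x}"
        using exists_normalized_cyclic[OF fin p q PG cP less.prems(1) c S] by blast
      have xG: "x \<in> carrier G" using x subgroup.mem_carrier[OF sT] by blast
      have "P \<subseteq> normalizing (generate G {x})"
        using inv subgroup.subset[OF PG] unfolding normalizing_def by blast
      then have "generate G {x} <#> P = P <#> generate G {x}"
        by (rule normalizing_set_mult_commute[OF sgen[OF xG] PG])
      then have "x \<in> ?A" using xG by simp
      then have xZ: "x \<in> permutizer G P" using AZ by blast
      show ?thesis
      proof
        fix y assume y: "y \<in> T"
        let ?T = "G\<lparr>carrier := T\<rparr>"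
        interpret TT: group ?T using subgroup_imp_group[OF sT] .
        have yG: "y \<in> carrier G" using y subgroup.mem_carrier[OF sT] by blast
        have "finite (carrier ?T)" using fin subgroup.subset[OF sT] finite_subset by auto
        moreover have "S \<lhd> ?T" using normal_restrict_supergroup[OF sT S(1,2)] .
        ultimately obtain i :: nat where "S #> y = S #> x [^] i"
          using TT.coset_generator_if_prime_index[of S q x y] q(1) S(3) x y
          by (auto simp: order_def simp flip: nat_pow_consistent)
        then have "y \<otimes> inv (x [^] i) \<in> S"
          using coset_mem[OF sS yG nat_pow_closed[OF xG]] by blast
        then have "y \<otimes> inv (x [^] i) \<otimes> x [^] i \<in> permutizer G P"
          using SZ subgroup_nat_pow_closed[OF Z xZ] subgroup.m_closed[OF Z] by blast
        then show "y \<in> permutizer G P" using xG yG by (simp add: group_normalize)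
      qed
    qed
  qed
  have "F \<subseteq> permutizer G P"
  proof (rule subgroup_containing_primaries[OF Z])
    fix q :: nat assume q: "Factorial_Ring.prime q"
    show "primary q \<subseteq> permutizer G P"
    proof (cases "q = p")
      case True
      then show ?thesis
        using primary_le_sylow[OF p P] subgroup_le_normalizing[OF PG] norm by blast
    next
      case False
      then show ?thesis using prim[OF q _ primary_normal[OF q]] by blast
    qed
  qed
  then have "carrier G \<subseteq> permutizer G P"
    using frattini[OF p P] norm subgroup.m_closed[OF Z] by (metis subsetD subsetI)
  then show ?thesis using subgroup.subset[OF Z] by blast
qed

text \<open>The locale is applied to \<open>U\<close> in place of \<open>G\<close>, while
  \<open>maximal\<close> comes from the series of \<open>G\<close>, with \<open>U\<close> acting on
  its normal subgroup \<open>T\<close>.\<close>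

lemma permutizer_sylow_in_supersoluble:
  assumes super: "supersoluble G" and p: "Factorial_Ring.prime p" and P: "sylow_sub p P"
    and U: "subgroup U G" "P \<subseteq> U"
  shows "permutizer (G\<lparr>carrier := U\<rparr>) P = U"
proof -
  let ?U = "G\<lparr>carrier := U\<rparr>"
  interpret U: nilpotent_by_nilpotent ?U "F \<inter> U" using restrict_subgroup[OF U(1)] .
  have "permutizer ?U P = carrier ?U"
  proof (rule U.permutizer_sylow[OF p sylow_sub_in_subgroup[OF fin p U(1) P U(2)]])
    fix q c :: nat and T assume q: "Factorial_Ring.prime q" and T: "T \<lhd> ?U" "card T = q ^ c" "T \<noteq> {\<one>\<^bsub>?U\<^esub>}"
    have TU: "subgroup T ?U" using T(1) normal_imp_subgroup by blast
    have T_le: "T \<subseteq> U" using subgroup.subset[OF TU] by simp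
    have sT: "subgroup T G" using incl_subgroup[OF U(1) TU] .
    have "T \<subseteq> carrier G" using subgroup.subset[OF sT] .
    moreover have "U \<subseteq> normalizing T"
      using normal.inv_op_closed2[OF T(1)] subgroup.mem_carrier[OF U(1)]
      by (auto simp: normalizing_def m_inv_consistent[OF U(1)])
    ultimately obtain S where S: "subgroup S G" "S \<subseteq> T" "U \<subseteq> normalizing S" "card T = q * card S"
      using supersoluble_seq_invariant_maximal[OF fin super[unfolded supersoluble_def] U(1) q sT _ T_le _ T(2)] T(3)
      by auto
    have "S \<lhd> ?U"
    proof (rule U.normal_invI)
      show "subgroup S ?U" using subgroup_incl[OF S(1) U(1)] S(2) T_le by blast
      show "x \<otimes>\<^bsub>?U\<^esub> h \<otimes>\<^bsub>?U\<^esub> inv\<^bsub>?U\<^esub> x \<in> S" if "x \<in> carrier ?U" "h \<in> S" for x h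
        using that S(3) by (auto simp: normalizing_def m_inv_consistent[OF U(1)])
    qed
    then show "\<exists>S. S \<lhd> ?U \<and> S \<subseteq> T \<and> card T = q * card S" using S by blast
  qed
  then show ?thesis by simp
qed

end

lemma (in group) sylow_subgroup_iff:
  "sylow_subgroup P G \<longleftrightarrow> (\<exists>p. Factorial_Ring.prime p \<and> sylow_sub p P)"
  by (auto simp: sylow_subgroup_def sylow_sub_def)

theorem theorem3p2:
  fixes G :: "('a, 'b) monoid_scheme"
  assumes "group G"
    and "finite (carrier G)"
    and "metanilpotent G"
  shows "(supersoluble G \<longleftrightarrow> (\<forall>P. sylow_subgroup P G \<longrightarrow> strongly_permuteral P G)) \<and>
         ((\<forall>P. sylow_subgroup P G \<longrightarrow> strongly_permuteral P G) \<longleftrightarrow>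
          (\<forall>P. sylow_subgroup P G \<longrightarrow> permuteral P G))"
proof -
  interpret group G by fact
  obtain F where F: "F \<lhd> G" "nilpotent_group (G\<lparr>carrier := F\<rparr>)" "nilpotent_group (G Mod F)"
    using assms(3) unfolding metanilpotent_def by blast
  interpret nilpotent_by_nilpotent G F
  proof (intro nilpotent_by_nilpotent.intro nilpotent_by_nilpotent_axioms.intro)
    show "coprime_commuting F" using nilpotent_Mod_coprime_commuting F by blast
    show "x \<otimes>\<^bsub>G\<^esub> y = y \<otimes>\<^bsub>G\<^esub> x"
      if "x \<in> F" "y \<in> F" "x [^]\<^bsub>G\<^esub> (m::nat) = \<one>\<^bsub>G\<^esub>" "y [^]\<^bsub>G\<^esub> (n::nat) = \<one>\<^bsub>G\<^esub>" "coprime m n" for x y m n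
      using nilpotent_subgroup_coprime_commute[OF normal_imp_subgroup[OF F(1)] F(2)] that by blast
  qed (fact assms F)+
  have strong: "strongly_permuteral P G" if "supersoluble G" "sylow_subgroup P G" for P
    using that permutizer_sylow_in_supersoluble
    by (auto simp: sylow_subgroup_iff strongly_permuteral_def sylow_sub_def)
  have weak: "permuteral P G" if "strongly_permuteral P G" for P
  proof -
    have P: "subgroup P G" using that by (simp add: strongly_permuteral_def)
    \<comment> \<open>The choice \<open>U = carrier G\<close>, for which the record update changes
      nothing.\<close>
    then have "permutizer (G\<lparr>carrier := carrier G\<rparr>) P = carrier G"
      using that subgroup_self subgroup.subset[OF P] unfolding strongly_permuteral_def by blast
    then show ?thesis using P by (simp add: permuteral_def)
  qed
  have super: "supersoluble G" if "\<forall>P. sylow_subgroup P G \<longrightarrow> permuteral P G"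
    using supersoluble_if_permuteral[OF F(3)] that sylow_subgroup_iff by blast
  show ?thesis using strong weak super by blast
qed

end
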